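(* For all $0<r<\infty$ and all $m\in\mathbb{N}$, the optimal constant $K_{m,r}$ in the multiple Khintchine inequality equals $(\mathrm{A}_r)^m$. Explicitly: $K_{m,r}=1$ for $r\ge2$; $K_{m,r}=\left(2^{\frac1r-\frac12}\right)^m$ for $0<r\le p_0$; and $K_{m,r}=\left(\frac{1}{\sqrt2}\left(\frac{\Gamma(\frac{r+1}{2})}{\sqrt\pi}\right)^{-1/r}\right)^m$ for $p_0<r<2$.
   Context: $r_j(t)=\operatorname{sign}(\sin(2^j\pi t))$, $t\in[0,1]$, are the Rademacher functions. For $0<r<\infty$, $\mathrm{A}_r$ is the optimal constant such that $\left(\sum_{j=1}^n|a_j|^2\right)^{1/2}\le \mathrm{A}_r\left(\int_0^1|\sum_{j=1}^n a_jr_j(t)|^rdt\right)^{1/r}$ for all $n$ and real $a_j$. It is known (Haagerup) that $\mathrm{A}_r=1$ for $r\ge2$, $\mathrm{A}_r=2^{\frac1r-\frac12}$ for $0<r\le p_0$, and $\mathrm{A}_r=\frac{1}{\sqrt2}\left(\frac{\Gamma(\frac{r+1}{2})}{\sqrt\pi}\right)^{-1/r}$ for $p_0<r<2$, where $p_0\in(1,2)$ ($p_0\approx1.85$) is the unique solution of $\Gamma\left(\frac{p_0+1}{2}\right)=\frac{\sqrt\pi}{2}$. $K_{m,r}$ denotes the smallest constant $K$ such that for all $N\in\mathbb{N}$ and all real arrays $(y_{i_1\dots i_m})_{i_1,\dots,i_m=1}^N$, $\left(\sum_{i_1,\dots,i_m=1}^N|y_{i_1\dots i_m}|^2\right)^{1/2}\le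 K\left(\int_{[0,1]^m}\left|\sum_{i_1,\dots,i_m=1}^N r_{i_1}(t_1)\cdots r_{i_m}(t_m)y_{i_1\dots i_m}\right|^r dt_1\cdots dt_m\right)^{1/r}$. *)

theory Defs
  imports "HOL-Analysis.Analysis"
begin

definition rademacher :: "nat \<Rightarrow> real \<Rightarrow> real" where
  "rademacher j t = sgn (sin (2 ^ j * pi * t))"

definition unit_meas :: "real measure" where
  "unit_meas = restrict_space lborel {0..1}"

definition khintchine_ok :: "real \<Rightarrow> real \<Rightarrow> bool" where
  "khintchine_ok r A \<longleftrightarrow> (\<forall>(n::nat) (a::nat \<Rightarrow> real).
     sqrt (\<Sum>j=1..n. (a j)\<^sup>2) \<le>
       A * (\<integral>t. \<bar>\<Sum>j=1..n. a j * rademacher j t\<bar> powr r \<partial>unit_meas) powr (1 / r))"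

definition A_const :: "real \<Rightarrow> real" where
  "A_const r = Inf {A. khintchine_ok r A}"

definition multi_idx :: "nat \<Rightarrow> nat \<Rightarrow> (nat \<Rightarrow> nat) set" where
  "multi_idx m N = PiE {..<m} (\<lambda>_. {1..N})"

definition multi_khintchine_ok :: "nat \<Rightarrow> real \<Rightarrow> real \<Rightarrow> bool" where
  "multi_khintchine_ok m r K \<longleftrightarrow> (\<forall>(N::nat) (y::(nat \<Rightarrow> nat) \<Rightarrow> real).
     sqrt (\<Sum>i\<in>multi_idx m N. (y i)\<^sup>2) \<le>
       K * (\<integral>t. \<bar>\<Sum>i\<in>multi_idx m N. (\<Prod>k<m. rademacher (i k) (t k)) * y i\<bar> powr r
              \<partial>(PiM {..<m} (\<lambda>_. unit_meas))) powr (1 / r))"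

definition K_const :: "nat \<Rightarrow> real \<Rightarrow> real" where
  "K_const m r = Inf {K. multi_khintchine_ok m r K}"

definition p0 :: real where
  "p0 = (THE p. 1 < p \<and> p < 2 \<and> Gamma ((p + 1) / 2) = sqrt pi / 2)"

end

theory Submission
  imports Defs "HOL-Probability.Probability" "HOL-Real_Asymp.Real_Asymp"
begin

text \<open>The one-dimensional constants are found along the lines of Nazarov and Podkorytov. For \<open>0 < p < 2\<close>,
  \<open>\<bar>x\<bar> powr p\<close> is a constant multiple of the integral of \<open>(1 - cos (x * u)) * u powr (- p - 1)\<close> over \<open>u > 0\<close>, so the \<open>p\<close>-th moment of a
  Rademacher sum is governed by a product of cosines \<open>cos (b\<^sub>j * u)\<close>. When the squares of the \<open>b\<^sub>j\<close> sum to 1, weighted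
  AM-GM bounds this product by the average of \<open>\<bar>cos (b\<^sub>j * u)\<bar> powr s\<close>, \<open>s = 1 / b\<^sub>j\<^sup>2\<close>, with weights \<open>b\<^sub>j\<^sup>2\<close>.
  If moreover all \<open>b\<^sub>j\<^sup>2 \<le> 1/2\<close>, comparison with a Gaussian reduces to the positivity of the
  integral of \<open>(exp (- s * u\<^sup>2 / 2) - \<bar>cos u\<bar> powr s) * u powr (- p - 1)\<close> for \<open>s \<ge> 2\<close>. The distribution functions of
  \<open>exp (- u\<^sup>2 / 2)\<close> and \<open>\<bar>cos u\<bar>\<close> under the density \<open>u powr (- p - 1)\<close> cross only once, so it is enough to know this for \<open>s = 2\<close>,
  which is the condition \<open>p \<ge> p\<^sub>0\<close>. A dominating coefficient is dealt with by an induction on the number of terms, and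
  exponents below \<open>p\<^sub>0\<close> by interpolating \<open>p\<^sub>0\<close> between \<open>p\<close> and 2.

  The multiple inequality follows by iterating the one-dimensional one with Minkowski's inequality, and tensor powers of
  one-dimensional coefficients show that the constant cannot be improved.\<close>

subsection \<open>Averages over random signs\<close>

text \<open>Two competitors decide the constant for \<open>p < 2\<close>:
  \<open>2 powr (p / 2 - 1)\<close>, the p-th moment of two equal coefficients of square sum 1, and
  \<open>normal_moment p\<close>, the limit for n equal coefficients. They coincide at
  \<open>p0\<close>, so there the Gaussian bound is also attained by two coefficients; this is why
  interpolating with the exponent 2 stays sharp below \<open>p0\<close>. The bound 1/2 on the
  squares is forced by AM-GM: it produces the exponents s = 1 / b_j^2, and the Gaussian comparison
  starts only at s = 2. A dominating coefficient gives s < 2, where the integral method says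
  nothing, so that case needs an argument of another kind. The single crossing depends on
  quantitative estimates for the cosine, which are proved for p \<ge> 17/10. Hence the numerical
  part on the Gamma function: it shows that \<open>p0\<close> lies in this range. In the multiple
  inequality Minkowski is applied with exponent 2/r and so requires r \<le> 2. For larger r the
  inequality for r = 2, whose constant is 1, is followed by Jensen.\<close>

text \<open>\<open>sgn_avg \<phi> as x\<close> is the expectation of \<open>\<phi> (x + \<Sum>j. \<epsilon>\<^sub>j a\<^sub>j)\<close> for independent random signs \<open>\<epsilon>\<^sub>j\<close>.\<close>

primrec sgn_avg :: "(real \<Rightarrow> real) \<Rightarrow> real list \<Rightarrow> real \<Rightarrow> real" where
  "sgn_avg \<phi> [] x = \<phi> x"
| "sgn_avg \<phi> (a # as) x = (sgn_avg \<phi> as (x + a) + sgn_avg \<phi> as (x - a)) / 2"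

abbreviation sgn_moment :: "real \<Rightarrow> real list \<Rightarrow> real \<Rightarrow> real" where
  "sgn_moment p \<equiv> sgn_avg (\<lambda>x. \<bar>x\<bar> powr p)"

abbreviation sq_sum :: "real list \<Rightarrow> real" where
  "sq_sum as \<equiv> (\<Sum>a\<leftarrow>as. a\<^sup>2)"

lemma sgn_avg_mono:
  assumes "\<And>x. \<phi> x \<le> \<psi> x"
  shows "sgn_avg \<phi> as x \<le> sgn_avg \<psi> as x"
  by (induction as arbitrary: x) (auto intro!: divide_right_mono add_mono assms)

lemma sgn_avg_add: "sgn_avg (\<lambda>x. \<phi> x + \<psi> x) as x = sgn_avg \<phi> as x + sgn_avg \<psi> as x"
  by (induction as arbitrary: x) (auto simp: field_simps)

lemma sgn_avg_cmult: "sgn_avg (\<lambda>x. c * \<phi> x) as x = c * sgn_avg \<phi> as x"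
  by (induction as arbitrary: x) (auto simp: field_simps)

lemma sgn_avg_const [simp]: "sgn_avg (\<lambda>x. c) as x = c"
  by (induction as arbitrary: x) auto

lemma sgn_avg_nonneg: "(\<And>x. 0 \<le> \<phi> x) \<Longrightarrow> 0 \<le> sgn_avg \<phi> as x"
  using sgn_avg_mono[of "\<lambda>_. 0" \<phi> as x] by simp

lemma sgn_avg_square: "sgn_avg (\<lambda>x. x\<^sup>2) as x = x\<^sup>2 + sq_sum as"
  by (induction as arbitrary: x) (auto simp: field_simps power2_eq_square)

lemma sgn_avg_cos: "sgn_avg (\<lambda>x. cos (x * t)) as x = cos (x * t) * (\<Prod>a\<leftarrow>as. cos (a * t))"
  by (induction as arbitrary: x) (auto simp: algebra_simps cos_add cos_diff)

lemma sgn_avg_uminus: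
  assumes "\<And>x. \<phi> (- x) = \<phi> x"
  shows "sgn_avg \<phi> as (- x) = sgn_avg \<phi> as x"
proof (induction as arbitrary: x)
  case (Cons a as)
  have "- x + a = - (x - a)" "- x - a = - (x + a)" by auto
  then have "sgn_avg \<phi> as (- x + a) = sgn_avg \<phi> as (x - a)" "sgn_avg \<phi> as (- x - a) = sgn_avg \<phi> as (x + a)"
    using Cons by metis+
  then show ?case by simp
qed (use assms in auto)

lemma sgn_avg_swap: "sgn_avg \<phi> (a # b # as) x = sgn_avg \<phi> (b # a # as) x"
  by (simp add: add_divide_distrib algebra_simps)

lemma sgn_avg_move: "sgn_avg \<phi> (as @ a # bs) x = sgn_avg \<phi> (a # as @ bs) x"
proof (induction as arbitrary: x)
  case (Cons c as)
  have "sgn_avg \<phi> ((c # as) @ a # bs) x = sgn_avg \<phi> (c # a # as @ bs) x"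
    by (simp only: append_Cons sgn_avg.simps(2)[of _ c] Cons)
  then show ?case by (simp only: sgn_avg_swap append_Cons)
qed simp

text \<open>If e and e' are independent random signs, so are e and e e', and e a + e' b = e (a + (e
  e') b). Trading two coefficients for a + b or a - b shortens the list, which drives the induction
  on the number of terms.\<close>

lemma sgn_avg_merge:
  "sgn_avg \<phi> (a # b # as) x = (sgn_avg \<phi> ((a + b) # as) x + sgn_avg \<phi> ((a - b) # as) x) / 2"
  by (simp add: add_divide_distrib algebra_simps)

lemma sgn_avg_scale:
  "sgn_avg \<phi> (map (\<lambda>a. c * a) as) (c * x) = sgn_avg (\<lambda>x. \<phi> (c * x)) as x"
  by (induction as arbitrary: x) (auto simp flip: distrib_left right_diff_distrib)

text \<open>For an even function a global change of signs is invisible, so one random sign can be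
  fixed. A coefficient thus becomes a starting point, and after scaling the starting point
  1.\<close>

lemma sgn_avg_start:
  assumes "\<And>x. \<phi> (- x) = \<phi> x"
  shows "sgn_avg \<phi> (a # as) 0 = sgn_avg \<phi> as a"
  using sgn_avg_uminus[of \<phi> as a] assms by simp

lemma sgn_avg_powr_scale:
  "sgn_moment p (map (\<lambda>a. c * a) as) (c * x)
     = \<bar>c\<bar> powr p * sgn_moment p as x"
  unfolding sgn_avg_scale by (simp add: abs_mult powr_mult sgn_avg_cmult)

lemma sgn_avg_powr_scale0:
  "sgn_moment p (map (\<lambda>a. c * a) as) 0
     = \<bar>c\<bar> powr p * sgn_moment p as 0"
  using sgn_avg_powr_scale[of p c as 0] by simp

lemma sq_sum_scale: "sq_sum (map (\<lambda>a. c * a) as) = c\<^sup>2 * sq_sum as"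
  by (induction as) (auto simp: algebra_simps power2_eq_square)

lemma sq_sum_nonneg: "0 \<le> sq_sum as"
  by (induction as) auto

subsection \<open>A two-point inequality\<close>

text \<open>The logarithm of (1 + a)^s - (1 - a)^s is concave in s, hence at s = r it lies below its
  tangent at s = 1. There the difference is 2 a and the logarithmic derivative is the entropy
  quotient in the exponent. The form \<open>alt\<close> of \<open>f'\<close> makes the concavity
  visible.\<close>

lemma ln_diff_powr_bound:
  fixes r a :: real
  assumes r: "0 < r" "r \<le> 1" and a: "0 < a" "a < 1"
  shows "((1 + a) powr r - (1 - a) powr r) / (2 * a)
    \<le> exp ((r - 1) * (((1 + a) * ln (1 + a) - (1 - a) * ln (1 - a)) / (2 * a)))"
proof -
  let ?E = "((1 + a) * ln (1 + a) - (1 - a) * ln (1 - a)) / (2 * a)"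
  define P where "P = ln (1 + a)"
  define Q where "Q = ln (1 - a)"
  define f where "f = (\<lambda>s. ln (exp (P * s) - exp (Q * s)))"
  have PQ: "Q < P" unfolding P_def Q_def using a by simp
  have eP: "exp P = 1 + a" "exp Q = 1 - a" using a by (auto simp: P_def Q_def)
  have pos: "exp (P * s) - exp (Q * s) > 0" if "0 < s" for s using PQ that by simp
  define f' where "f' = (\<lambda>s. (P * exp (P * s) - Q * exp (Q * s)) / (exp (P * s) - exp (Q * s)))"
  have df: "(f has_real_derivative f' s) (at s)" if "0 < s" for s
    unfolding f_def f'_def using pos[OF that]
    by (auto intro!: derivative_eq_intros simp: field_simps)
  have mono: "f' 1 \<le> f' s" if s: "0 < s" "s \<le> 1" for s
  proof -
    have split: "(P * E + D) / E = P + D / E" if "E > 0" for E D :: real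
      using that by (simp add: field_simps)
    have alt: "f' t = P + (P - Q) / (exp ((P - Q) * t) - 1)" if "0 < t" for t
    proof -
      have e: "exp (P * t) = exp (Q * t) * exp ((P - Q) * t)"
        by (simp add: algebra_simps flip: exp_add)
      have 1: "exp ((P - Q) * t) - 1 > 0" using PQ that by simp
      have "exp (P * t) - exp (Q * t) = exp (Q * t) * (exp ((P - Q) * t) - 1)"
        unfolding e by (simp add: algebra_simps)
      moreover have "P * exp (P * t) - Q * exp (Q * t)
          = exp (Q * t) * (P * (exp ((P - Q) * t) - 1) + (P - Q))"
        unfolding e by (simp add: algebra_simps)
      ultimately have "f' t = (P * (exp ((P - Q) * t) - 1) + (P - Q)) / (exp ((P - Q) * t) - 1)"
        unfolding f'_def by simp
      also have "\<dots> = P + (P - Q) / (exp ((P - Q) * t) - 1)"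
        by (rule split) (rule 1)
      finally show ?thesis .
    qed
    have "exp ((P - Q) * s) - 1 \<le> exp ((P - Q) * 1) - 1" "exp ((P - Q) * s) - 1 > 0"
      using PQ s mult_left_mono[of s 1 "P - Q"] by auto
    then show ?thesis unfolding alt[OF s(1)] alt[OF zero_less_one]
      using PQ by (intro add_left_mono divide_left_mono) auto
  qed
  have "f r \<le> f 1 + (r - 1) * f' 1"
  proof (cases "r = 1")
    case False
    obtain z where z: "z > r" "z < 1" "f 1 - f r = (1 - r) * f' z"
      using MVT2[of r 1 f f'] df r False by fastforce
    have "(1 - r) * f' 1 \<le> (1 - r) * f' z"
      using mono[of z] z r by (intro mult_left_mono) auto
    then show ?thesis using z by (simp add: algebra_simps)
  qed simp
  moreover have "f 1 = ln (2 * a)" by (simp add: f_def eP)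
  moreover have "f' 1 = ?E"
    by (simp add: f'_def eP, simp add: P_def Q_def algebra_simps)
  moreover have "(1 + a) powr r - (1 - a) powr r = exp (f r)"
    using pos[OF r(1)] a by (simp add: f_def powr_def P_def Q_def mult.commute)
  ultimately have "(1 + a) powr r - (1 - a) powr r
      \<le> exp (ln (2 * a) + (r - 1) * ?E)"
    by simp
  also have "\<dots> = 2 * a * exp ((r - 1) * ?E)"
    using a by (simp add: exp_add)
  finally show ?thesis using a by (simp add: divide_le_eq mult.commute)
qed

text \<open>The difference \<open>u\<close> of the two sides vanishes at 0, tends to 0 at 1 and is
  concave. A negative value at a would force a negative slope before a, and by concavity
  \<open>u\<close> would then never return to 0.\<close>

lemma entropy_diff_ge:
  fixes a :: real
  assumes a: "0 < a" "a < 1"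
  shows "a * ln (6 - 2 * a\<^sup>2) \<le> (1 + a) * ln (1 + a) - (1 - a) * ln (1 - a)"
proof (rule ccontr)
  define u where "u = (\<lambda>a::real. (1 + a) * ln (1 + a) - (1 - a) * ln (1 - a) - a * ln (6 - 2 * a\<^sup>2))"
  define u' where "u' = (\<lambda>a::real. ln (1 + a) + ln (1 - a) + 2 - ln (6 - 2 * a\<^sup>2) + 4 * a\<^sup>2 / (6 - 2 * a\<^sup>2))"
  define u'' where "u'' = (\<lambda>a::real. 1 / (1 + a) - 1 / (1 - a) + 4 * a / (6 - 2 * a\<^sup>2)
     + (8 * a * (6 - 2 * a\<^sup>2) + 4 * a\<^sup>2 * (4 * a)) / (6 - 2 * a\<^sup>2)\<^sup>2)"
  have sq: "6 - 2 * x\<^sup>2 > 0" if "0 \<le> x" "x < 1" for x :: real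
    using power_le_one[of x 2] that by simp
  have du: "(u has_real_derivative u' x) (at x)" if "0 \<le> x" "x < 1" for x
  proof -
    have "x * x < 1" using that abs_square_less_1[of x] by (simp add: power2_eq_square)
    then have "x * x < 3" "x * x \<noteq> 3" by auto
    then show ?thesis
      unfolding u_def u'_def using that
      by (auto intro!: derivative_eq_intros simp: power2_eq_square)
  qed
  have du': "(u' has_real_derivative u'' x) (at x)" if "0 \<le> x" "x < 1" for x
  proof -
    have "x * x < 1" using that abs_square_less_1[of x] by (simp add: power2_eq_square)
    then have "x * x < 3" "x * x \<noteq> 3" by auto
    then show ?thesis
      unfolding u''_def u'_def using that
      by (auto intro!: derivative_eq_intros simp: power2_eq_square)
  qed
  have u''_nonpos: "u'' x \<le> 0" if x: "0 \<le> x" "x < 1" for x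
  proof -
    have "1 - x\<^sup>2 > 0" "3 - x\<^sup>2 > 0" using sq[OF x] x abs_square_less_1[of x] by auto
    moreover have "1 / (1 + x) - 1 / (1 - x) = - 2 * x / (1 - x\<^sup>2)"
    proof -
      have "(1 + x) * (1 - x) = 1 - x\<^sup>2" by (simp add: algebra_simps power2_eq_square)
      then show ?thesis using x by (simp add: diff_frac_eq)
    qed
    moreover have "4 * x / (6 - 2 * x\<^sup>2) = 2 * x / (3 - x\<^sup>2)"
      using sq[OF x] by (simp add: divide_simps)
    moreover have "(8 * x * (6 - 2 * x\<^sup>2) + 4 * x\<^sup>2 * (4 * x)) / (6 - 2 * x\<^sup>2)\<^sup>2 = 12 * x / (3 - x\<^sup>2)\<^sup>2"
    proof -
      have "(6 - 2 * x\<^sup>2)\<^sup>2 = 4 * (3 - x\<^sup>2)\<^sup>2" by algebra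
      moreover have "8 * x * (6 - 2 * x\<^sup>2) + 4 * x\<^sup>2 * (4 * x) = 4 * (12 * x)" by algebra
      ultimately show ?thesis by simp
    qed
    moreover have "- 2 * x / (1 - x\<^sup>2) + 2 * x / (3 - x\<^sup>2) + 12 * x / (3 - x\<^sup>2)\<^sup>2
       = - (8 * x ^ 3) / ((1 - x\<^sup>2) * (3 - x\<^sup>2)\<^sup>2)"
      using calculation(1,2) by (simp add: divide_simps) algebra
    moreover have "- (8 * x ^ 3) / ((1 - x\<^sup>2) * (3 - x\<^sup>2)\<^sup>2) \<le> 0"
      using calculation(1,2) x by (auto intro!: divide_nonpos_pos)
    ultimately show ?thesis unfolding u''_def by linarith
  qed
  have u'_anti: "u' y \<le> u' x" if "0 \<le> x" "x \<le> y" "y < 1" for x y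
  proof (rule DERIV_nonpos_imp_nonincreasing[OF that(2)])
    fix z assume "x \<le> z" "z \<le> y"
    then have "0 \<le> z" "z < 1" using that by auto
    then show "\<exists>d. (u' has_real_derivative d) (at z) \<and> d \<le> 0" using du' u''_nonpos by blast
  qed
  assume "\<not> ?thesis"
  then have neg: "u a < 0" by (simp add: u_def)
  obtain z where z: "0 < z" "z < a" "u a - u 0 = (a - 0) * u' z"
    using MVT2[of 0 a u u'] du a by fastforce
  have "u' z < 0" using z neg a by (simp add: u_def zero_less_mult_iff mult_less_0_iff)
  have "u b \<le> u a" if "a \<le> b" "b < 1" for b
  proof (rule DERIV_nonpos_imp_nonincreasing[of a b])
    fix x assume "a \<le> x" "x \<le> b"
    then have "u' x \<le> 0" using u'_anti[of z x] z that \<open>u' z < 0\<close> by force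
    then show "\<exists>y. (u has_real_derivative y) (at x) \<and> y \<le> 0"
      using du[of x] that a \<open>a \<le> x\<close> \<open>x \<le> b\<close> by fastforce
  qed (use that in auto)
  then have "\<forall>\<^sub>F b in at_left 1. u b \<le> u a"
    using a by (intro eventually_at_leftI[of a]) auto
  moreover have "(u \<longlongrightarrow> 0) (at_left 1)"
  proof -
    have "(u \<longlongrightarrow> 2 * ln 2 - ln 4) (at_left 1)" unfolding u_def by real_asymp
    moreover have "ln 4 = 2 * ln (2::real)" using ln_realpow[of 2 2] by simp
    ultimately show ?thesis by simp
  qed
  ultimately have "0 \<le> u a"
    by (intro tendsto_upperbound[of u 0]) auto
  then show False using neg by simp
qed

text \<open>Base case of the induction: with q = p/2 it says that
  \<open>2 powr (p / 2 - 1) * reflected_powr q (a\<^sup>2)\<close> is at most the moment for the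
  coefficients 1 and a. The right side decreases in a, by the two preceding lemmas, and equals the
  left side at a = 1.\<close>

lemma two_term_base:
  fixes p a :: real
  assumes p: "1 < p" "p < 2" and a: "0 \<le> a" "a \<le> 1"
  shows "2 powr p \<le> ((1 + a) powr p + (1 - a) powr p) / 2 + 2 powr (p / 2 - 1) * (3 - a\<^sup>2) powr (p / 2)"
proof -
  define g where "g = (\<lambda>a. ((1 + a) powr p + (1 - a) powr p) / 2 + 2 powr (p / 2 - 1) * (3 - a\<^sup>2) powr (p / 2))"
  define g' where "g' = (\<lambda>a. p * ((1 + a) powr (p - 1) - (1 - a) powr (p - 1)) / 2
       - 2 powr (p / 2 - 1) * (p / 2 * (3 - a\<^sup>2) powr (p / 2 - 1) * (2 * a)))"
  have sq: "3 - x\<^sup>2 > 0" if "0 \<le> x" "x \<le> 1" for x :: real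
    using power_le_one[of x 2] that by simp
  have dg: "(g has_real_derivative g' x) (at x)" if x: "0 < x" "x < 1" for x
    unfolding g_def g'_def using sq[of x] x
    by (auto intro!: derivative_eq_intros simp: field_simps)
  have g'_nonpos: "g' x \<le> 0" if x: "0 < x" "x < 1" for x
  proof -
    define E where "E = (1 + x) * ln (1 + x) - (1 - x) * ln (1 - x)"
    have "((1 + x) powr (p - 1) - (1 - x) powr (p - 1)) / (2 * x) \<le> exp ((p - 1 - 1) * (E / (2 * x)))"
      unfolding E_def using ln_diff_powr_bound[of "p - 1" x] p x by auto
    also have "\<dots> \<le> exp ((p / 2 - 1) * ln (6 - 2 * x\<^sup>2))"
    proof -
      have "ln (6 - 2 * x\<^sup>2) \<le> E / x"
        using entropy_diff_ge[OF x] x unfolding E_def by (simp add: field_simps)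
      then have "(p / 2 - 1) * (E / x) \<le> (p / 2 - 1) * ln (6 - 2 * x\<^sup>2)"
        using p by (intro mult_left_mono_neg) auto
      then show ?thesis by (simp add: field_simps)
    qed
    also have "\<dots> = (6 - 2 * x\<^sup>2) powr (p / 2 - 1)" using sq[of x] x by (simp add: powr_def)
    also have "6 - 2 * x\<^sup>2 = 2 * (3 - x\<^sup>2)" by simp
    also have "(2 * (3 - x\<^sup>2)) powr (p / 2 - 1) = 2 powr (p / 2 - 1) * (3 - x\<^sup>2) powr (p / 2 - 1)"
      using sq[of x] x by (subst powr_mult) auto
    finally have *: "(1 + x) powr (p - 1) - (1 - x) powr (p - 1) \<le>
       (2 powr (p / 2 - 1) * (3 - x\<^sup>2) powr (p / 2 - 1)) * (2 * x)"
      using x by (simp add: divide_le_eq)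
    have "p / 2 * ((1 + x) powr (p - 1) - (1 - x) powr (p - 1)) \<le>
       p / 2 * ((2 powr (p / 2 - 1) * (3 - x\<^sup>2) powr (p / 2 - 1)) * (2 * x))"
      by (intro mult_left_mono *) (use p in auto)
    then show ?thesis unfolding g'_def by (simp add: mult_ac)
  qed
  have "continuous_on {0..1} g"
  proof -
    have "0 \<le> 3 - x\<^sup>2" if "x \<in> {0..1}" for x :: real using sq[of x] that by simp
    then show ?thesis
      unfolding g_def using p by (intro continuous_on_add continuous_on_mult continuous_on_divide continuous_on_powr' continuous_on_diff
          continuous_on_const continuous_on_id continuous_on_power) auto
  qed
  then have cont: "continuous_on {a..1} g" by (rule continuous_on_subset) (use a in auto)
  have "g 1 \<le> g a"
  proof (cases "a = 1")
    case False
    show ?thesis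
    proof (rule DERIV_nonpos_imp_decreasing_open[OF _ _ cont])
      fix x assume "a < x" "x < 1"
      then have "0 < x" "x < 1" using a by auto
      then show "\<exists>y. (g has_real_derivative y) (at x) \<and> y \<le> 0" using dg g'_nonpos by blast
    qed (use a in auto)
  qed simp
  moreover have "g 1 = 2 powr p"
  proof -
    have "2 powr (p / 2 - 1) * 2 powr (p / 2) = 2 powr p / (2::real)"
      by (simp add: powr_diff flip: powr_add)
    then show ?thesis using p by (simp add: g_def)
  qed
  ultimately show ?thesis by (simp add: g_def)
qed

subsection \<open>Reduction to balanced coefficients\<close>

lemma one_plus_powr_ge:
  fixes q e :: real
  assumes q: "1 \<le> q" and e: "- 1 < e"
  shows "1 + q * e \<le> (1 + e) powr q"
proof -
  define z where "z = 1 + e"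
  have z: "z > 0" using e by (simp add: z_def)
  have "q * (z - 1) \<le> z powr q - 1 powr q"
  proof (rule convex_on_imp_above_tangent[OF powr_convex[OF q]])
    have "((\<lambda>x. x powr q) has_real_derivative q) (at 1)" by (auto intro!: derivative_eq_intros)
    then show "((\<lambda>x. x powr q) has_real_derivative q) (at 1 within {0<..})"
      by (rule has_field_derivative_at_within)
  qed (use z in \<open>auto simp: interior_open\<close>)
  then show ?thesis by (simp add: z_def)
qed

lemma abs_powr_conv_square: "\<bar>x\<bar> powr r = (x\<^sup>2) powr (r / 2)" for x :: real
proof (cases "x = 0")
  case False
  then have "x\<^sup>2 = \<bar>x\<bar> powr 2" by simp
  then show ?thesis by (simp only: powr_powr) simp
qed simp

lemma powr_concave_chord:
  fixes q A B z :: real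
  assumes q: "0 < q" "q \<le> 1" and z: "0 < A" "A \<le> z" "z \<le> B"
  shows "(B - z) * A powr q + (z - A) * B powr q \<le> (B - A) * z powr q"
proof (cases "A = B")
  case False
  then have AB: "A < B" using z by simp
  have conv: "convex_on {0<..} (\<lambda>x. - (x powr q))"
  proof (rule f''_ge0_imp_convex[where f' = "\<lambda>x. - (q * x powr (q - 1))"
        and f'' = "\<lambda>x. - (q * ((q - 1) * x powr (q - 1 - 1)))"])
    fix x :: real assume x: "x \<in> {0<..}"
    then show "((\<lambda>x. - (x powr q)) has_real_derivative - (q * x powr (q - 1))) (at x)"
      and "((\<lambda>x. - (q * x powr (q - 1))) has_real_derivative - (q * ((q - 1) * x powr (q - 1 - 1)))) (at x)"
      by (auto intro!: derivative_eq_intros)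
    show "0 \<le> - (q * ((q - 1) * x powr (q - 1 - 1)))"
      using q by (simp add: mult_nonneg_nonpos mult_nonpos_nonneg)
  qed auto
  define t where "t = (z - A) / (B - A)"
  have t: "0 \<le> t" "t \<le> 1" and tA: "t * (B - A) = z - A" using z AB by (auto simp: t_def)
  have "- (((1 - t) * A + t * B) powr q) \<le> (1 - t) * (- (A powr q)) + t * (- (B powr q))"
    using convex_onD[OF conv t, of A B] z by simp
  moreover have "(1 - t) * A + t * B = z" using tA by (simp add: algebra_simps)
  ultimately have "(1 - t) * A powr q + t * B powr q \<le> z powr q" by simp
  then have "(B - A) * ((1 - t) * A powr q + t * B powr q) \<le> (B - A) * z powr q"
    using AB by (intro mult_left_mono) auto
  moreover have "(B - A) * ((1 - t) * A powr q + t * B powr q)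
      = (B - A - t * (B - A)) * A powr q + t * (B - A) * B powr q" by (simp add: algebra_simps)
  ultimately show ?thesis unfolding tA by simp
qed (use z in simp)

lemma powr_midpoint:
  fixes q A B :: real
  assumes q: "0 < q" "q \<le> 1" and AB: "0 < A" "0 < B"
  shows "A powr q + B powr q \<le> 2 * ((A + B) / 2) powr q"
proof -
  have *: "A powr q + B powr q \<le> 2 * ((A + B) / 2) powr q" if "0 < A" "A \<le> B" for A B :: real
  proof (cases "A = B")
    case False
    have "(B - (A + B) / 2) * A powr q + ((A + B) / 2 - A) * B powr q \<le> (B - A) * ((A + B) / 2) powr q"
      using powr_concave_chord[OF q, of A "(A + B) / 2" B] that by simp
    then have "(B - A) * (A powr q + B powr q) \<le> (B - A) * (2 * ((A + B) / 2) powr q)"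
    proof -
      have "(B - A) * (A powr q + B powr q) = 2 * ((B - (A + B) / 2) * A powr q + ((A + B) / 2 - A) * B powr q)"
        by (simp add: field_simps)
      also have "\<dots> \<le> 2 * ((B - A) * ((A + B) / 2) powr q)"
        using \<open>(B - (A + B) / 2) * A powr q + ((A + B) / 2 - A) * B powr q \<le> (B - A) * ((A + B) / 2) powr q\<close> by simp
      finally show ?thesis by (simp only: mult.left_commute[of 2])
    qed
    then show ?thesis using False that by simp
  qed simp
  show ?thesis using *[of A B] *[of B A] AB by (cases "A \<le> B") (auto simp: add.commute)
qed

text \<open>On \<open>[0, 1]\<close> the function \<open>(1 + x) powr q\<close> is replaced by its point reflection at \<open>x = 1\<close>. This strengthens the bound to be proved,
  but makes it midpoint convex, so that it survives the replacement of two coefficients \<open>a, b\<close> by \<open>a + b\<close> or \<open>a - b\<close>.\<close>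

definition reflected_powr :: "real \<Rightarrow> real \<Rightarrow> real" where
  "reflected_powr q x = (if 1 \<le> x then (1 + x) powr q else 2 * 2 powr q - (3 - x) powr q)"

lemma reflected_powr_le1: "x \<le> 1 \<Longrightarrow> reflected_powr q x = 2 * 2 powr q - (3 - x) powr q"
  by (auto simp: reflected_powr_def)

lemma reflected_powr_ge:
  assumes "0 < q" "q \<le> 1" "0 \<le> x"
  shows "(1 + x) powr q \<le> reflected_powr q x"
  using powr_midpoint[OF assms(1,2), of "1 + x" "3 - x"] assms(3)
  by (auto simp: reflected_powr_def)

text \<open>The function is convex on [0, 1] but concave beyond 1, so the midpoint must not exceed
  1. If v > 1, midconvexity follows from two chord inequalities for the concave power on [2, 3 - u],
  at the points 1 + v and 3 - m; the first lies in that interval because u + v \<le> 2.\<close>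

lemma reflected_powr_midconvex:
  assumes q: "0 < q" "q \<le> 1" and uv: "0 \<le> u" "0 \<le> v" "u + v \<le> 2"
  shows "2 * reflected_powr q ((u + v) / 2) \<le> reflected_powr q u + reflected_powr q v"
proof -
  have *: "2 * reflected_powr q ((u + v) / 2) \<le> reflected_powr q u + reflected_powr q v"
    if uv: "0 \<le> u" "u \<le> v" "u + v \<le> 2" for u v
  proof (cases "v \<le> 1")
    case True
    have "(3 - u) powr q + (3 - v) powr q \<le> 2 * ((3 - u + (3 - v)) / 2) powr q"
      using powr_midpoint[OF q, of "3 - u" "3 - v"] uv True by simp
    also have "(3 - u + (3 - v)) / 2 = 3 - (u + v) / 2" by (simp add: field_simps)
    finally show ?thesis using uv True by (simp add: reflected_powr_le1)
  next
    case False
    define m where "m = (u + v) / 2"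
    have m: "u \<le> m" "m \<le> 1" "2 * m = u + v" using uv by (auto simp: m_def)
    have 1: "(3 - u - (1 + v)) * 2 powr q + (1 + v - 2) * (3 - u) powr q \<le> (3 - u - 2) * (1 + v) powr q"
      using powr_concave_chord[OF q, of 2 "1 + v" "3 - u"] uv False by simp
    have 2: "(3 - u - (3 - m)) * 2 powr q + (3 - m - 2) * (3 - u) powr q \<le> (3 - u - 2) * (3 - m) powr q"
      using powr_concave_chord[OF q, of 2 "3 - m" "3 - u"] m by simp
    have v: "v = 2 * m - u" using m by simp
    have "(1 - u) * (2 * 2 powr q + (3 - u) powr q)
       = (3 - u - (1 + v)) * 2 powr q + (1 + v - 2) * (3 - u) powr q
         + 2 * ((3 - u - (3 - m)) * 2 powr q + (3 - m - 2) * (3 - u) powr q)"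
      unfolding v by algebra
    also have "\<dots> \<le> (1 - u) * ((1 + v) powr q + 2 * (3 - m) powr q)"
      using 1 2 by (simp add: algebra_simps)
    finally have "2 * 2 powr q + (3 - u) powr q \<le> (1 + v) powr q + 2 * (3 - m) powr q"
      using uv False by simp
    moreover have "3 - u = 1 + v" if "m = 1" using m that by simp
    ultimately show ?thesis using uv False m by (auto simp add: reflected_powr_def simp flip: m_def)
  qed
  show ?thesis using *[of u v] *[of v u] uv by (cases "u \<le> v") (auto simp: add.commute)
qed

lemma reflected_powr_nonneg:
  assumes "0 < q" "q \<le> 1" "0 \<le> x"
  shows "0 \<le> reflected_powr q x"
  using reflected_powr_ge[OF assms] by (smt (verit) powr_ge_zero)

text \<open>One coefficient is normalized to 1, and \<open>main\<close> is an induction on the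
  number of the others, with square sum x. If x \<le> 1, two of them are merged and midconvexity is
  used. If x > 1, the reflected power is the true power: either the full list is balanced, or a
  dominating coefficient takes over the role of 1, which leads back to x \<le> 1.\<close>

lemma sgn_avg_lower_bound_of_balanced:
  fixes p c :: real
  assumes p: "1 < p" "p < 2" and c: "0 \<le> c" "c \<le> 2 powr (p / 2 - 1)"
    and bal: "\<And>bs. sq_sum bs = 1 \<Longrightarrow> (\<And>b. b \<in> set bs \<Longrightarrow> b\<^sup>2 \<le> 1 / 2) \<Longrightarrow> c \<le> sgn_moment p bs 0"
  shows "c * sq_sum bs powr (p / 2) \<le> sgn_moment p bs 0"
proof -
  define q where "q = p / 2"
  define M where "M = sgn_moment p"
  have q: "0 < q" "q \<le> 1" using p by (auto simp: q_def)
  have ps: "\<bar>a\<bar> powr p = (a\<^sup>2) powr q" for a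
    unfolding q_def by (rule abs_powr_conv_square)
  have start: "M (a # as) 0 = M as a" for a as
    unfolding M_def by (rule sgn_avg_start) simp
  have balS: "c * sq_sum bs powr q \<le> M bs 0"
    if "\<And>b. b \<in> set bs \<Longrightarrow> b\<^sup>2 \<le> sq_sum bs / 2" for bs
  proof (cases "sq_sum bs = 0")
    case True
    then show ?thesis unfolding M_def using sgn_avg_nonneg[of "\<lambda>x. \<bar>x\<bar> powr p" bs 0] by simp
  next
    case False
    define s where "s = 1 / sqrt (sq_sum bs)"
    have S: "sq_sum bs > 0" using False sq_sum_nonneg[of bs] by simp
    have s2: "s\<^sup>2 * sq_sum bs = 1" using S by (simp add: s_def power_divide)
    have s: "s > 0" using S by (simp add: s_def)
    have "c \<le> M (map (\<lambda>b. s * b) bs) 0"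
      unfolding M_def
    proof (rule bal)
      show "sq_sum (map (\<lambda>b. s * b) bs) = 1" unfolding sq_sum_scale by (rule s2)
      fix b assume "b \<in> set (map (\<lambda>b. s * b) bs)"
      then obtain b' where b': "b' \<in> set bs" "b = s * b'" by auto
      have "s\<^sup>2 * b'\<^sup>2 \<le> s\<^sup>2 * (sq_sum bs / 2)" by (intro mult_left_mono that b') auto
      then show "b\<^sup>2 \<le> 1 / 2" using s2 b' by (simp add: power_mult_distrib)
    qed
    also have "\<dots> = (s\<^sup>2) powr q * M bs 0"
      unfolding M_def sgn_avg_powr_scale0 ps[of s] ..
    finally have "c * sq_sum bs powr q \<le> (s\<^sup>2) powr q * M bs 0 * sq_sum bs powr q"
      by (intro mult_right_mono) auto
    also have "\<dots> = M bs 0 * (s\<^sup>2 * sq_sum bs) powr q"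
      using S by (simp add: powr_mult)
    finally show ?thesis using s2 by simp
  qed
  have swap: "M (us @ a # vs) 1 = (a\<^sup>2) powr q * M (map (\<lambda>b. 1 / a * b) (1 # us @ vs)) 1"
    if "a \<noteq> 0" for us a vs
  proof -
    have "M (us @ a # vs) 1 = M (1 # a # us @ vs) 0"
      unfolding start by (simp add: M_def sgn_avg_move del: sgn_avg.simps)
    also have "\<dots> = M (1 # us @ vs) a" 
      unfolding M_def by (subst sgn_avg_swap) (simp only: start[unfolded M_def])
    also have "M (1 # us @ vs) a = M (map (\<lambda>b. a * b) (map (\<lambda>b. 1 / a * b) (1 # us @ vs))) (a * 1)"
      using that by (simp add: comp_def)
    also have "\<dots> = (a\<^sup>2) powr q * M (map (\<lambda>b. 1 / a * b) (1 # us @ vs)) 1"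
      unfolding M_def sgn_avg_powr_scale ps[of a] ..
    finally show ?thesis .
  qed
  have main: "c * reflected_powr q (sq_sum as) \<le> M as 1" for as
  proof (induction "length as" arbitrary: as rule: less_induct)
    case less
    \<comment> \<open>Proved for every list of the length of \<open>as\<close>, not just for
      \<open>as\<close>: exchanging 1 with a dominating coefficient changes the list but not its
      length, so the induction hypothesis would not apply to the result.\<close>
    have small: "c * reflected_powr q (sq_sum bs) \<le> M bs 1"
      if bs: "sq_sum bs \<le> 1" "length bs = length as" for bs
    proof -
      consider "length bs < 2" | a b rest where "bs = a # b # rest"
        by (cases bs; cases "tl bs") auto
      then show ?thesis
      proof cases
        case 1
        have "\<exists>a. \<bar>a\<bar> \<le> 1 \<and> sq_sum bs = a\<^sup>2 \<and> M bs 1 = (\<bar>1 + a\<bar> powr p + \<bar>1 - a\<bar> powr p) / 2"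
        proof (cases bs)
          case Nil
          then show ?thesis by (intro exI[of _ 0]) (simp add: M_def)
        next
          case (Cons a as')
          then show ?thesis using 1 bs(1) by (intro exI[of _ a]) (auto simp: M_def abs_square_le_1)
        qed
        then obtain a where a: "\<bar>a\<bar> \<le> 1" "sq_sum bs = a\<^sup>2" "M bs 1 = (\<bar>1 + a\<bar> powr p + \<bar>1 - a\<bar> powr p) / 2"
          by auto
        have "M bs 1 = ((1 + \<bar>a\<bar>) powr p + (1 - \<bar>a\<bar>) powr p) / 2"
          using a by (cases "a \<ge> 0") auto
        moreover have "2 powr p \<le> ((1 + \<bar>a\<bar>) powr p + (1 - \<bar>a\<bar>) powr p) / 2 + 2 powr (p / 2 - 1) * (3 - a\<^sup>2) powr (p / 2)"
          using two_term_base[OF p, of "\<bar>a\<bar>"] a by simp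
        moreover have "2 powr p = 2 powr (p / 2 - 1) * (2 * 2 powr q)"
          by (simp add: q_def powr_diff flip: powr_add)
        ultimately have "2 powr (p / 2 - 1) * (2 * 2 powr q) \<le> M bs 1 + 2 powr (p / 2 - 1) * (3 - a\<^sup>2) powr q"
          unfolding q_def by linarith
        then have "2 powr (p / 2 - 1) * reflected_powr q (a\<^sup>2) \<le> M bs 1"
          using a bs(1)[unfolded a(2)] by (simp only: reflected_powr_le1 right_diff_distrib)
        \<comment> \<open>Here the bound \<open>c \<le> 2 powr (p / 2 - 1)\<close> enters: the
          extremal case of two equal coefficients must not beat c.\<close>
        moreover have "c * reflected_powr q (a\<^sup>2) \<le> 2 powr (p / 2 - 1) * reflected_powr q (a\<^sup>2)"
          using c q by (intro mult_right_mono reflected_powr_nonneg) auto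
        ultimately show ?thesis using a by simp
      next
        case 2
        define u where "u = sq_sum ((a + b) # rest)"
        define v where "v = sq_sum ((a - b) # rest)"
        \<comment> \<open>The squares of a + b and a - b average to a^2 + b^2, so the merged square
          sums have midpoint \<open>sq_sum bs\<close>, as midconvexity requires.\<close>
        have uv: "(u + v) / 2 = sq_sum bs" "0 \<le> u" "0 \<le> v"
          unfolding u_def v_def 2 by (simp add: power2_eq_square field_simps, (rule sq_sum_nonneg)+)
        have "c * reflected_powr q u \<le> M ((a + b) # rest) 1" "c * reflected_powr q v \<le> M ((a - b) # rest) 1"
          unfolding u_def v_def by (rule less; use bs 2 in simp)+
        moreover have "c * (2 * reflected_powr q ((u + v) / 2)) \<le> c * (reflected_powr q u + reflected_powr q v)"
          using uv bs by (intro mult_left_mono reflected_powr_midconvex q c) auto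
        moreover have "M bs 1 = (M ((a + b) # rest) 1 + M ((a - b) # rest) 1) / 2"
          unfolding 2 M_def by (rule sgn_avg_merge)
        ultimately show ?thesis unfolding uv by (simp add: algebra_simps)
      qed
    qed
    show ?case
    proof (cases "sq_sum as \<le> 1")
      case False
      define x where "x = sq_sum as"
      have x: "x > 1" using False by (simp add: x_def)
      have Phi: "reflected_powr q x = (1 + x) powr q" using x by (simp add: reflected_powr_def)
      show ?thesis
      proof (cases "\<forall>a\<in>set as. a\<^sup>2 \<le> (1 + x) / 2")
        case True
        have "c * sq_sum (1 # as) powr q \<le> M (1 # as) 0"
          by (rule balS) (use True x in \<open>auto simp: x_def\<close>)
        then show ?thesis unfolding start using Phi by (simp add: x_def)
      next
        case False
        then obtain a where a: "a \<in> set as" "a\<^sup>2 > (1 + x) / 2" by force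
        then obtain us vs where as: "as = us @ a # vs" by (meson split_list)
        have a2: "a\<^sup>2 > 0" by (rule order.strict_trans[OF _ a(2)]) (use x in simp)
        then have a0: "a \<noteq> 0" by auto
        \<comment> \<open>Division by a turns a into 1 and 1 into an ordinary coefficient. Since a^2
          exceeds half of 1 + x, the remaining squares now sum to less than 1.\<close>
        define bs where "bs = map (\<lambda>b. 1 / a * b) (1 # us @ vs)"
        have sqb: "sq_sum bs = (1 + x - a\<^sup>2) / a\<^sup>2"
          unfolding bs_def sq_sum_scale x_def as by (simp add: power_divide)
        have xa: "a\<^sup>2 \<le> x" using sq_sum_nonneg[of us] sq_sum_nonneg[of vs] by (simp add: x_def as)
        have "sq_sum bs \<le> 1" using a a2 unfolding sqb by (simp add: field_simps)
        moreover have "length bs = length as" by (simp add: bs_def as)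
        ultimately have "c * reflected_powr q (sq_sum bs) \<le> M bs 1" by (rule small)
        moreover have "c * (1 + sq_sum bs) powr q \<le> c * reflected_powr q (sq_sum bs)"
          by (intro mult_left_mono reflected_powr_ge q c sq_sum_nonneg)
        ultimately have "(a\<^sup>2) powr q * (c * (1 + sq_sum bs) powr q) \<le> (a\<^sup>2) powr q * M bs 1"
          by (intro mult_left_mono) auto
        also have "\<dots> = M as 1" unfolding as swap[OF a0] bs_def ..
        also have "(a\<^sup>2) powr q * (c * (1 + sq_sum bs) powr q) = c * (a\<^sup>2 * (1 + sq_sum bs)) powr q"
          using sq_sum_nonneg[of bs] by (simp add: powr_mult)
        also have "a\<^sup>2 * (1 + sq_sum bs) = 1 + x" using a0 unfolding sqb by (simp add: field_simps)
        finally show ?thesis using Phi by (simp add: x_def)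
      qed
    qed (use small in auto)
  qed
  show ?thesis
  proof (cases "\<forall>b\<in>set bs. b = 0")
    case True
    then have "sq_sum bs = 0" by (induction bs) auto
    then show ?thesis using sgn_avg_nonneg[of "\<lambda>x. \<bar>x\<bar> powr p" bs 0] by simp
  next
    case False
    then obtain a where a: "a \<in> set bs" "a \<noteq> 0" by auto
    then obtain us vs where bs: "bs = us @ a # vs" by (meson split_list)
    define as where "as = map (\<lambda>b. 1 / a * b) (us @ vs)"
    have "sq_sum bs = a\<^sup>2 * (1 + sq_sum as)"
      using a unfolding as_def sq_sum_scale bs by (simp add: field_simps)
    then have "c * sq_sum bs powr q = (a\<^sup>2) powr q * (c * (1 + sq_sum as) powr q)"
      using sq_sum_nonneg[of as] by (simp add: powr_mult)
    also have "\<dots> \<le> (a\<^sup>2) powr q * (c * reflected_powr q (sq_sum as))"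
      by (intro mult_left_mono reflected_powr_ge q c sq_sum_nonneg) auto
    also have "\<dots> \<le> (a\<^sup>2) powr q * M as 1" by (intro mult_left_mono main) auto
    also have "\<dots> = M (map (\<lambda>b. a * b) as) (a * 1)" unfolding M_def sgn_avg_powr_scale ps[of a] ..
    also have "\<dots> = M (us @ vs) a" unfolding as_def using a by (simp add: comp_def)
    also have "\<dots> = M bs 0" unfolding bs M_def sgn_avg_move by (simp only: start[unfolded M_def])
    finally show ?thesis by (simp add: M_def q_def)
  qed
qed

subsection \<open>The Gamma function and the critical exponent\<close>

text \<open>Otherwise 1/2 = sin (pi / 6) would be at most sin (313/600), whose Taylor polynomial of
  degree 5 with remainder stays below 1/2.\<close>

lemma pi_gt_313: "313 / 100 < pi"
proof (rule ccontr)
  assume "\<not> ?thesis"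
  then have "sin (pi / 6) \<le> sin (313 / 600)"
    using pi_ge_two by (intro sin_monotone_2pi_le) auto
  moreover have "\<bar>sin (313 / 600) - (\<Sum>k<7. sin_coeff k * (313 / 600 :: real) ^ k)\<bar> \<le> inverse (fact 7) * \<bar>313 / 600\<bar> ^ 7"
    by (rule Maclaurin_sin_bound)
  moreover have "(\<Sum>k<7. sin_coeff k * (313 / 600 :: real) ^ k) = 313 / 600 - (313 / 600) ^ 3 / 6 + (313 / 600) ^ 5 / 120"
  proof -
    have "{..<7} = {0, 1, 2, 3, 4, 5, 6 :: nat}" by auto
    then show ?thesis by (simp add: sin_coeff_def fact_numeral)
  qed
  ultimately show False by (simp add: sin_30 fact_numeral power_divide abs_le_iff)
qed

lemma Gamma_three_halves: "Gamma (3 / 2 :: real) = sqrt pi / 2"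
proof -
  have "(1 / 2 :: real) \<notin> \<int>\<^sub>\<le>\<^sub>0" using nonpos_Ints_nonpos[of "1 / 2 :: real"] by auto
  then show ?thesis using Gamma_plus1[of "1 / 2 :: real"] by (simp add: Gamma_one_half_real)
qed

text \<open>Put x = (p + 1) / 2. The value sqrt pi / 2 is also taken at x = 3/2, where Gamma
  increases, so Gamma is smaller just to the left, while Gamma 1 = 1 is larger: a root lies in
  between. Two roots below 3/2 would, with 3/2 itself, give two zeros of the strictly increasing
  Digamma function by Rolle.\<close>

lemma p0_root:
  "\<exists>!p. 1 < p \<and> p < 2 \<and> Gamma ((p + 1) / 2) = sqrt pi / (2::real)"
proof -
  have "\<exists>x. 1 < x \<and> x < 3 / 2 \<and> Gamma x = sqrt pi / (2::real)"
  proof -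
    have D: "(Gamma has_real_derivative Gamma (3 / 2) * Digamma (3 / 2)) (at (3 / 2 :: real))"
      by (rule derivative_eq_intros refl)+ (auto elim!: nonpos_Ints_cases)
    have "0 < Gamma (3 / 2 :: real) * Digamma (3 / 2)"
      using Digamma_real_three_halves_pos Gamma_real_pos[of "3 / 2"] by simp
    from DERIV_pos_inc_left[OF D this] obtain d where d: "d > 0"
      "\<And>h. 0 < h \<Longrightarrow> h < d \<Longrightarrow> Gamma (3 / 2 - h) < Gamma (3 / 2 :: real)" by blast
    define z where "z = 3 / 2 - min (d / 2) (1 / 4)"
    have z: "1 < z" "z < 3 / 2" "Gamma z < sqrt pi / 2"
      using d(1) d(2)[of "min (d / 2) (1 / 4)"] Gamma_three_halves unfolding z_def by auto
    have "sqrt pi / 2 < 1" using pi_less_4 real_sqrt_less_iff[of pi 4] by simp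
    then have "Gamma 1 \<ge> sqrt pi / 2" by simp
    moreover have "continuous_on {1..z} Gamma"
      by (intro continuous_intros) (auto elim!: nonpos_Ints_cases)
    ultimately obtain x where x: "1 \<le> x" "x \<le> z" "Gamma x = sqrt pi / 2"
      using IVT2'[of Gamma z "sqrt pi / 2" 1] z by auto
    moreover have "x \<noteq> 1" using x \<open>sqrt pi / 2 < 1\<close> by auto
    ultimately show ?thesis using z by (intro exI[of _ x]) auto
  qed
  then obtain x where x: "1 < x" "x < 3 / 2" "Gamma x = sqrt pi / 2" by auto
  have two: False if xy: "1 < x" "x < y" "y < 3 / 2" "Gamma x = sqrt pi / 2" "Gamma y = sqrt pi / 2" for x y :: real
  proof -
    have *: "\<exists>z. a < z \<and> z < b \<and> Digamma z = 0" if ab: "0 < a" "a < b" "Gamma a = Gamma b" for a b :: real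
    proof -
      have "(Gamma has_real_derivative Gamma x * Digamma x) (at x)" if "a \<le> x" for x
        using ab that by (auto intro!: derivative_eq_intros elim!: nonpos_Ints_cases)
      then obtain z where z: "a < z" "z < b" "Gamma b - Gamma a = (b - a) * (Gamma z * Digamma z)"
        using MVT2[of a b Gamma "\<lambda>z. Gamma z * Digamma z"] ab by blast
      have "Gamma z > 0" using z ab by (intro Gamma_real_pos) auto
      then have "Gamma z \<noteq> 0" by linarith
      then show ?thesis using z ab by (intro exI[of _ z]) simp
    qed
    obtain z where "x < z" "z < y" "Digamma z = 0" using *[of x y] xy by auto
    moreover obtain w where "y < w" "w < 3 / 2" "Digamma w = 0" using *[of y "3 / 2"] xy Gamma_three_halves by auto
    ultimately show False using Digamma_real_strict_mono[of z w] xy by auto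
  qed
  show ?thesis
  proof (rule ex1I[of _ "2 * x - 1"])
    show "1 < 2 * x - 1 \<and> 2 * x - 1 < 2 \<and> Gamma ((2 * x - 1 + 1) / 2) = sqrt pi / 2" using x by simp
    fix p :: real assume p: "1 < p \<and> p < 2 \<and> Gamma ((p + 1) / 2) = sqrt pi / 2"
    have "\<not> x < (p + 1) / 2" "\<not> (p + 1) / 2 < x"
      using two[of x "(p + 1) / 2"] two[of "(p + 1) / 2" x] x p by auto
    then have "x = (p + 1) / 2" by linarith
    then show "p = 2 * x - 1" by simp
  qed
qed

lemma p0_spec: "1 < p0" "p0 < 2" "Gamma ((p0 + 1) / 2) = sqrt pi / 2"
  using theI'[OF p0_root] unfolding p0_def by auto

lemma ln_Gamma_chord:
  fixes x y z :: real
  assumes "0 < x" "x \<le> y" "y \<le> z" "x < z"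
  shows "(z - x) * ln (Gamma y) \<le> (z - y) * ln (Gamma x) + (y - x) * ln (Gamma z)"
proof -
  define t where "t = (y - x) / (z - x)"
  have t: "0 \<le> t" "t \<le> 1" and tx: "t * (z - x) = y - x" using assms by (auto simp: t_def)
  have "(ln \<circ> Gamma) ((1 - t) *\<^sub>R x + t *\<^sub>R z) \<le> (1 - t) * (ln \<circ> Gamma) x + t * (ln \<circ> Gamma) z"
    by (rule convex_onD[OF log_convex_Gamma_real]) (use t assms in auto)
  moreover have "(1 - t) *\<^sub>R x + t *\<^sub>R z = y" using tx by (simp add: algebra_simps)
  ultimately have "ln (Gamma y) \<le> (1 - t) * ln (Gamma x) + t * ln (Gamma z)" by simp
  then have "(z - x) * ln (Gamma y) \<le> (z - x) * ((1 - t) * ln (Gamma x) + t * ln (Gamma z))"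
    using assms by (intro mult_left_mono) auto
  also have "\<dots> = (z - x - t * (z - x)) * ln (Gamma x) + t * (z - x) * ln (Gamma z)"
    by (simp add: algebra_simps)
  finally show ?thesis unfolding tx by simp
qed

text \<open>Gamma is log-convex and takes the value sqrt pi / 2 at both ends (p0 + 1) / 2 and
  3/2.\<close>

lemma Gamma_le_of_p0_le:
  assumes "p0 \<le> p" "p \<le> 2"
  shows "Gamma ((p + 1) / 2) \<le> sqrt pi / 2"
proof -
  have "(3 / 2 - (p0 + 1) / 2) * ln (Gamma ((p + 1) / 2)) \<le>
     (3 / 2 - (p + 1) / 2) * ln (Gamma ((p0 + 1) / 2)) + ((p + 1) / 2 - (p0 + 1) / 2) * ln (Gamma (3 / 2))"
    by (rule ln_Gamma_chord) (use assms p0_spec in auto)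
  also have "\<dots> = (3 / 2 - (p0 + 1) / 2) * ln (sqrt pi / 2)"
    unfolding p0_spec Gamma_three_halves by (simp add: algebra_simps)
  finally have "ln (Gamma ((p + 1) / 2)) \<le> ln (sqrt pi / 2)" using p0_spec by simp
  moreover have "Gamma ((p + 1) / 2) > 0" using assms p0_spec by (intro Gamma_real_pos) auto
  ultimately show ?thesis by simp
qed

text \<open>The bound on \<open>\<Gamma>(27/20)\<close> comes from log-convexity between \<open>n + 27/20\<close>, \<open>n + 3/2\<close> and \<open>n + 2\<close>
  with \<open>n = 10\<close>, pulled back by the functional equation.\<close>

lemma Gamma_27_20: "sqrt pi / 2 < Gamma (27 / 20 :: real)"
proof (rule ccontr)
  assume neg: "\<not> ?thesis"
  define g where "g = sqrt pi / 2"
  have g: "g > 0" by (simp add: g_def)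
  define P where "P = pochhammer (3 / 2 :: real) 10"
  define Q where "Q = pochhammer (27 / 20 :: real) 10"
  have PQ: "P > 0" "Q > 0" unfolding P_def Q_def by (auto intro!: pochhammer_pos)
  have P: "Gamma (23 / 2 :: real) = P * g"
  proof -
    have "P = Gamma (3 / 2 + of_nat 10) / Gamma (3 / 2 :: real)"
      unfolding P_def by (rule pochhammer_Gamma) (auto elim!: nonpos_Ints_cases)
    then show ?thesis using g by (simp add: Gamma_three_halves g_def)
  qed
  have Q: "Gamma (227 / 20 :: real) = Q * Gamma (27 / 20)"
  proof -
    have "Q = Gamma (27 / 20 + of_nat 10) / Gamma (27 / 20 :: real)"
      unfolding Q_def by (rule pochhammer_Gamma) (auto elim!: nonpos_Ints_cases)
    moreover have "Gamma (27 / 20 :: real) > 0" by (rule Gamma_real_pos) simp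
    ultimately show ?thesis by (simp add: field_simps)
  qed
  have F: "Gamma (12 :: real) = fact 11" using Gamma_fact[of 11, where 'a = real] by simp
  have "(12 - 227 / 20) * ln (Gamma (23 / 2)) \<le> (12 - 23 / 2) * ln (Gamma (227 / 20)) + (23 / 2 - 227 / 20) * ln (Gamma (12 :: real))"
    by (rule ln_Gamma_chord) auto
  \<comment> \<open>The gaps between 227/20, 23/2 and 12 are 3/20 and 10/20, 13/20 in total;
    clearing denominators gives the exponents 13, 10 and 3 below.\<close>
  then have "13 * ln (P * g) \<le> 10 * ln (Q * Gamma (27 / 20)) + 3 * ln (fact 11 :: real)"
    unfolding P Q F by (simp add: field_simps)
  also have "ln (Q * Gamma (27 / 20)) \<le> ln (Q * g)"
    using neg PQ g Gamma_real_pos[of "27 / 20"] by (simp add: g_def)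
  finally have "13 * ln (P * g) \<le> 10 * ln (Q * g) + 3 * ln (fact 11 :: real)" by simp
  then have "ln ((P * g) ^ 13) \<le> ln ((Q * g) ^ 10 * fact 11 ^ 3)"
    using PQ g by (simp add: ln_mult ln_realpow)
  then have "(P * g) ^ 13 \<le> (Q * g) ^ 10 * fact 11 ^ 3"
    using PQ g by simp
  then have "g ^ 10 * (P ^ 13 * g ^ 3) \<le> g ^ 10 * (Q ^ 10 * fact 11 ^ 3)"
  proof -
    have "g ^ 13 = g ^ 10 * g ^ 3" by (simp flip: power_add)
    then show ?thesis
      using \<open>(P * g) ^ 13 \<le> (Q * g) ^ 10 * fact 11 ^ 3\<close> unfolding power_mult_distrib by (simp only: mult_ac)
  qed
  then have le: "P ^ 13 * g ^ 3 \<le> Q ^ 10 * fact 11 ^ 3" using g by simp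
  have "g\<^sup>2 = pi / 4" by (simp add: g_def power_divide)
  then have "(8845 / 10000)\<^sup>2 \<le> g\<^sup>2" using pi_gt_313 by (simp add: power_divide)
  then have "8845 / 10000 \<le> g" using g by (simp add: power2_le_iff_abs_le)
  then have "P ^ 13 * (8845 / 10000) ^ 3 \<le> P ^ 13 * g ^ 3"
    using PQ by (intro mult_left_mono power_mono) auto
  with le have "P ^ 13 * (8845 / 10000) ^ 3 \<le> Q ^ 10 * fact 11 ^ 3" by linarith
  have "{0..<10} = {0, 1, 2, 3, 4, 5, 6, 7, 8, 9 :: nat}" by auto
  then have "P = 13749310575 / 1024" "Q = 95518816749390290949 / 10240000000000"
    unfolding P_def Q_def by (simp_all add: pochhammer_prod)
  then have "13427061 \<le> P" "Q \<le> 9328010" by simp_all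
  then have "13427061 ^ 13 \<le> P ^ 13" "Q ^ 10 \<le> 9328010 ^ 10" using power_mono[of 13427061 P 13] power_mono[of Q 9328010 10] PQ by simp_all
  then have "13427061 ^ 13 * (8845 / 10000) ^ 3 \<le> P ^ 13 * (8845 / 10000) ^ 3"
    "Q ^ 10 * fact 11 ^ 3 \<le> 9328010 ^ 10 * fact 11 ^ 3" by (auto intro!: mult_right_mono)
  then have "13427061 ^ 13 * (8845 / 10000) ^ 3 \<le> 9328010 ^ 10 * (fact 11 ^ 3 :: real)"
    using \<open>P ^ 13 * (8845 / 10000) ^ 3 \<le> Q ^ 10 * fact 11 ^ 3\<close> by linarith
  moreover have "fact 11 = (39916800 :: real)" by (simp add: fact_numeral)
  ultimately show False by (simp add: power_divide)
qed

text \<open>By \<open>Gamma_le_of_p0_le\<close>, \<open>p0 < 17 / 10\<close> would bound Gamma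
  (27/20) by sqrt pi / 2. The result gives q = p/2 \<ge> 17/20 in the estimates for the
  cosine.\<close>

lemma p0_ge: "17 / 10 \<le> p0"
proof (rule ccontr)
  assume "\<not> ?thesis"
  then have "Gamma ((17 / 10 + 1) / 2) \<le> sqrt pi / 2" by (intro Gamma_le_of_p0_le) auto
  then show False using Gamma_27_20 by simp
qed

subsection \<open>Elementary estimates for the cosine\<close>

text \<open>With \<open>y = tan (x / 2)\<^sup>2\<close> one has \<open>- 2 ln (cos x) = 4 artanh y\<close>, \<open>x = 2 arctan (sqrt y)\<close> and \<open>tan x = 2 sqrt y / (1 - y)\<close>.
  Taylor bounds for \<open>arctan\<close> and \<open>artanh\<close> turn the estimate \<open>ln_cos_margin\<close> below into polynomial inequalities in \<open>y\<close>, which are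
  checked by a backward Horner scheme on \<open>[0, 47/100]\<close>.\<close>

primrec horner_lower :: "real \<Rightarrow> real list \<Rightarrow> real" where
  "horner_lower h [] = 0"
| "horner_lower h (c # cs) = c + min 0 (h * horner_lower h cs)"

lemma horner_lower_le:
  fixes y :: real
  assumes "0 \<le> y" "y \<le> h"
  shows "horner_lower h cs \<le> poly (Poly cs) y"
proof (induction cs)
  case (Cons c cs)
  have "min 0 (h * horner_lower h cs) \<le> y * horner_lower h cs"
    using assms by (cases "0 \<le> horner_lower h cs") (auto simp: min_le_iff_disj intro: mult_right_mono_neg)
  also have "\<dots> \<le> y * poly (Poly cs) y" using Cons assms by (intro mult_left_mono)
  finally show ?case by simp
qed simp

text \<open>The squared factor comes from \<open>arctan\<close> and the right side from artanh. The
  first factor bounds their quotient from below: 2/3 and 4/15 are exact Taylor coefficients, 1/4 and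
  3/20 are rounded down. In \<open>tan_half_poly2\<close> the quotient of artanh into arctan is
  rounded up in the same way, and \<open>tan_half_poly3\<close> compares the two bounds.\<close>

lemma tan_half_poly1:
  fixes y :: real
  assumes y: "0 \<le> y" "y \<le> 47 / 100"
  shows "(1 + y * (2 / 3 + 4 / 15 * y + 1 / 4 * y ^ 2 + 3 / 20 * y ^ 3)) * ((1 - y / 3 + y ^ 2 / 5 - y ^ 3 / 7 + y ^ 4 / 9) * (1 - y / 3 + y ^ 2 / 5 - y ^ 3 / 7 + y ^ 4 / 9)) \<le> (1 + y ^ 2 / 3 + y ^ 4 / 5 + y ^ 6 / 7)"
proof -
  have "0 \<le> poly (Poly [0, 0, 0, 23 / 3780, 43 / 18900, -437 / 18900, 194987 / 1984500, -1193 / 396900, -58127 / 1984500, 4411 / 1190700, -6053 / 1190700, 19 / 11340, -1 / 540]) y"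
    by (rule order.trans[OF _ horner_lower_le[OF y]]) simp
  also have "Poly [0, 0, 0, 23 / 3780, 43 / 18900, -437 / 18900, 194987 / 1984500, -1193 / 396900, -58127 / 1984500, 4411 / 1190700, -6053 / 1190700, 19 / 11340, -1 / 540] = ([:1, 0, 1 / 3, 0, 1 / 5, 0, 1 / 7:] - [:1, 2 / 3, 4 / 15, 1 / 4, 3 / 20:] * ([:1, -1 / 3, 1 / 5, -1 / 7, 1 / 9:] * [:1, -1 / 3, 1 / 5, -1 / 7, 1 / 9:]) :: real poly)"
    by simp
  also have "poly (\<dots>) y = (1 + y ^ 2 / 3 + y ^ 4 / 5 + y ^ 6 / 7) - (1 + y * (2 / 3 + 4 / 15 * y + 1 / 4 * y ^ 2 + 3 / 20 * y ^ 3)) * ((1 - y / 3 + y ^ 2 / 5 - y ^ 3 / 7 + y ^ 4 / 9) * (1 - y / 3 + y ^ 2 / 5 - y ^ 3 / 7 + y ^ 4 / 9))"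
    by (simp add: numeral_eq_Suc field_simps)
  finally show ?thesis by simp
qed

lemma tan_half_poly2:
  fixes y :: real
  assumes y: "0 \<le> y" "y \<le> 47 / 100"
  shows "(1 - y / 3 + y ^ 2 / 5 - y ^ 3 / 7 + y ^ 4 / 9) \<le> (1 - y / 3 - 2 / 15 * y ^ 2 - 1 / 40 * y ^ 3 - 1 / 100 * y ^ 4) * (1 + y ^ 2 / 3 + y ^ 4 / 5 + y ^ 6 / 7)"
proof -
  have "0 \<le> poly (Poly [0, 0, 0, 17 / 2520, 31 / 900, -3 / 40, 79 / 700, -221 / 4200, -221 / 10500, -1 / 280, -1 / 700]) y"
    by (rule order.trans[OF _ horner_lower_le[OF y]]) simp
  also have "Poly [0, 0, 0, 17 / 2520, 31 / 900, -3 / 40, 79 / 700, -221 / 4200, -221 / 10500, -1 / 280, -1 / 700] = ([:1, -1 / 3, -2 / 15, -1 / 40, -1 / 100:] * [:1, 0, 1 / 3, 0, 1 / 5, 0, 1 / 7:] - [:1, -1 / 3, 1 / 5, -1 / 7, 1 / 9:] :: real poly)"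
    by simp
  also have "poly (\<dots>) y = (1 - y / 3 - 2 / 15 * y ^ 2 - 1 / 40 * y ^ 3 - 1 / 100 * y ^ 4) * (1 + y ^ 2 / 3 + y ^ 4 / 5 + y ^ 6 / 7) - (1 - y / 3 + y ^ 2 / 5 - y ^ 3 / 7 + y ^ 4 / 9)"
    by (simp add: numeral_eq_Suc field_simps)
  finally show ?thesis by simp
qed

lemma tan_half_poly3:
  fixes y :: real
  assumes y: "0 \<le> y" "y \<le> 47 / 100"
  shows "(2 / 3 - 2 / 15 * y - 1 / 40 * y ^ 2 - 1 / 100 * y ^ 3) \<le> 27 / 20 * ((1 - y) * ((2 / 3 + 4 / 15 * y + 1 / 4 * y ^ 2 + 3 / 20 * y ^ 3) - 3 / 40 * y * ((2 / 3 + 4 / 15 * y + 1 / 4 * y ^ 2 + 3 / 20 * y ^ 3) * (2 / 3 + 4 / 15 * y + 1 / 4 * y ^ 2 + 3 / 20 * y ^ 3))))"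
proof -
  have "0 \<le> poly (Poly [7 / 30, -271 / 600, 23 / 2000, -2599 / 20000, -1953 / 10000, 6183 / 320000, 2187 / 320000, 1701 / 320000, 729 / 320000]) y"
    by (rule order.trans[OF _ horner_lower_le[OF y]]) simp
  also have "Poly [7 / 30, -271 / 600, 23 / 2000, -2599 / 20000, -1953 / 10000, 6183 / 320000, 2187 / 320000, 1701 / 320000, 729 / 320000] = (smult (27 / 20) ([:1, -1:] * ([:2 / 3, 4 / 15, 1 / 4, 3 / 20:] - [:0, 3 / 40:] * ([:2 / 3, 4 / 15, 1 / 4, 3 / 20:] * [:2 / 3, 4 / 15, 1 / 4, 3 / 20:]))) - [:2 / 3, -2 / 15, -1 / 40, -1 / 100:] :: real poly)"
    by simp
  also have "poly (\<dots>) y = 27 / 20 * ((1 - y) * ((2 / 3 + 4 / 15 * y + 1 / 4 * y ^ 2 + 3 / 20 * y ^ 3) - 3 / 40 * y * ((2 / 3 + 4 / 15 * y + 1 / 4 * y ^ 2 + 3 / 20 * y ^ 3) * (2 / 3 + 4 / 15 * y + 1 / 4 * y ^ 2 + 3 / 20 * y ^ 3)))) - (2 / 3 - 2 / 15 * y - 1 / 40 * y ^ 2 - 1 / 100 * y ^ 3)"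
    by (simp add: numeral_eq_Suc field_simps)
  finally show ?thesis by simp
qed

lemma ln_cos_half_angle_lower:
  fixes y :: real
  assumes y: "0 \<le> y" "y < 1"
  shows "4 * y * (1 + y ^ 2 / 3 + y ^ 4 / 5 + y ^ 6 / 7) \<le> 2 * (ln (1 + y) - ln (1 - y))"
proof -
  define g where "g = (\<lambda>y::real. ln (1 + y) - ln (1 - y) - (2 * y + 2 / 3 * y ^ 3 + 2 / 5 * y ^ 5 + 2 / 7 * y ^ 7))"
  have "g 0 \<le> g y"
  proof (rule DERIV_nonneg_imp_nondecreasing[OF y(1)])
    fix x assume x: "0 \<le> x" "x \<le> y"
    define g' where "g' = 1 / (1 + x) + 1 / (1 - x) - (2 + 2 * x ^ 2 + 2 * x ^ 4 + 2 * x ^ 6)"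
    have "(g has_real_derivative g') (at x)"
      unfolding g_def g'_def using x y by (auto intro!: derivative_eq_intros)
    moreover have "0 \<le> g'"
    proof -
      have p: "(1 + x) * (1 - x) > 0" using x y by simp
      have "1 / (1 + x) + 1 / (1 - x) = 2 / ((1 + x) * (1 - x))"
        using x y by (simp add: add_frac_eq)
      moreover have "(2 + 2 * x ^ 2 + 2 * x ^ 4 + 2 * x ^ 6) * ((1 + x) * (1 - x)) = 2 - 2 * x ^ 8"
        by algebra
      then have "(2 + 2 * x ^ 2 + 2 * x ^ 4 + 2 * x ^ 6) * ((1 + x) * (1 - x)) \<le> 2" using x by simp
      then have "2 + 2 * x ^ 2 + 2 * x ^ 4 + 2 * x ^ 6 \<le> 2 / ((1 + x) * (1 - x))"
        using p by (subst pos_le_divide_eq) auto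
      ultimately show ?thesis unfolding g'_def by linarith
    qed
    ultimately show "\<exists>d. (g has_real_derivative d) (at x) \<and> 0 \<le> d" by blast
  qed
  moreover have "4 * y * (1 + y ^ 2 / 3 + y ^ 4 / 5 + y ^ 6 / 7) = 2 * (2 * y + 2 / 3 * y ^ 3 + 2 / 5 * y ^ 5 + 2 / 7 * y ^ 7)"
    by algebra
  ultimately show ?thesis by (simp add: g_def)
qed

lemma arctan_upper:
  fixes z :: real
  assumes z: "0 \<le> z"
  shows "arctan z \<le> z * (1 - z\<^sup>2 / 3 + (z\<^sup>2) ^ 2 / 5 - (z\<^sup>2) ^ 3 / 7 + (z\<^sup>2) ^ 4 / 9)"
proof -
  define g where "g = (\<lambda>z::real. (z - z ^ 3 / 3 + z ^ 5 / 5 - z ^ 7 / 7 + z ^ 9 / 9) - arctan z)"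
  have "g 0 \<le> g z"
  proof (rule DERIV_nonneg_imp_nondecreasing[OF z])
    fix x assume x: "0 \<le> x" "x \<le> z"
    define g' where "g' = 1 - x ^ 2 + x ^ 4 - x ^ 6 + x ^ 8 - 1 / (1 + x\<^sup>2)"
    have "(g has_real_derivative g') (at x)"
      unfolding g_def g'_def by (auto intro!: derivative_eq_intros simp: inverse_eq_divide)
    moreover have "0 \<le> g'"
    proof -
      have p: "1 + x\<^sup>2 > 0" by (simp add: add_pos_nonneg)
      have "(1 - x ^ 2 + x ^ 4 - x ^ 6 + x ^ 8) * (1 + x\<^sup>2) = 1 + x ^ 10" by algebra
      then have "1 \<le> (1 - x ^ 2 + x ^ 4 - x ^ 6 + x ^ 8) * (1 + x\<^sup>2)" using x by simp
      then have "1 / (1 + x\<^sup>2) \<le> 1 - x ^ 2 + x ^ 4 - x ^ 6 + x ^ 8" using p by (subst pos_divide_le_eq) auto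
      then show ?thesis unfolding g'_def by linarith
    qed
    ultimately show "\<exists>d. (g has_real_derivative d) (at x) \<and> 0 \<le> d" by blast
  qed
  moreover have "z * (1 - z\<^sup>2 / 3 + (z\<^sup>2) ^ 2 / 5 - (z\<^sup>2) ^ 3 / 7 + (z\<^sup>2) ^ 4 / 9)
     = z - z ^ 3 / 3 + z ^ 5 / 5 - z ^ 7 / 7 + z ^ 9 / 9"
    by (simp add: algebra_simps flip: power_mult power_Suc)
  ultimately show ?thesis by (simp add: g_def)
qed

lemma cos_taylor_bounds:
  fixes x :: real
  shows "cos x \<le> 1 - x\<^sup>2 / 2 + x ^ 4 / 24" "1 - x\<^sup>2 / 2 + x ^ 4 / 24 - x ^ 6 / 720 \<le> cos x"
proof -
  have c: "{..<4} = {0, 1, 2, 3 :: nat}" "{..<6} = {0, 1, 2, 3, 4, 5 :: nat}" by auto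
  obtain t where t: "cos x = (\<Sum>m<4. cos_coeff m * x ^ m) + cos (t + 1 / 2 * real 4 * pi) / fact 4 * x ^ 4"
    using Maclaurin_cos_expansion[of x 4] by blast
  have "cos (t + 1 / 2 * real 4 * pi) / fact 4 * x ^ 4 \<le> 1 / fact 4 * x ^ 4"
    by (intro mult_right_mono divide_right_mono) auto
  then show "cos x \<le> 1 - x\<^sup>2 / 2 + x ^ 4 / 24"
    unfolding t by (simp add: c cos_coeff_def fact_numeral)
  obtain t where t: "cos x = (\<Sum>m<6. cos_coeff m * x ^ m) + cos (t + 1 / 2 * real 6 * pi) / fact 6 * x ^ 6"
    using Maclaurin_cos_expansion[of x 6] by blast
  have "-1 / fact 6 * x ^ 6 \<le> cos (t + 1 / 2 * real 6 * pi) / fact 6 * x ^ 6"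
    by (intro mult_right_mono divide_right_mono) auto
  then show "1 - x\<^sup>2 / 2 + x ^ 4 / 24 - x ^ 6 / 720 \<le> cos x"
    unfolding t by (simp add: c cos_coeff_def fact_numeral)
qed

text \<open>The witness is \<open>y * E\<close>. The number 3/40 is (1 - q) / 2 at q = 17/20, so e -
  3/40 e^2 is a lower bound for ((1 + e)^q - 1) / q for all q in [17/20, 1], by the second-order
  bound \<open>one_plus_powr_lower\<close>.\<close>

lemma ln_cos_margin:
  fixes x :: real
  assumes x: "0 < x" "x \<le> 6 / 5"
  defines "L \<equiv> - 2 * ln (cos x)"
  shows "\<exists>e. 0 \<le> e \<and> 1 + e \<le> L / x\<^sup>2 \<and> 20 / 27 * (x * tan x / L - 1) \<le> e - 3 / 40 * e\<^sup>2"
proof -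
  define z where "z = tan (x / 2)"
  define y where "y = z\<^sup>2"
  define A where "A = 1 - y / 3 + y ^ 2 / 5 - y ^ 3 / 7 + y ^ 4 / 9"
  define B where "B = 1 + y ^ 2 / 3 + y ^ 4 / 5 + y ^ 6 / 7"
  define E where "E = 2 / 3 + 4 / 15 * y + 1 / 4 * y ^ 2 + 3 / 20 * y ^ 3"
  define K where "K = 2 / 3 - 2 / 15 * y - 1 / 40 * y ^ 2 - 1 / 100 * y ^ 3"
  have xpi: "x < pi / 2" using x pi_gt_313 by simp
  have z: "z > 0" unfolding z_def using x xpi by (intro tan_gt_zero) auto
  have y: "y > 0" using z by (simp add: y_def)
  have cx: "cos (x / 2) > 0" using x xpi by (intro cos_gt_zero_pi) auto
  have cosx: "cos x = (1 - y) / (1 + y)"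
    using cos_tan_half[of "x / 2"] cx by (simp add: y_def z_def)
  have tanx: "tan x = 2 * z / (1 - y)"
    using tan_half[of "x / 2"] tan_double[of "x / 2"] cx cos_gt_zero_pi[of x] x xpi by (simp add: y_def z_def)
  have "cos x > 0" using x xpi by (intro cos_gt_zero_pi) auto
  have "1 - (6 / 5)\<^sup>2 / 2 + (6 / 5) ^ 4 / 24 - (6 / 5) ^ 6 / 720 \<le> cos (6 / 5 :: real)"
    by (rule cos_taylor_bounds)
  moreover have "cos (6 / 5) \<le> cos x" using x pi_gt_313 by (intro cos_monotone_0_pi_le) auto
  \<comment> \<open>53/147 is the value of (1 - y) / (1 + y) at y = 47/100, the end of the interval
    on which the polynomials are controlled.\<close>
  moreover have "53 / 147 \<le> 1 - (6 / 5)\<^sup>2 / 2 + (6 / 5) ^ 4 / 24 - (6 / 5 :: real) ^ 6 / 720" by (simp add: power_divide)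
  ultimately have "53 / 147 \<le> (1 - y) / (1 + y)" unfolding cosx by linarith
  then have y47: "y \<le> 47 / 100" using y by (simp add: pos_le_divide_eq)
  have Bpos: "B > 0" unfolding B_def using y by (simp add: add_pos_nonneg)
  have xA: "x \<le> 2 * (z * A)"
  proof -
    have "arctan z = x / 2" unfolding z_def using x xpi by (intro arctan_tan) auto
    moreover have "arctan z \<le> z * A" using arctan_upper[of z] z by (simp add: A_def y_def)
    ultimately show ?thesis by linarith
  qed
  then have "0 < z * A" using x by linarith
  then have Apos: "A > 0" using z by (simp add: zero_less_mult_iff)
  have LB: "4 * y * B \<le> L"
  proof -
    have "ln (cos x) = ln (1 - y) - ln (1 + y)" unfolding cosx using y y47 by (simp add: ln_div)
    then show ?thesis using ln_cos_half_angle_lower[of y] y y47 by (simp add: L_def B_def)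
  qed
  have Lpos: "L > 0" using LB y Bpos by (smt (verit) mult_pos_pos)
  have x2: "x\<^sup>2 \<le> 4 * y * (A * A)"
    using power_mono[OF xA, of 2] x by (simp add: y_def power_mult_distrib power2_eq_square mult_ac)
  have E: "0 \<le> y * E" using y unfolding E_def by (intro mult_nonneg_nonneg add_nonneg_nonneg) auto
  have 1: "1 + y * E \<le> L / x\<^sup>2"
  proof -
    have "(1 + y * E) * x\<^sup>2 \<le> (1 + y * E) * (4 * y * (A * A))" using x2 E by (intro mult_left_mono) auto
    also have "\<dots> = 4 * y * ((1 + y * E) * (A * A))" by simp
    also have "\<dots> \<le> 4 * y * B"
      unfolding A_def B_def E_def using y y47 tan_half_poly1[of y] by (intro mult_left_mono) auto
    also have "\<dots> \<le> L" by (rule LB)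
    finally show ?thesis using x by (simp add: pos_le_divide_eq)
  qed
  have 2: "x * tan x / L - 1 \<le> y * K / (1 - y)"
  proof -
    have y1: "1 - y > 0" using y47 by simp
    have "x * tan x \<le> 2 * (z * A) * (2 * z / (1 - y))"
      unfolding tanx using xA z y1 by (intro mult_right_mono) auto
    also have "\<dots> = 4 * y * A / (1 - y)" by (simp add: y_def power2_eq_square)
    finally have "x * tan x / L \<le> (4 * y * A / (1 - y)) / (4 * y * B)"
      using LB y y1 Apos Bpos Lpos by (intro frac_le) auto
    also have "\<dots> = (4 * y * A) / (4 * y * B) / (1 - y)" by simp
    also have "\<dots> = A / B / (1 - y)" using y by simp
    also have "A / B \<le> 1 - y + y * K"
    proof -
      have "A \<le> (1 - y / 3 - 2 / 15 * y ^ 2 - 1 / 40 * y ^ 3 - 1 / 100 * y ^ 4) * B"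
        unfolding A_def B_def using y y47 by (intro tan_half_poly2) auto
      also have "1 - y / 3 - 2 / 15 * y ^ 2 - 1 / 40 * y ^ 3 - 1 / 100 * y ^ 4 = 1 - y + y * K"
        unfolding K_def by algebra
      finally show ?thesis using Bpos by (simp add: pos_divide_le_eq)
    qed
    then have "A / B / (1 - y) \<le> (1 - y + y * K) / (1 - y)" using y1 by (intro divide_right_mono) auto
    also have "\<dots> = 1 + y * K / (1 - y)" using y1 by (simp add: add_divide_distrib)
    finally show ?thesis by simp
  qed
  have 3: "20 / 27 * (y * K / (1 - y)) \<le> y * E - 3 / 40 * (y * E)\<^sup>2"
  proof -
    have "K \<le> 27 / 20 * ((1 - y) * (E - 3 / 40 * y * (E * E)))"
      unfolding K_def E_def using y y47 by (intro tan_half_poly3) auto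
    then have "K / (1 - y) \<le> 27 / 20 * (E - 3 / 40 * y * (E * E))"
      using y47 by (simp add: pos_divide_le_eq mult_ac)
    then have "y * (K / (1 - y)) \<le> y * (27 / 20 * (E - 3 / 40 * y * (E * E)))"
      using y by (intro mult_left_mono) auto
    also have "\<dots> = 27 / 20 * (y * E - 3 / 40 * (y * E)\<^sup>2)" by (simp add: algebra_simps power2_eq_square)
    finally have le: "y * (K / (1 - y)) \<le> 27 / 20 * (y * E - 3 / 40 * (y * E)\<^sup>2)" .
    have "20 / 27 * X \<le> Y" if "X \<le> 27 / 20 * Y" for X Y :: real using that by simp
    from this[OF le] show ?thesis by simp
  qed
  have "20 / 27 * (x * tan x / L - 1) \<le> 20 / 27 * (y * K / (1 - y))"
    using 2 by (rule mult_left_mono) simp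
  from order.trans[OF this 3] show ?thesis
    using 1 E by blast
qed

lemma one_plus_powr_lower:
  fixes q e :: real
  assumes q: "0 \<le> q" "q \<le> 1" and e: "0 \<le> e"
  shows "1 + q * e - q * (1 - q) * e\<^sup>2 / 2 \<le> (1 + e) powr q"
proof -
  define g where "g = (\<lambda>e. (1 + e) powr q - (1 + q * e - q * (1 - q) * e\<^sup>2 / 2))"
  have "g 0 \<le> g e"
  proof (rule DERIV_nonneg_imp_nondecreasing[OF e])
    fix x assume x: "0 \<le> x" "x \<le> e"
    have "(g has_real_derivative q * ((1 + x) powr (q - 1) - (1 + (q - 1) * x))) (at x)"
      unfolding g_def using x by (auto intro!: derivative_eq_intros simp: field_simps)
    moreover have "1 + (q - 1) * x \<le> (1 + x) powr (q - 1)"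
    proof -
      have "ln (1 + x) \<le> x" using x(1) by (rule ln_add_one_self_le_self)
      then have "(q - 1) * x \<le> (q - 1) * ln (1 + x)" using q by (intro mult_left_mono_neg) auto
      moreover have "1 + (q - 1) * ln (1 + x) \<le> exp ((q - 1) * ln (1 + x))" by (rule exp_ge_add_one_self)
      moreover have "(1 + x) powr (q - 1) = exp ((q - 1) * ln (1 + x))" using x by (simp add: powr_def)
      ultimately show ?thesis by linarith
    qed
    ultimately show "\<exists>d. (g has_real_derivative d) (at x) \<and> 0 \<le> d" using q by fastforce
  qed
  then show ?thesis by (simp add: g_def)
qed

text \<open>Equivalent to the sign of the derivative in \<open>small_angle_decreasing\<close>; the constant \<open>20/27\<close> comes from \<open>2 q + 1 \<ge> 27/10\<close>.\<close>

lemma ln_cos_powr_margin: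
  fixes x q :: real
  assumes x: "0 < x" "x \<le> 6 / 5" and q: "17 / 20 \<le> q" "q \<le> 1"
  defines "L \<equiv> - 2 * ln (cos x)"
  shows "1 + 2 * q * (x * tan x / L) \<le> (2 * q + 1) * (L / x\<^sup>2) powr q"
proof -
  define k where "k = x * tan x / L - 1"
  obtain e where e: "0 \<le> e" "1 + e \<le> L / x\<^sup>2" "20 / 27 * k \<le> e - 3 / 40 * e\<^sup>2"
    using ln_cos_margin[OF x] unfolding k_def L_def by blast
  have L1: "1 \<le> (L / x\<^sup>2) powr q" using e q by (intro ge_one_powr_ge_zero) auto
  have "2 * q * k \<le> (2 * q + 1) * ((L / x\<^sup>2) powr q - 1)"
  proof (cases "k \<le> 0")
    case True
    then have "2 * q * k \<le> 0" using q by (intro mult_nonneg_nonpos) auto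
    also have "0 \<le> (2 * q + 1) * ((L / x\<^sup>2) powr q - 1)" using L1 q by simp
    finally show ?thesis .
  next
    case False
    have "(1 - q) * e\<^sup>2 / 2 \<le> 3 / 40 * e\<^sup>2" using mult_right_mono[of "(1 - q) / 2" "3 / 40" "e\<^sup>2"] q by simp
    then have "20 / 27 * k \<le> e - (1 - q) * e\<^sup>2 / 2" using e by simp
    then have "q * (20 / 27 * k) \<le> q * (e - (1 - q) * e\<^sup>2 / 2)" using q by (intro mult_left_mono) auto
    also have "\<dots> = 1 + q * e - q * (1 - q) * e\<^sup>2 / 2 - 1" by (simp add: algebra_simps)
    also have "\<dots> \<le> (1 + e) powr q - 1" using one_plus_powr_lower[of q e] q e by simp
    also have "\<dots> \<le> (L / x\<^sup>2) powr q - 1" using q e by (intro diff_right_mono powr_mono2) auto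
    finally have *: "q * (20 / 27 * k) \<le> (L / x\<^sup>2) powr q - 1" .
    have "2 * q * k = 27 / 10 * (q * (20 / 27 * k))" by simp
    also have "\<dots> \<le> (2 * q + 1) * (q * (20 / 27 * k))" using q False by (intro mult_right_mono) auto
    also have "\<dots> \<le> (2 * q + 1) * ((L / x\<^sup>2) powr q - 1)" using q * by (intro mult_left_mono) auto
    finally show ?thesis .
  qed
  then show ?thesis by (simp add: k_def algebra_simps)
qed

lemma ln_cos_neg: "0 < x \<Longrightarrow> x < pi / 2 \<Longrightarrow> 0 < - 2 * ln (cos x)"
  using cos_gt_zero_pi[of x] cos_monotone_0_pi[of 0 x] by (simp add: ln_less_zero)

lemma DERIV_ln_cos_powr:
  assumes "0 < x" "x < pi / 2"
  shows "((\<lambda>x. (- 2 * ln (cos x)) powr (- q)) has_real_derivative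
     - q * (2 * tan x) * (- 2 * ln (cos x)) powr (- q - 1)) (at x)"
  using ln_cos_neg[OF assms] cos_gt_zero_pi[of x] assms
  by (auto intro!: derivative_eq_intros simp: tan_def)

text \<open>The numerator of the derivative is L^(-q) times 1 + 2 q t tan t / L - (2 q + 1) (L /
  t^2)^q with L = -2 ln (cos t), which \<open>ln_cos_powr_margin\<close> makes nonpositive. The
  difference of powers is the threshold that \<open>cos_defect\<close> must not exceed if
  \<open>cos_tail\<close> is to dominate.\<close>

lemma small_angle_decreasing:
  fixes x x' q :: real
  assumes x: "0 < x" "x \<le> x'" "x' \<le> 6 / 5" and q: "17 / 20 \<le> q" "q \<le> 1"
  shows "(x' powr (- 2 * q) - (- 2 * ln (cos x')) powr (- q)) / x' \<le> (x powr (- 2 * q) - (- 2 * ln (cos x)) powr (- q)) / x"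
proof (rule DERIV_nonpos_imp_nonincreasing[OF x(2)])
  let ?f = "\<lambda>x. (x powr (- 2 * q) - (- 2 * ln (cos x)) powr (- q)) / x"
  fix t assume t: "x \<le> t" "t \<le> x'"
  have t0: "0 < t" "t < pi / 2" "t \<le> 6 / 5" using t x pi_gt_313 by auto
  define L where "L = - 2 * ln (cos t)"
  have L: "L > 0" unfolding L_def using ln_cos_neg[OF t0(1,2)] by simp
  define f' where "f' = ((- 2 * q * t powr (- 2 * q - 1) - (- q * (2 * tan t) * L powr (- q - 1))) * t
     - (t powr (- 2 * q) - L powr (- q))) / (t * t)"
  have "(?f has_real_derivative f') (at t)"
  proof -
    have P: "((\<lambda>x. x powr (- 2 * q)) has_real_derivative - 2 * q * t powr (- 2 * q - 1)) (at t)"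
      using t0 by (auto intro!: derivative_eq_intros)
    show ?thesis unfolding f'_def L_def
      using DERIV_divide[OF DERIV_diff[OF P DERIV_ln_cos_powr[OF t0(1,2), of q]] DERIV_ident] t0 by simp
  qed
  moreover have "f' \<le> 0"
  proof -
    have e1: "t powr (- 2 * q - 1) * t = t powr (- 2 * q)" using t0 by (simp add: powr_diff)
    have e2: "L powr (- q - 1) = L powr (- q) / L" using L by (simp add: powr_diff)
    have e3: "t powr (- 2 * q) = L powr (- q) * (L / t\<^sup>2) powr q"
    proof -
      have "t\<^sup>2 = t powr 2" using t0 by simp
      then have "t powr (- 2 * q) = inverse ((t\<^sup>2) powr q)" using t0 by (simp only: powr_powr flip: powr_minus) simp
      then show ?thesis using t0 L by (simp add: powr_divide powr_minus field_simps)
    qed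
    have "(- 2 * q * t powr (- 2 * q - 1) - (- q * (2 * tan t) * L powr (- q - 1))) * t
     - (t powr (- 2 * q) - L powr (- q)) = - 2 * q * (t powr (- 2 * q - 1) * t) + 2 * q * (t * tan t * L powr (- q - 1))
     - t powr (- 2 * q) + L powr (- q)" by (simp add: algebra_simps)
    also have "\<dots> = L powr (- q) * ((1 + 2 * q * (t * tan t / L)) - (2 * q + 1) * (L / t\<^sup>2) powr q)"
      unfolding e1 e2 e3 by (simp add: algebra_simps)
    also have "\<dots> \<le> 0"
      using ln_cos_powr_margin[OF t0(1,3) q] unfolding L_def by (intro mult_nonneg_nonpos) auto
    finally show ?thesis unfolding f'_def by (intro divide_nonpos_nonneg) auto
  qed
  ultimately show "\<exists>d. (?f has_real_derivative d) (at t) \<and> d \<le> 0" by blast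
qed

text \<open>This fixes the point at which small and large angles are separated: from 6/5 on, -2 ln
  (cos t) is at least 2, as the next lemma requires, while \<open>ln_cos_margin\<close> reaches up
  to 6/5.\<close>

lemma ln_cos_six_fifths: "1 \<le> - ln (cos (6 / 5 :: real))"
proof -
  have "cos (6 / 5 :: real) \<le> 1 - (6 / 5)\<^sup>2 / 2 + (6 / 5) ^ 4 / 24" by (rule cos_taylor_bounds)
  also have "\<dots> \<le> 100 / 272" by (simp add: power_divide)
  also have "\<dots> \<le> exp (- 1)" using e_less_272 by (simp add: exp_minus field_simps)
  finally have "cos (6 / 5 :: real) \<le> exp (- 1)" .
  moreover have "0 < cos (6 / 5 :: real)" using pi_gt_313 by (intro cos_gt_zero_pi) auto
  ultimately show ?thesis using ln_le_cancel_iff[of "cos (6 / 5)" "exp (- 1)"] by simp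
qed

text \<open>Up to a positive factor the derivative is 1 - 2 q \<beta> tan t / L with \<beta> = pi/2
  - t. Here \<beta> tan t = \<beta> / tan \<beta> \<le> 1, q \<le> 1 and L \<ge> 2.\<close>

lemma large_angle_increasing:
  fixes x x' q :: real
  assumes x: "6 / 5 \<le> x" "x \<le> x'" "x' < pi / 2" and q: "0 < q" "q \<le> 1"
  shows "(- 2 * ln (cos x)) powr (- q) / (pi / 2 - x) \<le> (- 2 * ln (cos x')) powr (- q) / (pi / 2 - x')"
proof (rule DERIV_nonneg_imp_nondecreasing[OF x(2)])
  let ?f = "\<lambda>x. (- 2 * ln (cos x)) powr (- q) / (pi / 2 - x)"
  fix t assume t: "x \<le> t" "t \<le> x'"
  have t0: "0 < t" "t < pi / 2" "6 / 5 \<le> t" using t x by auto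
  define L where "L = - 2 * ln (cos t)"
  define \<beta> where "\<beta> = pi / 2 - t"
  have \<beta>: "\<beta> > 0" "\<beta> < pi / 2" using t0 by (auto simp: \<beta>_def)
  have c: "cos t > 0" using t0 by (intro cos_gt_zero_pi) auto
  have "cos t \<le> cos (6 / 5)" using t0 by (intro cos_monotone_0_pi_le) auto
  then have "ln (cos t) \<le> ln (cos (6 / 5))" using c by simp
  then have L: "2 \<le> L" using ln_cos_six_fifths unfolding L_def by simp
  have tan: "\<beta> * tan t \<le> 1"
  proof -
    have "tan t = inverse (tan \<beta>)" unfolding \<beta>_def tan_def by (simp add: cos_diff sin_diff)
    moreover have "\<beta> \<le> tan \<beta>" 
    proof -
      have "arctan (tan \<beta>) \<le> tan \<beta>" using \<beta> tan_gt_zero[of \<beta>] by (intro arctan_le_self) auto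
      then show ?thesis using \<beta> by (simp add: arctan_tan)
    qed
    moreover have "tan \<beta> > 0" using \<beta> by (intro tan_gt_zero) auto
    ultimately show ?thesis by (simp add: pos_divide_le_eq flip: divide_inverse)
  qed
  define f' where "f' = (- q * (2 * tan t) * L powr (- q - 1) * (pi / 2 - t) + L powr (- q)) / ((pi / 2 - t) * (pi / 2 - t))"
  have "(?f has_real_derivative f') (at t)"
  proof -
    have P: "((\<lambda>x. pi / 2 - x) has_real_derivative - 1) (at t)" by (auto intro!: derivative_eq_intros)
    show ?thesis unfolding f'_def L_def
      using DERIV_divide[OF DERIV_ln_cos_powr[OF t0(1,2), of q] P] t0 by simp
  qed
  moreover have "0 \<le> f'"
  proof -
    have e2: "L powr (- q - 1) = L powr (- q) / L" using L by (simp add: powr_diff)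
    have "- q * (2 * tan t) * L powr (- q - 1) * (pi / 2 - t) + L powr (- q)
        = L powr (- q) * (1 - 2 * (q * (\<beta> * tan t)) / L)"
      unfolding e2 \<beta>_def by (simp add: algebra_simps)
    moreover have "q * (\<beta> * tan t) \<le> 1 * 1"
    proof (rule mult_mono)
      show "0 \<le> \<beta> * tan t" using \<beta> tan_gt_zero[of t] t0 by (intro mult_nonneg_nonneg) auto
    qed (use q tan in simp_all)
    then have "2 * (q * (\<beta> * tan t)) / L \<le> 1" using L by (simp add: pos_divide_le_eq)
    ultimately have "0 \<le> - q * (2 * tan t) * L powr (- q - 1) * (pi / 2 - t) + L powr (- q)" by simp
    then show ?thesis unfolding f'_def by (intro divide_nonneg_nonneg) auto
  qed
  ultimately show "\<exists>d. (?f has_real_derivative d) (at t) \<and> 0 \<le> d" by blast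
qed

subsection \<open>Single crossing of the distribution functions\<close>

text \<open>For 0 \<le> x < c this is p times the mass of [c - x, c + x] under the density
  u^(-p-1).\<close>

definition power_gap :: "real \<Rightarrow> real \<Rightarrow> real \<Rightarrow> real" where
  "power_gap p c x = (c - x) powr (- p) - (c + x) powr (- p)"

lemma power_gap_nonneg: "0 \<le> p \<Longrightarrow> 0 \<le> x \<Longrightarrow> x < c \<Longrightarrow> 0 \<le> power_gap p c x"
  unfolding power_gap_def by (auto intro!: powr_mono2')

text \<open>The gap is convex in x and vanishes at x = 0, so its quotient by x increases.\<close>

lemma power_gap_ratio_mono:
  assumes p: "0 \<le> p" and x: "0 \<le> x" "x \<le> x'" "0 < x'" "x' < c"
  shows "power_gap p c x \<le> x / x' * power_gap p c x'"
proof -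
  have conv: "convex_on {0..x'} (power_gap p c)"
  proof (rule f''_ge0_imp_convex[where f' = "\<lambda>x. p * ((c - x) powr (- p - 1) + (c + x) powr (- p - 1))"
        and f'' = "\<lambda>x. p * ((p + 1) * ((c - x) powr (- p - 1 - 1) - (c + x) powr (- p - 1 - 1)))"])
    fix t assume "t \<in> {0..x'}"
    then have t: "0 \<le> t" "c - t > 0" "c + t > 0" using x by auto
    show "(power_gap p c has_real_derivative p * ((c - t) powr (- p - 1) + (c + t) powr (- p - 1))) (at t)"
      unfolding power_gap_def[abs_def] using t
      by (auto intro!: derivative_eq_intros simp: algebra_simps)
    show "((\<lambda>x. p * ((c - x) powr (- p - 1) + (c + x) powr (- p - 1))) has_real_derivative
        p * ((p + 1) * ((c - t) powr (- p - 1 - 1) - (c + t) powr (- p - 1 - 1)))) (at t)"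
      using t by (auto intro!: derivative_eq_intros simp: algebra_simps)
    have "(c + t) powr (- p - 1 - 1) \<le> (c - t) powr (- p - 1 - 1)"
      using t p by (intro powr_mono2') auto
    then show "0 \<le> p * ((p + 1) * ((c - t) powr (- p - 1 - 1) - (c + t) powr (- p - 1 - 1)))"
      using p by simp
  qed auto
  define u where "u = x / x'"
  have u: "0 \<le> u" "u \<le> 1" "u * x' = x" using x by (auto simp: u_def)
  have "power_gap p c ((1 - u) *\<^sub>R 0 + u *\<^sub>R x') \<le> (1 - u) * power_gap p c 0 + u * power_gap p c x'"
    by (rule convex_onD[OF conv]) (use u x in auto)
  then show ?thesis using u by (simp add: power_gap_def u_def)
qed

text \<open>Up to the factor \<open>p\<close>, \<open>cos_tail p a\<close> and \<open>(- 2 ln (cos a)) powr (- p / 2)\<close> are the masses of \<open>{\<bar>cos u\<bar> \<le> cos a}\<close> and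
  \<open>{exp (- u\<^sup>2 / 2) \<le> cos a}\<close> under the density \<open>u powr (- p - 1)\<close>. For large \<open>a\<close> their ratio is monotone because \<open>cos_tail p a / (pi / 2 - a)\<close> is
  decreasing in \<open>a\<close>; for small \<open>a\<close> one compares \<open>cos_defect p a / a\<close>, which is increasing, with
  \<open>small_angle_decreasing\<close>.\<close>

abbreviation tail_term :: "real \<Rightarrow> real \<Rightarrow> nat \<Rightarrow> real" where
  "tail_term p a k \<equiv> power_gap p (pi / 2 + pi * real k) (pi / 2 - a)"

abbreviation defect_term :: "real \<Rightarrow> real \<Rightarrow> nat \<Rightarrow> real" where
  "defect_term p a k \<equiv> power_gap p (pi * real (Suc k)) a"

definition cos_tail :: "real \<Rightarrow> real \<Rightarrow> real" where
  "cos_tail p a = (\<Sum>k. tail_term p a k)"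

definition cos_defect :: "real \<Rightarrow> real \<Rightarrow> real" where
  "cos_defect p a = (\<Sum>k. defect_term p a k)"

lemma tail_term_nonneg:
  assumes "0 \<le> p" "0 < a" "a < pi / 2"
  shows "0 \<le> tail_term p a k"
proof -
  have "0 \<le> pi * real k" by simp
  then show ?thesis using assms by (intro power_gap_nonneg) linarith+
qed

text \<open>The intervals around pi/2 + pi k of radius pi/2 - a, where the cosine is small,
  alternate with those around pi (k + 1) of radius a. Together they tile a half-line from a on, so
  the powers telescope.\<close>

lemma cos_tail_partial:
  "(\<Sum>k<Suc n. tail_term p a k)
     = a powr (- p) - (\<Sum>k<n. defect_term p a k) - (pi * real (Suc n) - a) powr (- p)"
proof (induction n)
  case 0
  then show ?case by (simp add: power_gap_def)
next
  case (Suc n)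
  show ?case
    unfolding sum.lessThan_Suc[of _ "Suc n"] Suc.IH sum.lessThan_Suc[of _ n]
    by (simp add: power_gap_def algebra_simps)
qed

lemma cos_tail_summable:
  assumes "0 \<le> p" "0 < a" "a < pi / 2"
  shows "summable (\<lambda>k. tail_term p a k)"
    and "summable (\<lambda>k. defect_term p a k)"
proof -
  have nn: "0 \<le> tail_term p a k" for k
    using assms by (intro tail_term_nonneg) auto
  have pk: "a < pi * real (Suc k)" for k
  proof -
    have "pi * 1 \<le> pi * real (Suc k)" by (intro mult_left_mono) auto
    then show ?thesis using assms by linarith
  qed
  have nn': "0 \<le> defect_term p a k" for k
    using assms pk by (intro power_gap_nonneg) auto
  have sn: "0 \<le> (\<Sum>k<n. tail_term p a k)"
    and sn': "0 \<le> (\<Sum>k<n. defect_term p a k)" for n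
    by (intro sum_nonneg nn nn')+
  have b: "(\<Sum>k<Suc n. tail_term p a k) + (\<Sum>k<n. defect_term p a k) \<le> a powr (- p)" for n
    unfolding cos_tail_partial by simp
  show "summable (\<lambda>k. tail_term p a k)"
  proof (rule summableI_nonneg_bounded[where x = "a powr (- p)"])
    fix n
    have "(\<Sum>k<n. tail_term p a k) \<le> (\<Sum>k<Suc n. tail_term p a k)"
      using nn by simp
    also have "\<dots> \<le> a powr (- p)" using b[of n] sn'[of n] by linarith
    finally show "(\<Sum>k<n. tail_term p a k) \<le> a powr (- p)" .
  qed (rule nn)
  show "summable (\<lambda>k. defect_term p a k)"
  proof (rule summableI_nonneg_bounded[where x = "a powr (- p)"])
    fix n
    show "(\<Sum>k<n. defect_term p a k) \<le> a powr (- p)"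
      using b[of n] sn[of "Suc n"] by linarith
  qed (rule nn')
qed

lemma cos_tail_eq:
  assumes p: "0 < p" and a: "0 < a" "a < pi / 2"
  shows "cos_tail p a = a powr (- p) - cos_defect p a"
proof -
  have "(\<lambda>n. \<Sum>k<Suc n. tail_term p a k) \<longlonglongrightarrow> cos_tail p a"
    unfolding cos_tail_def using cos_tail_summable(1)[of p a] assms by (intro LIMSEQ_Suc summable_LIMSEQ) auto
  moreover have "(\<lambda>n. a powr (- p) - (\<Sum>k<n. defect_term p a k) - (pi * real (Suc n) - a) powr (- p))
      \<longlonglongrightarrow> a powr (- p) - cos_defect p a - 0"
  proof (intro tendsto_intros)
    show "(\<lambda>n. \<Sum>k<n. defect_term p a k) \<longlonglongrightarrow> cos_defect p a"
      unfolding cos_defect_def using cos_tail_summable(2)[of p a] assms by (intro summable_LIMSEQ) auto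
    have "filterlim (\<lambda>n. pi * real (Suc n) - a) at_top sequentially"
      using pi_gt_zero by real_asymp
    then show "(\<lambda>n. (pi * real (Suc n) - a) powr (- p)) \<longlonglongrightarrow> 0"
      using p by (intro tendsto_neg_powr) auto
  qed
  ultimately show ?thesis
    unfolding cos_tail_partial by (simp add: LIMSEQ_unique)
qed

text \<open>Domination is inherited by smaller angles, that is, by higher levels cos a. This is the
  single crossing in terms of angles, with p = 2 q.\<close>

lemma cos_tail_single_crossing:
  fixes q a a' :: real
  assumes q: "17 / 20 \<le> q" "q \<le> 1" and a: "0 < a" "a \<le> a'" "a' < pi / 2"
    and ge: "(- 2 * ln (cos a')) powr (- q) \<le> cos_tail (2 * q) a'"
  shows "(- 2 * ln (cos a)) powr (- q) \<le> cos_tail (2 * q) a"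
proof -
  define F where "F = (\<lambda>a. (- 2 * ln (cos a)) powr (- q))"
  have large: "F a \<le> cos_tail (2 * q) a"
    if h: "6 / 5 \<le> a" "a \<le> a'" "a' < pi / 2" "F a' \<le> cos_tail (2 * q) a'" for a a'
  proof -
    \<comment> \<open>Passing from a to a', every tail term falls at least by the factor \<rho>,
      whereas F falls at most by it. Hence domination at a' forces domination at a.\<close>
    define \<rho> where "\<rho> = (pi / 2 - a') / (pi / 2 - a)"
    have \<rho>: "\<rho> > 0" using h by (simp add: \<rho>_def)
    have "F a / (pi / 2 - a) \<le> F a' / (pi / 2 - a')"
      unfolding F_def using large_angle_increasing[OF h(1-3), of q] q by simp
    then have "\<rho> * F a \<le> F a'" using h by (simp add: \<rho>_def field_simps)
    also have "\<dots> \<le> cos_tail (2 * q) a'" by (rule h)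
    also have "\<dots> \<le> (\<Sum>k. \<rho> * tail_term (2 * q) a k)"
      unfolding cos_tail_def
    proof (rule suminf_le)
      fix k
      show "tail_term (2 * q) a' k \<le> \<rho> * tail_term (2 * q) a k"
      proof -
        have "0 \<le> pi * real k" by simp
        then show ?thesis unfolding \<rho>_def using h q by (intro power_gap_ratio_mono) linarith+
      qed
    qed (use h q in \<open>auto intro!: cos_tail_summable summable_mult\<close>)
    also have "\<dots> = \<rho> * cos_tail (2 * q) a"
      unfolding cos_tail_def using h q by (intro suminf_mult cos_tail_summable) auto
    finally show ?thesis using \<rho> by simp
  qed
  have small: "F a \<le> cos_tail (2 * q) a"
    if h: "0 < a" "a \<le> a'" "a' \<le> 6 / 5" "F a' \<le> cos_tail (2 * q) a'" for a a'
  proof -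
    have pi: "a' < pi / 2" using h pi_gt_313 by simp
    have "cos_defect (2 * q) a \<le> (\<Sum>k. a / a' * defect_term (2 * q) a' k)"
      unfolding cos_defect_def
    proof (rule suminf_le)
      fix k
      have "pi * 1 \<le> pi * real (Suc k)" by (intro mult_left_mono) auto
      then have "a' < pi * real (Suc k)" using pi h by linarith
      then show "defect_term (2 * q) a k \<le> a / a' * defect_term (2 * q) a' k"
        using h q by (intro power_gap_ratio_mono) auto
    qed (use h q pi in \<open>auto intro!: cos_tail_summable summable_mult simp del: of_nat_Suc\<close>)
    also have "\<dots> = a / a' * cos_defect (2 * q) a'"
      unfolding cos_defect_def using h q pi by (intro suminf_mult cos_tail_summable) auto
    also have "\<dots> \<le> a / a' * (a' powr (- 2 * q) - F a')"
      using h q pi cos_tail_eq[of "2 * q" a'] by (intro mult_left_mono) auto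
    also have "\<dots> \<le> a powr (- 2 * q) - F a"
    proof -
      have "(a' powr (- 2 * q) - F a') / a' \<le> (a powr (- 2 * q) - F a) / a"
        unfolding F_def using small_angle_decreasing[OF h(1-3) q] .
      then show ?thesis using h by (simp add: field_simps)
    qed
    finally show ?thesis using cos_tail_eq[of "2 * q" a] h q pi by simp
  qed
  show ?thesis
  proof (cases "a' \<le> 6 / 5")
    case True
    then show ?thesis using small[of a a'] a ge by (simp add: F_def)
  next
    case False
    \<comment> \<open>If a < 6/5 < a', domination travels in two legs: from a' down to 6/5 by
      \<open>large\<close>, then from 6/5 to a by \<open>small\<close>.\<close>
    then have *: "F (max a (6 / 5)) \<le> cos_tail (2 * q) (max a (6 / 5))"
      using large[of "max a (6 / 5)" a'] a ge by (simp add: F_def)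
    show ?thesis
      using small[of a "6 / 5"] * a by (cases "a \<le> 6 / 5") (auto simp: F_def max_def)
  qed
qed

subsection \<open>Integral representation of absolute moments\<close>

text \<open>The Levy density of a p-stable law, on the positive half-line.\<close>

definition jump_wt :: "real \<Rightarrow> real \<Rightarrow> real" where
  "jump_wt p u = indicator {0<..} u * u powr (- p - 1)"

lemma jump_wt_nonneg [simp]: "0 \<le> jump_wt p u"
  by (simp add: jump_wt_def)

lemma jump_wt_measurable [measurable]: "jump_wt p \<in> borel_measurable borel"
  unfolding jump_wt_def[abs_def] by measurable

lemma nn_integral_jump_wt_tail:
  assumes "0 < p" "0 < a"
  shows "(\<integral>\<^sup>+u. ennreal (jump_wt p u) * indicator {a..} u \<partial>lborel) = ennreal (a powr (- p) / p)"
proof -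
  have "(\<integral>\<^sup>+u. ennreal (jump_wt p u) * indicator {a..} u \<partial>lborel)
      = (\<integral>\<^sup>+u. ennreal (u powr (- p - 1)) * indicator {a..} u \<partial>lborel)"
    using assms by (intro nn_integral_cong) (auto simp: jump_wt_def indicator_def)
  also have "\<dots> = ennreal (0 - (- (a powr (- p) / p)))"
  proof (rule nn_integral_FTC_atLeast)
    fix x assume "a \<le> x"
    then show "((\<lambda>x. - (x powr (- p) / p)) has_real_derivative x powr (- p - 1)) (at x)"
      using assms by (auto intro!: derivative_eq_intros)
  next
    show "((\<lambda>x. - (x powr (- p) / p)) \<longlongrightarrow> 0) at_top"
    proof -
      have "((\<lambda>x. x powr (- p)) \<longlongrightarrow> 0) at_top" using assms by (intro tendsto_neg_powr filterlim_ident) auto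
      then have "((\<lambda>x. - (x powr (- p) / p)) \<longlongrightarrow> - (0 / p)) at_top" using assms by (intro tendsto_intros) auto
      then show ?thesis by simp
    qed
  qed auto
  finally show ?thesis by simp
qed

lemma nn_integral_jump_wt_Icc:
  assumes "0 < p" "0 < a" "a \<le> b"
  shows "(\<integral>\<^sup>+u. ennreal (jump_wt p u) * indicator {a..b} u \<partial>lborel) = ennreal ((a powr (- p) - b powr (- p)) / p)"
proof -
  have "(\<integral>\<^sup>+u. ennreal (jump_wt p u) * indicator {a..b} u \<partial>lborel)
      = (\<integral>\<^sup>+u. ennreal (u powr (- p - 1)) * indicator {a..b} u \<partial>lborel)"
    using assms by (intro nn_integral_cong) (auto simp: jump_wt_def indicator_def)
  also have "\<dots> = ennreal (- (b powr (- p) / p) - (- (a powr (- p) / p)))"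
  proof (rule nn_integral_FTC_Icc)
    fix x assume "x \<in> {a..b}"
    then show "((\<lambda>x. - (x powr (- p) / p)) has_real_derivative x powr (- p - 1)) (at x)"
      using assms by (auto intro!: derivative_eq_intros)
  qed (use assms in auto)
  finally show ?thesis by (simp add: diff_divide_distrib)
qed

lemma integrable_jump_wt_tail:
  assumes "0 < p" "0 < a"
  shows "integrable lborel (\<lambda>u. indicator {a..} u * jump_wt p u)"
proof (rule integrableI_nn_integral_finite[where x = "a powr (- p) / p"])
  show "(\<integral>\<^sup>+ x. ennreal (indicator {a..} x * jump_wt p x) \<partial>lborel) = ennreal (a powr (- p) / p)"
    unfolding nn_integral_jump_wt_tail[OF assms, symmetric]
    by (intro nn_integral_cong) (auto simp: indicator_def)
qed (auto simp: assms less_imp_le)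

lemma integrable_jump_wt_head:
  assumes "0 < p" "p < 2"
  shows "integrable lborel (\<lambda>u. indicator {0..1} u * (u\<^sup>2 * jump_wt p u))"
proof -
  have h: "((\<lambda>x. x powr (1 - p)) has_integral (1 powr (1 - p + 1) / (1 - p + 1))) {0..1}"
    using assms by (intro has_integral_powr_from_0) auto
  have eq: "indicator {0..1} u * (u\<^sup>2 * jump_wt p u) = (if u \<in> {0..1} then u powr (1 - p) else 0)" for u
  proof (cases "0 < u")
    case True
    have "u\<^sup>2 * u powr (- p - 1) = u powr (2 + (- p - 1))" using True by (simp only: powr_add powr_numeral)
    then show ?thesis using True by (simp add: jump_wt_def indicator_def)
  qed (auto simp: jump_wt_def indicator_def)
  have "integral\<^sup>N lborel (\<lambda>u. ennreal (indicator {0..1} u * (u\<^sup>2 * jump_wt p u))) = ennreal (1 powr (1 - p + 1) / (1 - p + 1))"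
  proof (rule nn_integral_has_integral_lborel)
    show "((\<lambda>u. indicator {0..1} u * (u\<^sup>2 * jump_wt p u)) has_integral 1 powr (1 - p + 1) / (1 - p + 1)) UNIV"
      unfolding eq using h by (simp only: has_integral_restrict_UNIV)
  qed auto
  then show ?thesis
    by (rule integrableI_nn_integral_finite[rotated 2]) (use assms in auto)
qed

text \<open>Near 0 the factor u^2 leaves u^(1-p), integrable since p < 2; at infinity u^(-p-1) is
  integrable since p > 0.\<close>

lemma integrable_mult_jump_wt:
  fixes f :: "real \<Rightarrow> real"
  assumes p: "0 < p" "p < 2" and [measurable]: "f \<in> borel_measurable borel"
    and f: "\<And>u. 0 < u \<Longrightarrow> \<bar>f u\<bar> \<le> C * u\<^sup>2" "\<And>u. 0 < u \<Longrightarrow> \<bar>f u\<bar> \<le> C"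
  shows "integrable lborel (\<lambda>u. f u * jump_wt p u)"
proof (rule Bochner_Integration.integrable_bound)
  show "integrable lborel (\<lambda>u. C * (indicator {0..1} u * (u\<^sup>2 * jump_wt p u)) + C * (indicator {1..} u * jump_wt p u))"
    using p by (intro Bochner_Integration.integrable_add integrable_mult_right integrable_jump_wt_head integrable_jump_wt_tail) auto
  have C: "0 \<le> C" using f(2)[of 1] by simp
  show "AE u in lborel. norm (f u * jump_wt p u)
      \<le> norm (C * (indicator {0..1} u * (u\<^sup>2 * jump_wt p u)) + C * (indicator {1..} u * jump_wt p u))"
  proof (rule AE_I2)
    fix u :: real
    show "norm (f u * jump_wt p u) \<le> norm (C * (indicator {0..1} u * (u\<^sup>2 * jump_wt p u)) + C * (indicator {1..} u * jump_wt p u))"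
    proof (cases "0 < u")
      case True
      have "\<bar>f u\<bar> * jump_wt p u \<le> C * u\<^sup>2 * jump_wt p u" "\<bar>f u\<bar> * jump_wt p u \<le> C * jump_wt p u"
        using f True by (auto intro!: mult_right_mono)
      moreover have "0 \<le> C * (u\<^sup>2 * jump_wt p u)" "0 \<le> C * jump_wt p u" using C by auto
      ultimately show ?thesis using True by (auto simp: abs_mult indicator_def mult.assoc)
    qed (simp add: jump_wt_def)
  qed
qed auto

lemma integral_jump_wt_scale:
  assumes "0 < c"
  shows "(\<integral>u. f (c * u) * jump_wt p u \<partial>lborel) = c powr p * (\<integral>u. f u * jump_wt p u \<partial>lborel)"
proof -
  have wt: "jump_wt p (u / c) = c powr (p + 1) * jump_wt p u" for u
    using assms by (cases "0 < u") (auto simp: jump_wt_def indicator_def powr_divide powr_minus powr_diff powr_add field_simps zero_less_divide_iff)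
  have "(\<integral>u. f (c * u) * jump_wt p u \<partial>lborel) = \<bar>1 / c\<bar> *\<^sub>R (\<integral>u. f (c * (0 + 1 / c * u)) * jump_wt p (0 + 1 / c * u) \<partial>lborel)"
    using assms by (intro lborel_integral_real_affine) auto
  also have "\<dots> = 1 / c * (\<integral>u. c powr (p + 1) * (f u * jump_wt p u) \<partial>lborel)"
    using assms wt by (simp add: mult_ac)
  also have "\<dots> = c powr p * (\<integral>u. f u * jump_wt p u \<partial>lborel)"
    using assms by (simp add: powr_add)
  finally show ?thesis .
qed

lemma one_minus_cos_le: "1 - cos x \<le> x\<^sup>2 / (2 :: real)"
proof -
  have "1 - cos x = 2 * (sin (x / 2))\<^sup>2" using cos_double_sin[of "x / 2"] by simp
  also have "(sin (x / 2))\<^sup>2 \<le> (x / 2)\<^sup>2" using abs_sin_x_le_abs_x[of "x / 2"] by (simp only: abs_le_square_iff)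
  finally show ?thesis by (simp add: power_divide)
qed

lemma integrable_cos_jump_wt:
  assumes "0 < p" "p < 2"
  shows "integrable lborel (\<lambda>u. (1 - cos (x * u)) * jump_wt p u)"
proof (rule integrable_mult_jump_wt[OF assms, where C = "max 2 (x\<^sup>2 / 2)"])
  fix u :: real assume "0 < u"
  have "\<bar>1 - cos (x * u)\<bar> = 1 - cos (x * u)" using cos_le_one[of "x * u"] by simp
  also have "\<dots> \<le> x\<^sup>2 / 2 * u\<^sup>2" using one_minus_cos_le[of "x * u"] by (simp add: power_mult_distrib)
  also have "\<dots> \<le> max 2 (x\<^sup>2 / 2) * u\<^sup>2" by (intro mult_right_mono) auto
  finally show "\<bar>1 - cos (x * u)\<bar> \<le> max 2 (x\<^sup>2 / 2) * u\<^sup>2" .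
  have "\<bar>1 - cos (x * u)\<bar> \<le> 2" using cos_le_one[of "x * u"] cos_ge_minus_one[of "x * u"] by linarith
  then show "\<bar>1 - cos (x * u)\<bar> \<le> max 2 (x\<^sup>2 / 2)" by (simp add: le_max_iff_disj)
qed simp

text \<open>Only its positivity is ever used: it is a common factor on both sides of each comparison
  of moments and cancels.\<close>

definition cos_const :: "real \<Rightarrow> real" where
  "cos_const p = (\<integral>u. (1 - cos u) * jump_wt p u \<partial>lborel)"

lemma abs_powr_eq_integral:
  assumes "0 < p" "p < 2"
  shows "(\<integral>u. (1 - cos (x * u)) * jump_wt p u \<partial>lborel) = cos_const p * \<bar>x\<bar> powr p"
proof (cases "x = 0")
  case False
  have "cos (x * u) = cos (\<bar>x\<bar> * u)" for u by (cases "0 \<le> x") auto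
  then have "(\<integral>u. (1 - cos (x * u)) * jump_wt p u \<partial>lborel) = (\<integral>u. (1 - cos (\<bar>x\<bar> * u)) * jump_wt p u \<partial>lborel)" by simp
  also have "\<dots> = \<bar>x\<bar> powr p * cos_const p"
    unfolding cos_const_def using False integral_jump_wt_scale[of "\<bar>x\<bar>" "\<lambda>u. 1 - cos u" p] by simp
  finally show ?thesis by simp
qed simp

lemma cos_const_pos:
  assumes "0 < p" "p < 2"
  shows "0 < cos_const p"
proof -
  have int: "integrable lborel (\<lambda>u. (1 - cos u) * jump_wt p u)"
    using integrable_cos_jump_wt[OF assms, of 1] by simp
  have nn: "0 \<le> (1 - cos u) * jump_wt p u" for u using cos_le_one[of u] by (intro mult_nonneg_nonneg) auto
  have "cos_const p \<noteq> 0"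
  proof
    assume "cos_const p = 0"
    then have "AE u in lborel. (1 - cos u) * jump_wt p u = 0"
      using integral_nonneg_eq_0_iff_AE[OF int] nn by (auto simp: cos_const_def)
    moreover have "(1 - cos u) * jump_wt p u \<noteq> 0" if "u \<in> {0<..<1}" for u
    proof -
      have "cos u < cos 0" using that pi_ge_two by (intro cos_monotone_0_pi) auto
      then show ?thesis using that by (simp add: jump_wt_def)
    qed
    ultimately have "AE u in lborel. u \<notin> {0<..<1 :: real}" by (auto elim!: eventually_mono)
    then have "emeasure lborel {0<..<1 :: real} = 0" by (subst (asm) AE_iff_measurable[of "{0<..<1}"]) auto
    then show False by simp
  qed
  moreover have "0 \<le> cos_const p" unfolding cos_const_def by (intro integral_nonneg_AE) (use nn in auto)
  ultimately show ?thesis by simp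
qed

lemma sgn_avg_integral:
  fixes g :: "real \<Rightarrow> real \<Rightarrow> real"
  assumes "\<And>x. integrable M (g x)"
  shows "integrable M (\<lambda>u. sgn_avg (\<lambda>x. g x u) as x)"
    and "(\<integral>u. sgn_avg (\<lambda>x. g x u) as x \<partial>M) = sgn_avg (\<lambda>x. \<integral>u. g x u \<partial>M) as x"
  using assms by (induction as arbitrary: x) auto

lemma sgn_avg_powr_integral:
  assumes p: "0 < p" "p < 2"
  shows "integrable lborel (\<lambda>u. (1 - (\<Prod>b\<leftarrow>bs. cos (b * u))) * jump_wt p u)"
    and "(\<integral>u. (1 - (\<Prod>b\<leftarrow>bs. cos (b * u))) * jump_wt p u \<partial>lborel) = cos_const p * sgn_moment p bs 0"
proof -
  have eq: "sgn_avg (\<lambda>x. (1 - cos (x * u)) * jump_wt p u) bs 0 = (1 - (\<Prod>b\<leftarrow>bs. cos (b * u))) * jump_wt p u" for u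
  proof -
    have "(\<lambda>x. (1 - cos (x * u)) * jump_wt p u) = (\<lambda>x. jump_wt p u + (- jump_wt p u) * cos (x * u))"
      by (simp add: fun_eq_iff algebra_simps)
    then show ?thesis by (simp only: sgn_avg_add sgn_avg_cmult sgn_avg_const sgn_avg_cos) (simp add: algebra_simps)
  qed
  show "integrable lborel (\<lambda>u. (1 - (\<Prod>b\<leftarrow>bs. cos (b * u))) * jump_wt p u)"
    using sgn_avg_integral(1)[of lborel "\<lambda>x u. (1 - cos (x * u)) * jump_wt p u" bs 0] integrable_cos_jump_wt[OF p]
    unfolding eq by blast
  show "(\<integral>u. (1 - (\<Prod>b\<leftarrow>bs. cos (b * u))) * jump_wt p u \<partial>lborel) = cos_const p * sgn_moment p bs 0"
    using sgn_avg_integral(2)[of lborel "\<lambda>x u. (1 - cos (x * u)) * jump_wt p u" bs 0] integrable_cos_jump_wt[OF p]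
    unfolding eq abs_powr_eq_integral[OF p] sgn_avg_cmult by blast
qed

section \<open>Absolute moments of the standard normal law\<close>

definition normal_moment :: "real \<Rightarrow> real" where
  "normal_moment p = 2 powr (p / 2) * Gamma ((p + 1) / 2) / sqrt pi"

text \<open>The substitution t = x^2 / 2 turns Euler's integral for Gamma ((p + 1) / 2) into the
  integral over the positive half-line; reflection supplies the negative half.\<close>

lemma nn_integral_normal_abs_powr:
  assumes p: "0 < p"
  shows "(\<integral>\<^sup>+g. ennreal (std_normal_density g * \<bar>g\<bar> powr p) \<partial>lborel) = ennreal (normal_moment p)"
proof -
  let ?P = "\<lambda>x::real. indicator {0<..} x * (x powr p * exp (- x\<^sup>2 / 2))" and ?N = "\<lambda>x::real. indicator {..<0} x * (\<bar>x\<bar> powr p * exp (- x\<^sup>2 / 2))"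
  define s where "s = (p + 1) / 2"
  have s: "s > 0" using p by (simp add: s_def)
  let ?G = "\<lambda>x::real. \<bar>x\<bar> * ((x\<^sup>2 / 2) powr (s - 1) / exp (x\<^sup>2 / 2))" and ?T = "\<lambda>t::real. t powr (s - 1) / exp t"
  have "(?T has_integral Gamma s) {0<..}"
    using Gamma_integral_real[OF s] by (rule has_integral_spike_set_eq[THEN iffD1, rotated 2]) (auto intro: negligible_subset[of "{0}"])
  then have ai: "?T absolutely_integrable_on {0<..} \<and> integral {0<..} ?T = Gamma s"
    by (auto intro!: nonnegative_absolutely_integrable_1)
  have im: "(\<lambda>x. x\<^sup>2 / 2) ` {0<..} = {0::real<..}"
  proof (intro equalityI subsetI)
    fix t :: real assume "t \<in> {0<..}"
    then have "t = (sqrt (2 * t))\<^sup>2 / 2" "sqrt (2 * t) \<in> {0<..}" by auto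
    then show "t \<in> (\<lambda>x. x\<^sup>2 / 2) ` {0<..}" by blast
  qed auto
  have cv: "?G absolutely_integrable_on {0<..} \<and>
     integral {0<..} ?G = Gamma s"
  proof (subst has_absolute_integral_change_of_variables_1'[where g = "\<lambda>x. x\<^sup>2 / 2" and f = ?T])
    show "inj_on (\<lambda>x::real. x\<^sup>2 / 2) {0<..}" by (auto simp: inj_on_def power2_eq_iff)
    show "?T absolutely_integrable_on (\<lambda>x. x\<^sup>2 / 2) ` {0<..} \<and> integral ((\<lambda>x. x\<^sup>2 / 2) ` {0<..}) ?T = Gamma s"
      unfolding im by (rule ai)
  qed (auto intro!: derivative_eq_intros)
  have h: "(?G has_integral Gamma s) {0<..}"
    unfolding has_integral_iff
    by (intro conjI set_lebesgue_integral_eq_integral(1) conjunct1[OF cv] conjunct2[OF cv])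
  have hi: "((?P) has_integral 2 powr (s - 1) * Gamma s) UNIV"
  proof -
    have "((\<lambda>x. 2 powr (s - 1) * ?G x) has_integral 2 powr (s - 1) * Gamma s) {0<..}"
      by (rule has_integral_mult_right[OF h])
    moreover have "2 powr (s - 1) * ?G x = x powr p * exp (- x\<^sup>2 / 2)" if "x \<in> {0<..}" for x
    proof -
      have "x\<^sup>2 = x powr 2" using that by simp
      moreover have "2 * (s - 1) = p - 1" by (simp add: s_def field_simps)
      ultimately have "(x\<^sup>2) powr (s - 1) = x powr (p - 1)" by (simp only: powr_powr)
      then have "(x\<^sup>2 / 2) powr (s - 1) = x powr (p - 1) / 2 powr (s - 1)" by (simp add: powr_divide)
      moreover have "x * x powr (p - 1) = x powr p" using that by (simp add: powr_diff)
      ultimately show ?thesis using that by (simp add: exp_minus field_simps)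
    qed
    ultimately have "((\<lambda>x. x powr p * exp (- x\<^sup>2 / 2)) has_integral 2 powr (s - 1) * Gamma s) {0<..}"
      by (subst has_integral_cong[where g = "\<lambda>x. 2 powr (s - 1) * ?G x"]) auto
    then have "((\<lambda>x. if x \<in> {0<..} then x powr p * exp (- x\<^sup>2 / 2) else 0) has_integral 2 powr (s - 1) * Gamma s) UNIV"
      by (simp only: has_integral_restrict_UNIV)
    then show ?thesis by (rule has_integral_cong[THEN iffD1, rotated]) (auto simp: indicator_def)
  qed
  have half: "(\<integral>\<^sup>+x. ennreal (?P x) \<partial>lborel) = ennreal (2 powr (s - 1) * Gamma s)"
    by (rule nn_integral_has_integral_lborel[OF _ _ hi]) auto
  have "(\<integral>\<^sup>+x. ennreal (?N x) \<partial>lborel)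
      = ennreal \<bar>-1\<bar> * (\<integral>\<^sup>+x. ennreal (indicator {..<0} (0 + - 1 * x) * (\<bar>0 + - 1 * x\<bar> powr p * exp (- (0 + - 1 * x)\<^sup>2 / 2))) \<partial>lborel)"
    by (rule nn_integral_real_affine) auto
  also have "\<dots> = (\<integral>\<^sup>+x. ennreal (?P x) \<partial>lborel)"
    by (auto simp: indicator_def intro!: nn_integral_cong)
  finally have half': "(\<integral>\<^sup>+x. ennreal (?N x) \<partial>lborel) = ennreal (2 powr (s - 1) * Gamma s)"
    unfolding half .
  have G: "0 < Gamma s" by (rule Gamma_real_pos[OF s])
  have "(\<integral>\<^sup>+g. ennreal (std_normal_density g * \<bar>g\<bar> powr p) \<partial>lborel)
     = (\<integral>\<^sup>+x. ennreal (1 / sqrt (2 * pi)) * (ennreal (?P x)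
         + ennreal (?N x)) \<partial>lborel)"
  proof (rule nn_integral_cong)
    fix x :: real
    show "ennreal (std_normal_density x * \<bar>x\<bar> powr p) = ennreal (1 / sqrt (2 * pi)) * (ennreal (?P x)
         + ennreal (?N x))"
      by (cases x "0 :: real" rule: linorder_cases) (auto simp: std_normal_density_def mult_ac simp flip: ennreal_mult)
  qed
  also have "\<dots> = ennreal (1 / sqrt (2 * pi)) * (ennreal (2 powr (s - 1) * Gamma s) + ennreal (2 powr (s - 1) * Gamma s))"
    by (subst nn_integral_cmult, simp, subst nn_integral_add, simp, simp, simp only: half half')
  also have "\<dots> = ennreal (1 / sqrt (2 * pi) * (2 * (2 powr (s - 1) * Gamma s)))"
    using G by (simp flip: ennreal_plus ennreal_mult)
  also have "1 / sqrt (2 * pi) * (2 * (2 powr (s - 1) * Gamma s)) = normal_moment p"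
  proof -
    have "2 * 2 powr (s - 1) / sqrt 2 = (2 powr (p / 2) :: real)"
    proof -
      have "2 * 2 powr (s - 1) = 2 powr (p / 2) * 2 powr (1 / 2 :: real)" 
      proof -
        have "1 + (s - 1) = p / 2 + 1 / 2" by (simp add: s_def field_simps)
        moreover have "2 * 2 powr (s - 1) = (2 :: real) powr (1 + (s - 1))" by (simp only: powr_add) simp
        ultimately show ?thesis by (simp only: powr_add)
      qed
      then show ?thesis by (simp add: powr_half_sqrt)
    qed
    then show ?thesis unfolding normal_moment_def s_def[symmetric]
      by (simp add: real_sqrt_mult field_simps)
  qed
  finally show ?thesis .
qed

lemma std_normal_cos: "(\<integral>g. std_normal_density g * cos (g * u) \<partial>lborel) = exp (- u\<^sup>2 / 2)"
proof -
  have "complex_of_real (exp (- u\<^sup>2 / 2)) = (CLINT x|std_normal_distribution. iexp (u * x))"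
    using char_std_normal_distribution by (metis char_def)
  also have "Re \<dots> = (\<integral>x. cos (u * x) \<partial>std_normal_distribution)"
  proof -
    interpret prob_space std_normal_distribution by (rule prob_space_normal_density) simp
    have "integrable std_normal_distribution (\<lambda>x. iexp (u * x))"
      by (rule integrable_const_bound[where B = 1]) auto
    then show ?thesis by (simp flip: integral_Re add: Re_exp)
  qed
  also have "\<dots> = (\<integral>x. std_normal_density x * cos (u * x) \<partial>lborel)"
    by (subst integral_density) auto
  finally show ?thesis by (simp add: mult.commute[of u])
qed

text \<open>Tonelli for the nonnegative kernel \<open>?K\<close>: integrating over g first gives 1 -
  exp (-u^2 / 2) through the characteristic function, integrating over u first gives a multiple of
  \<bar>g\<bar>^p, whose mean is \<open>normal_moment p\<close>.\<close>

lemma normal_integral: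
  assumes p: "0 < p" "p < 2"
  shows "integrable lborel (\<lambda>u. (1 - exp (- u\<^sup>2 / 2)) * jump_wt p u)"
    and "(\<integral>u. (1 - exp (- u\<^sup>2 / 2)) * jump_wt p u \<partial>lborel) = cos_const p * normal_moment p"
proof -
  let ?K = "\<lambda>g u. std_normal_density g * ((1 - cos (g * u)) * jump_wt p u)"
  have nn: "0 \<le> (1 - cos (x * u)) * jump_wt p u" for x u
    using cos_le_one[of "x * u"] by (intro mult_nonneg_nonneg) auto
  have "0 < normal_moment p" unfolding normal_moment_def using p by (auto intro!: Gamma_real_pos divide_pos_pos mult_pos_pos)
  have inner: "(\<integral>\<^sup>+g. ennreal (?K g u) \<partial>lborel)
      = ennreal ((1 - exp (- u\<^sup>2 / 2)) * jump_wt p u)" for u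
  proof -
    have i1: "integrable lborel (\<lambda>g. std_normal_density g * cos (g * u))"
      by (rule Bochner_Integration.integrable_bound[OF integrable_normal_density[of 1 0]])
         (auto simp: abs_mult mult_left_le)
    have i2: "integrable lborel (\<lambda>g. ?K g u)"
    proof -
      have "integrable lborel (\<lambda>g. jump_wt p u * (std_normal_density g - std_normal_density g * cos (g * u)))"
        by (intro integrable_mult_right Bochner_Integration.integrable_diff integrable_normal_density i1) auto
      then show ?thesis by (simp add: algebra_simps)
    qed
    have "(\<integral>g. ?K g u \<partial>lborel)
        = (\<integral>g. (std_normal_density g - std_normal_density g * cos (g * u)) * jump_wt p u \<partial>lborel)"
      by (simp add: algebra_simps)
    also have "\<dots> = (1 - exp (- u\<^sup>2 / 2)) * jump_wt p u"
      using i1 integrable_normal_density[of 1 0] integral_normal_density[of 1 0] by (simp add: std_normal_cos)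
    finally show ?thesis
      using i2 nn by (subst nn_integral_eq_integral) (auto intro!: AE_I2 mult_nonneg_nonneg)
  qed
  have outer: "(\<integral>\<^sup>+u. ennreal (?K g u) \<partial>lborel)
      = ennreal (cos_const p) * ennreal (std_normal_density g * \<bar>g\<bar> powr p)" for g
  proof -
    have "(\<integral>\<^sup>+u. ennreal (?K g u) \<partial>lborel)
      = ennreal (\<integral>u. ?K g u \<partial>lborel)"
      using integrable_cos_jump_wt[OF p, of g] nn by (intro nn_integral_eq_integral) (auto intro!: AE_I2 mult_nonneg_nonneg)
    also have "\<dots> = ennreal (cos_const p * (std_normal_density g * \<bar>g\<bar> powr p))"
      unfolding integral_mult_right_zero abs_powr_eq_integral[OF p] by (simp only: mult_ac)
    finally show ?thesis using cos_const_pos[OF p] by (simp add: ennreal_mult')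
  qed
  have nni: "(\<integral>\<^sup>+u. ennreal ((1 - exp (- u\<^sup>2 / 2)) * jump_wt p u) \<partial>lborel) = ennreal (cos_const p * normal_moment p)"
  proof -
    have "(\<integral>\<^sup>+u. ennreal ((1 - exp (- u\<^sup>2 / 2)) * jump_wt p u) \<partial>lborel)
      = (\<integral>\<^sup>+u. \<integral>\<^sup>+g. ennreal (?K g u) \<partial>lborel \<partial>lborel)"
      unfolding inner ..
    also have "\<dots> = (\<integral>\<^sup>+g. \<integral>\<^sup>+u. ennreal (?K g u) \<partial>lborel \<partial>lborel)"
      by (rule lborel_pair.Fubini') measurable
    also have "\<dots> = ennreal (cos_const p) * ennreal (normal_moment p)"
      unfolding outer using p by (subst nn_integral_cmult) (auto simp: nn_integral_normal_abs_powr)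
    finally show ?thesis using cos_const_pos[OF p] \<open>0 < normal_moment p\<close> by (simp add: ennreal_mult)
  qed
  have nn2: "0 \<le> (1 - exp (- u\<^sup>2 / 2)) * jump_wt p u" for u by (intro mult_nonneg_nonneg) auto
  show "integrable lborel (\<lambda>u. (1 - exp (- u\<^sup>2 / 2)) * jump_wt p u)"
    by (rule integrableI_nn_integral_finite[OF _ _ nni]) (use nn2 in auto)
  show "(\<integral>u. (1 - exp (- u\<^sup>2 / 2)) * jump_wt p u \<partial>lborel) = cos_const p * normal_moment p"
    using nni nn2 cos_const_pos[OF p] \<open>0 < normal_moment p\<close> by (subst integral_eq_nn_integral) auto
qed

subsection \<open>The balanced case\<close>

lemma abs_cos_add_nat_pi: "\<bar>cos (v + pi * real k)\<bar> = \<bar>cos v\<bar>"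
proof (induction k)
  case (Suc k)
  have "cos (v + pi * real (Suc k)) = cos (v + pi * real k + pi)" by (simp add: algebra_simps)
  then show ?case using Suc by (simp only: cos_periodic_pi abs_minus_cancel)
qed simp

lemma abs_cos_le_iff:
  assumes a: "0 < a" "a < pi / 2" and u: "0 < u"
  shows "\<bar>cos u\<bar> \<le> cos a \<longleftrightarrow> (\<exists>k. u \<in> {pi * real k + a .. pi * real (Suc k) - a})"
proof -
  have base: "\<bar>cos v\<bar> \<le> cos a \<longleftrightarrow> v \<in> {a..pi - a}" if "0 \<le> v" "v \<le> pi" for v
  proof -
    have "cos v \<le> cos a \<longleftrightarrow> a \<le> v" using that a by (intro cos_mono_le_eq) auto
    moreover have "cos (pi - v) \<le> cos a \<longleftrightarrow> a \<le> pi - v" using that a by (intro cos_mono_le_eq) auto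
    ultimately show ?thesis by (auto simp: abs_le_iff)
  qed
  show ?thesis
  proof
    assume le: "\<bar>cos u\<bar> \<le> cos a"
    define k where "k = nat \<lfloor>u / pi\<rfloor>"
    define v where "v = u - pi * real k"
    have "real k = \<lfloor>u / pi\<rfloor>" using u by (simp add: k_def)
    then have "real k \<le> u / pi" "u / pi < real k + 1" by linarith+
    then have v: "0 \<le> v" "v \<le> pi" by (auto simp: v_def field_simps)
    have "\<bar>cos v\<bar> = \<bar>cos u\<bar>" using abs_cos_add_nat_pi[of v k] by (simp add: v_def)
    then have "v \<in> {a..pi - a}" using base[OF v] le by simp
    then show "\<exists>k. u \<in> {pi * real k + a .. pi * real (Suc k) - a}"
      by (intro exI[of _ k]) (auto simp: v_def algebra_simps)
  next
    assume "\<exists>k. u \<in> {pi * real k + a .. pi * real (Suc k) - a}"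
    then obtain k where k: "u \<in> {pi * real k + a .. pi * real (Suc k) - a}" by blast
    define v where "v = u - pi * real k"
    have v: "v \<in> {a..pi - a}" using k by (auto simp: v_def algebra_simps)
    then have "\<bar>cos v\<bar> \<le> cos a" using base[of v] a by auto
    then show "\<bar>cos u\<bar> \<le> cos a" using abs_cos_add_nat_pi[of v k] by (simp add: v_def)
  qed
qed

lemma nn_integral_abs_cos_le:
  assumes p: "0 < p" and a: "0 < a" "a < pi / 2"
  shows "(\<integral>\<^sup>+u. ennreal (jump_wt p u) * indicator {u. \<bar>cos u\<bar> \<le> cos a} u \<partial>lborel) = ennreal (cos_tail p a / p)"
proof -
  define A where "A = (\<lambda>k. {pi * real k + a .. pi * real (Suc k) - a})"
  have disj: "disjoint_family A"
    unfolding disjoint_family_on_def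
  proof (intro ballI impI)
    have "A k \<inter> A l = {}" if "k < l" for k l
    proof -
      have "pi * real (Suc k) \<le> pi * real l" using that by (intro mult_left_mono) auto
      then have lt: "pi * real (Suc k) - a < pi * real l + a" using a by linarith
      show ?thesis
      proof (rule equals0I)
        fix x assume "x \<in> A k \<inter> A l"
        then have "pi * real l + a \<le> x" "x \<le> pi * real (Suc k) - a" by (auto simp: A_def simp del: of_nat_Suc)
        then show False using lt by linarith
      qed
    qed
    then show "A k \<inter> A l = {}" if "k \<noteq> l" for k l
      using that by (cases k l rule: linorder_cases) blast+
  qed
  have ge: "pi * real k + a \<le> pi * real (Suc k) - a" "0 < pi * real k + a" for k
    using a by (auto simp: algebra_simps intro: add_pos_nonneg)
  have piece: "(\<integral>\<^sup>+u. ennreal (jump_wt p u) * indicator (A k) u \<partial>lborel)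
      = ennreal (tail_term p a k / p)" for k
    unfolding A_def nn_integral_jump_wt_Icc[OF p ge(2) ge(1)] power_gap_def
    by (simp add: algebra_simps)
  have "(\<integral>\<^sup>+u. ennreal (jump_wt p u) * indicator {u. \<bar>cos u\<bar> \<le> cos a} u \<partial>lborel)
     = (\<integral>\<^sup>+u. (\<Sum>k. ennreal (jump_wt p u) * indicator (A k) u) \<partial>lborel)"
  proof (rule nn_integral_cong)
    fix u :: real
    show "ennreal (jump_wt p u) * indicator {u. \<bar>cos u\<bar> \<le> cos a} u = (\<Sum>k. ennreal (jump_wt p u) * indicator (A k) u)"
    proof (cases "0 < u")
      case True
      have "indicator {u. \<bar>cos u\<bar> \<le> cos a} u = (indicator (\<Union>k. A k) u :: ennreal)"
        using abs_cos_le_iff[OF a True] by (auto simp: indicator_def A_def)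
      then show ?thesis by (simp add: suminf_indicator[OF disj, symmetric])
    qed (simp add: jump_wt_def)
  qed
  also have "\<dots> = (\<Sum>k. ennreal (tail_term p a k / p))"
    unfolding piece[symmetric] by (rule nn_integral_suminf) (auto simp: A_def)
  also have "\<dots> = ennreal (\<Sum>k. tail_term p a k / p)"
  proof (rule suminf_ennreal2)
    show "0 \<le> tail_term p a k / p" for k
      using p a by (intro divide_nonneg_nonneg tail_term_nonneg) auto
  qed (use cos_tail_summable(1)[of p a] p a in \<open>auto intro: summable_divide\<close>)
  also have "(\<Sum>k. tail_term p a k / p) = cos_tail p a / p"
    unfolding cos_tail_def using cos_tail_summable(1)[of p a] p a by (intro suminf_divide) auto
  finally show ?thesis .
qed

lemma nn_integral_gauss_le:
  assumes q: "0 < q" and a: "0 < a" "a < pi / 2"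
  shows "(\<integral>\<^sup>+u. ennreal (jump_wt (2 * q) u) * indicator {u. exp (- u\<^sup>2 / 2) \<le> cos a} u \<partial>lborel)
     = ennreal ((- 2 * ln (cos a)) powr (- q) / (2 * q))"
proof -
  define L where "L = - 2 * ln (cos a)"
  have L: "L > 0" unfolding L_def by (rule ln_cos_neg[OF a])
  have c: "cos a > 0" using a by (intro cos_gt_zero_pi) auto
  have iff: "exp (- u\<^sup>2 / 2) \<le> cos a \<longleftrightarrow> sqrt L \<le> u" if "0 < u" for u
  proof -
    have "exp (- u\<^sup>2 / 2) \<le> cos a \<longleftrightarrow> - u\<^sup>2 / 2 \<le> ln (cos a)"
      using c by (metis exp_le_cancel_iff exp_ln)
    also have "\<dots> \<longleftrightarrow> L \<le> u\<^sup>2" by (auto simp: L_def)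
    also have "\<dots> \<longleftrightarrow> sqrt L \<le> u" using that L by (auto simp: real_sqrt_le_iff real_le_lsqrt intro: real_le_lsqrt sqrt_le_D)
    finally show ?thesis .
  qed
  have "(\<integral>\<^sup>+u. ennreal (jump_wt (2 * q) u) * indicator {u. exp (- u\<^sup>2 / 2) \<le> cos a} u \<partial>lborel)
     = (\<integral>\<^sup>+u. ennreal (jump_wt (2 * q) u) * indicator {sqrt L..} u \<partial>lborel)"
  proof (rule nn_integral_cong)
    fix u :: real
    show "ennreal (jump_wt (2 * q) u) * indicator {u. exp (- u\<^sup>2 / 2) \<le> cos a} u = ennreal (jump_wt (2 * q) u) * indicator {sqrt L..} u"
      using iff[of u] by (cases "0 < u") (auto simp: indicator_def jump_wt_def)
  qed
  also have "\<dots> = ennreal (sqrt L powr (- (2 * q)) / (2 * q))"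
    using q L by (intro nn_integral_jump_wt_tail) auto
  also have "sqrt L powr (- (2 * q)) = L powr (- q)"
    using L by (simp add: powr_half_sqrt[symmetric] powr_powr)
  finally show ?thesis by (simp add: L_def)
qed

lemma bernoulli_powr:
  fixes z s :: real
  assumes "1 \<le> s" "0 \<le> z" "z \<le> 1"
  shows "1 - s * (1 - z) \<le> z powr s"
  using one_plus_powr_ge[of s "z - 1"] assms by (cases "z = 0") (auto simp: algebra_simps)

section \<open>Comparison of powers of the Gaussian and the cosine by level sets\<close>

definition gauss_cos_diff :: "real \<Rightarrow> real \<Rightarrow> real" where
  "gauss_cos_diff s u = exp (- u\<^sup>2 / 2) powr s - \<bar>cos u\<bar> powr s"

lemma gauss_cos_diff_measurable [measurable]: "gauss_cos_diff s \<in> borel_measurable borel"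
  unfolding gauss_cos_diff_def[abs_def] by measurable

lemma integrable_gauss_cos_diff:
  assumes p: "0 < p" "p < 2" and s: "1 \<le> s"
  shows "integrable lborel (\<lambda>u. gauss_cos_diff s u * jump_wt p u)"
proof (rule integrable_mult_jump_wt[OF p, where C = "max 1 (s / 2)"])
  fix u :: real assume "0 < u"
  define f where "f = exp (- u\<^sup>2 / 2)"
  define g where "g = \<bar>cos u\<bar>"
  have fg: "0 \<le> f" "f \<le> 1" "0 \<le> g" "g \<le> 1" by (auto simp: f_def g_def)
  have "1 - f \<le> u\<^sup>2 / 2" using exp_ge_add_one_self[of "- u\<^sup>2 / 2"] by (simp add: f_def)
  then have "s * (1 - f) \<le> s * (u\<^sup>2 / 2)" using s by (intro mult_left_mono) auto
  then have f1: "1 - s / 2 * u\<^sup>2 \<le> f powr s" using bernoulli_powr[OF s fg(1,2)] by simp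
  have "1 - g \<le> u\<^sup>2 / 2" using one_minus_cos_le[of u] by (simp add: g_def)
  then have "s * (1 - g) \<le> s * (u\<^sup>2 / 2)" using s by (intro mult_left_mono) auto
  then have g1: "1 - s / 2 * u\<^sup>2 \<le> g powr s" using bernoulli_powr[OF s fg(3,4)] by simp
  have le1: "f powr s \<le> 1" "g powr s \<le> 1" "0 \<le> f powr s" "0 \<le> g powr s" using fg s by (auto intro!: powr_le1)
  have d: "gauss_cos_diff s u = f powr s - g powr s" by (simp add: gauss_cos_diff_def f_def g_def)
  have "\<bar>gauss_cos_diff s u\<bar> \<le> s / 2 * u\<^sup>2" unfolding d using f1 g1 le1 by (simp only: abs_le_iff) linarith
  also have "\<dots> \<le> max 1 (s / 2) * u\<^sup>2" by (intro mult_right_mono) auto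
  finally show "\<bar>gauss_cos_diff s u\<bar> \<le> max 1 (s / 2) * u\<^sup>2" .
  have "\<bar>gauss_cos_diff s u\<bar> \<le> 1" unfolding d using le1 by (simp only: abs_le_iff) linarith
  then show "\<bar>gauss_cos_diff s u\<bar> \<le> max 1 (s / 2)" by (simp add: le_max_iff_disj)
qed simp

lemma integral_powr_initial:
  fixes s c :: real
  assumes s: "0 < s" and c: "0 \<le> c"
  shows "integrable lborel (\<lambda>y. indicator {0<..<c} y * y powr (s - 1))"
    and "(\<integral>y. indicator {0<..<c} y * y powr (s - 1) \<partial>lborel) = c powr s / s"
proof -
  have "((\<lambda>x. x powr (s - 1)) has_integral (c powr (s - 1 + 1) / (s - 1 + 1))) {0..c}"
    using s c by (intro has_integral_powr_from_0) auto
  then have "((\<lambda>x. x powr (s - 1)) has_integral c powr s / s) {0<..<c}"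
    by (simp add: has_integral_Icc_iff_Ioo)
  then have "((\<lambda>y. if y \<in> {0<..<c} then y powr (s - 1) else 0) has_integral c powr s / s) UNIV"
    by (simp only: has_integral_restrict_UNIV)
  moreover have "(\<lambda>y. if y \<in> {0<..<c} then y powr (s - 1) else 0) = (\<lambda>y. indicator {0<..<c} y * y powr (s - 1))"
    by (auto simp: fun_eq_iff indicator_def)
  ultimately have "((\<lambda>y. indicator {0<..<c} y * y powr (s - 1)) has_integral c powr s / s) UNIV" by simp
  then have nn: "integral\<^sup>N lborel (\<lambda>y. ennreal (indicator {0<..<c} y * y powr (s - 1))) = ennreal (c powr s / s)"
    by (rule nn_integral_has_integral_lborel[rotated 2]) auto
  show "integrable lborel (\<lambda>y. indicator {0<..<c} y * y powr (s - 1))"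
    by (rule integrableI_nn_integral_finite[OF _ _ nn]) auto
  show "(\<integral>y. indicator {0<..<c} y * y powr (s - 1) \<partial>lborel) = c powr s / s"
    using nn s by (subst integral_eq_nn_integral) auto
qed

text \<open>The mass of the sublevel set of the cosine minus that of the Gaussian. For levels 0 < y
  < 1 both sets keep, on the positive half-line, a distance from 0, so both masses are
  finite.\<close>

definition level_diff :: "real \<Rightarrow> real \<Rightarrow> real" where
  "level_diff p y = (\<integral>u. (indicator {u. \<bar>cos u\<bar> \<le> y} u - indicator {u. exp (- u\<^sup>2 / 2) \<le> y} u) * jump_wt p u \<partial>lborel)"

lemma level_diff_eq:
  assumes q: "0 < q" and a: "0 < a" "a < pi / 2"
  shows "level_diff (2 * q) (cos a) = (cos_tail (2 * q) a - (- 2 * ln (cos a)) powr (- q)) / (2 * q)"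
proof -
  let ?f = "\<lambda>u. indicator {u. \<bar>cos u\<bar> \<le> cos a} u * jump_wt (2 * q) u" and ?g = "\<lambda>u. indicator {u. exp (- u\<^sup>2 / 2) \<le> cos a} u * jump_wt (2 * q) u"
  have ct: "0 \<le> cos_tail (2 * q) a"
    unfolding cos_tail_def using q a by (intro suminf_nonneg cos_tail_summable tail_term_nonneg) auto
  have 1: "(\<integral>\<^sup>+u. ennreal (?f u) \<partial>lborel) = ennreal (cos_tail (2 * q) a / (2 * q))"
    using nn_integral_abs_cos_le[of "2 * q" a] q a by (simp add: mult.commute ennreal_mult'' ennreal_indicator)
  have 2: "(\<integral>\<^sup>+u. ennreal (?g u) \<partial>lborel)
      = ennreal ((- 2 * ln (cos a)) powr (- q) / (2 * q))"
    using nn_integral_gauss_le[OF q a] by (simp add: mult.commute ennreal_mult'' ennreal_indicator)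
  have i1: "integrable lborel ?f"
    by (rule integrableI_nn_integral_finite[OF _ _ 1]) (use q ct in auto)
  have i2: "integrable lborel ?g"
    by (rule integrableI_nn_integral_finite[OF _ _ 2]) (use q in auto)
  have e1: "(\<integral>u. ?f u \<partial>lborel) = cos_tail (2 * q) a / (2 * q)"
    using 1 q ct by (subst integral_eq_nn_integral) auto
  have e2: "(\<integral>u. ?g u \<partial>lborel) = (- 2 * ln (cos a)) powr (- q) / (2 * q)"
    using 2 q by (subst integral_eq_nn_integral) auto
  show ?thesis
    unfolding level_diff_def left_diff_distrib Bochner_Integration.integral_diff[OF i1 i2] e1 e2
    by (simp add: diff_divide_distrib)
qed

text \<open>With y = cos a, a nonnegative difference persists at all higher levels by
  \<open>cos_tail_single_crossing\<close>; the crossing level is the infimum of the levels where it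
  occurs.\<close>

lemma level_diff_single_crossing:
  fixes q :: real
  assumes q: "17 / 20 \<le> q" "q \<le> 1"
  obtains y0 where "0 \<le> y0" "\<And>y. 0 < y \<Longrightarrow> y < 1 \<Longrightarrow> y < y0 \<Longrightarrow> level_diff (2 * q) y \<le> 0"
    "\<And>y. 0 < y \<Longrightarrow> y < 1 \<Longrightarrow> y0 < y \<Longrightarrow> 0 \<le> level_diff (2 * q) y"
proof -
  have mono: "0 \<le> level_diff (2 * q) y'" if y: "0 < y" "y < y'" "y' < 1" "0 \<le> level_diff (2 * q) y" for y y'
  proof -
    define a where "a = arccos y'"
    define a' where "a' = arccos y"
    have y_eq: "y = cos a'" "y' = cos a" using y by (auto simp: a_def a'_def)
    have a: "0 < a" "a \<le> a'" "a' < pi / 2" unfolding a_def a'_def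
      using y arccos_less_arccos[of y' 1] arccos_less_arccos[of y y'] arccos_less_arccos[of 0 y] by auto
    have "(- 2 * ln (cos a')) powr (- q) \<le> cos_tail (2 * q) a'"
      using y(4) q a unfolding y_eq by (subst (asm) level_diff_eq) (auto simp: zero_le_divide_iff)
    then have "(- 2 * ln (cos a)) powr (- q) \<le> cos_tail (2 * q) a"
      by (rule cos_tail_single_crossing[OF q a])
    then show ?thesis unfolding y_eq using q a by (subst level_diff_eq) auto
  qed
  define S where "S = {y. 0 < y \<and> y < 1 \<and> 0 \<le> level_diff (2 * q) y}"
  have bdd: "bdd_below S" by (intro bdd_belowI[of _ 0]) (auto simp: S_def)
  show thesis
  proof (cases "S = {}")
    case True
    \<comment> \<open>No level is nonnegative, so y0 = 1 works and the claim above y0 is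
      vacuous.\<close>
    show thesis
      by (rule that[of 1]) (use True in \<open>force simp: S_def\<close>)+
  next
    case False
    show thesis
    proof (rule that[of "Inf S"])
      show "0 \<le> Inf S" using False by (intro cInf_greatest) (auto simp: S_def)
      fix y :: real assume y: "0 < y" "y < 1"
      show "level_diff (2 * q) y \<le> 0" if "y < Inf S"
      proof (rule ccontr)
        assume "\<not> ?thesis"
        then have "y \<in> S" using y by (auto simp: S_def)
        then show False using cInf_lower[OF _ bdd, of y] that by simp
      qed
      show "0 \<le> level_diff (2 * q) y" if lt: "Inf S < y"
      proof -
        obtain z where "z \<in> S" "z < y" using cInf_lessD[OF False lt] by blast
        then show ?thesis using mono[of z y] y by (auto simp: S_def)
      qed
    qed
  qed
qed

text \<open>Each power f^s is s times the integral of y^(s-1) over 0 < y < f, and Fubini exchanges u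
  with the level y. Passing from superlevel to sublevel sets reverses the sign, which explains the
  order of the terms in \<open>level_diff\<close>.\<close>

lemma integral_gauss_cos_diff_layer_cake:
  assumes p: "0 < p" "p < 2" and s: "1 \<le> s"
  shows "integrable lborel (\<lambda>y. indicator {0<..<1} y * (y powr (s - 1) * level_diff p y))"
    and "(\<integral>y. indicator {0<..<1} y * (y powr (s - 1) * level_diff p y) \<partial>lborel)
        = (\<integral>u. gauss_cos_diff s u * jump_wt p u \<partial>lborel) / s"
proof -
  define f where "f = (\<lambda>u::real. exp (- u\<^sup>2 / 2))"
  define g where "g = (\<lambda>u::real. \<bar>cos u\<bar>)"
  have fg: "0 \<le> f u" "f u \<le> 1" "0 \<le> g u" "g u \<le> 1" for u by (auto simp: f_def g_def)
  have [measurable]: "f \<in> borel_measurable borel" "g \<in> borel_measurable borel"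
    unfolding f_def g_def by measurable
  have s0: "0 < s" using s by simp
  define k where "k = (\<lambda>(u, y). (indicator {0<..<f u} y * y powr (s - 1) - indicator {0<..<g u} y * y powr (s - 1)) * jump_wt p u)"
  have k_meas: "k \<in> borel_measurable (lborel \<Otimes>\<^sub>M lborel)"
  proof -
    have "k = (\<lambda>x. ((if 0 < snd x \<and> snd x < f (fst x) then 1 else 0) * snd x powr (s - 1)
        - (if 0 < snd x \<and> snd x < g (fst x) then 1 else 0) * snd x powr (s - 1)) * jump_wt p (fst x))"
      by (auto simp: k_def fun_eq_iff indicator_def)
    then show ?thesis by (simp only:) measurable
  qed
  have inner_int: "integrable lborel (\<lambda>y. k (u, y))" for u
    unfolding k_def prod.case
    by (intro integrable_mult_left Bochner_Integration.integrable_diff integral_powr_initial s0 fg)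
  have inner: "(\<integral>y. k (u, y) \<partial>lborel) = gauss_cos_diff s u * jump_wt p u / s" for u
  proof -
    have "(\<integral>y. k (u, y) \<partial>lborel) = (f u powr s / s - g u powr s / s) * jump_wt p u"
      unfolding k_def prod.case using s0 fg[of u]
      by (simp add: Bochner_Integration.integral_diff integral_powr_initial)
    then show ?thesis using s0 by (simp add: gauss_cos_diff_def f_def g_def field_simps)
  qed
  \<comment> \<open>For fixed u the difference of the two indicators has constant sign in y, so the
    absolute value costs nothing and absolute integrability reduces to
    \<open>integrable_gauss_cos_diff\<close>.\<close>
  have inner_norm: "(\<integral>y. norm (k (u, y)) \<partial>lborel) = \<bar>gauss_cos_diff s u * jump_wt p u\<bar> / s" for u
  proof -
    define a where "a = max (f u) (g u)"
    define b where "b = min (f u) (g u)"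
    have ab: "0 \<le> a" "0 \<le> b" "b \<le> a" using fg[of u] by (auto simp: a_def b_def)
    have "norm (k (u, y)) = (indicator {0<..<a} y * y powr (s - 1) - indicator {0<..<b} y * y powr (s - 1)) * jump_wt p u" for y
      unfolding k_def a_def b_def by (auto simp: abs_mult indicator_def)
    then have "(\<integral>y. norm (k (u, y)) \<partial>lborel) = (a powr s / s - b powr s / s) * jump_wt p u"
      using s0 ab by (simp add: Bochner_Integration.integral_diff integral_powr_initial)
    also have "a powr s - b powr s = \<bar>f u powr s - g u powr s\<bar>"
    proof (cases "f u \<le> g u")
      case True
      then have "a = g u" "b = f u" by (simp_all add: a_def b_def)
      moreover have "f u powr s \<le> g u powr s" using True fg[of u] s0 by (intro powr_mono2) simp_all
      ultimately show ?thesis by simp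
    next
      case False
      then have "a = f u" "b = g u" by (simp_all add: a_def b_def)
      moreover have "g u powr s \<le> f u powr s" using False fg[of u] s0 by (intro powr_mono2) simp_all
      ultimately show ?thesis by simp
    qed
    then have "(a powr s / s - b powr s / s) * jump_wt p u = \<bar>f u powr s - g u powr s\<bar> * jump_wt p u / s"
      by (simp flip: diff_divide_distrib)
    finally show ?thesis by (simp add: gauss_cos_diff_def f_def g_def abs_mult)
  qed
  have k_int: "integrable (lborel \<Otimes>\<^sub>M lborel) k"
  proof (rule lborel_pair.Fubini_integrable[OF k_meas])
    show "integrable lborel (\<lambda>u. \<integral>y. norm (k (u, y)) \<partial>lborel)"
      unfolding inner_norm using integrable_gauss_cos_diff[OF p s] by auto
  qed (use inner_int in auto)
  have outer: "(\<integral>u. k (u, y) \<partial>lborel) = indicator {0<..<1} y * (y powr (s - 1) * level_diff p y)" for y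
  proof (cases "0 < y \<and> y < 1")
    case True
    have "k (u, y) = y powr (s - 1) * ((indicator {u. \<bar>cos u\<bar> \<le> y} u - indicator {u. exp (- u\<^sup>2 / 2) \<le> y} u) * jump_wt p u)" for u
      using True by (auto simp: k_def indicator_def f_def g_def)
    then show ?thesis using True by (simp add: level_diff_def)
  next
    case False
    have "k (u, y) = 0" for u
      using False fg[of u] by (auto simp: k_def indicator_def)
    then show ?thesis using False by auto
  qed
  have k_int': "integrable (lborel \<Otimes>\<^sub>M lborel) (\<lambda>(u, y). k (u, y))" using k_int by simp
  show "integrable lborel (\<lambda>y. indicator {0<..<1} y * (y powr (s - 1) * level_diff p y))"
    using lborel_pair.integrable_snd[OF k_int'] unfolding outer .
  show "(\<integral>y. indicator {0<..<1} y * (y powr (s - 1) * level_diff p y) \<partial>lborel)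
        = (\<integral>u. gauss_cos_diff s u * jump_wt p u \<partial>lborel) / s"
    using lborel_pair.Fubini_integral[OF k_int'] unfolding outer inner by simp
qed

text \<open>Let D = \<open>level_diff p\<close>. Below the crossing level both y^(s-2) - y0^(s-2)
  and D are nonpositive, above it both are nonnegative. Hence y^(s-1) D(y) \<ge> y0^(s-2) y D(y) at
  every level, and integration reduces s to 2.\<close>

lemma integral_gauss_cos_diff_mono:
  assumes p: "17 / 10 \<le> p" "p < 2" and s: "2 \<le> s"
    and two: "0 \<le> (\<integral>u. gauss_cos_diff 2 u * jump_wt p u \<partial>lborel)"
  shows "0 \<le> (\<integral>u. gauss_cos_diff s u * jump_wt p u \<partial>lborel)"
proof -
  let ?H = "\<lambda>s y. indicator {0<..<1} y * (y powr (s - 1) * level_diff p y)"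
  have p': "0 < p" "p < 2" using p by auto
  obtain y0 where y0: "0 \<le> y0" "\<And>y. 0 < y \<Longrightarrow> y < 1 \<Longrightarrow> y < y0 \<Longrightarrow> level_diff p y \<le> 0"
    "\<And>y. 0 < y \<Longrightarrow> y < 1 \<Longrightarrow> y0 < y \<Longrightarrow> 0 \<le> level_diff p y"
    using level_diff_single_crossing[of "p / 2"] p by auto
  have "0 \<le> y0 powr (s - 2) * ((\<integral>u. gauss_cos_diff 2 u * jump_wt p u \<partial>lborel) / 2)"
    using two by simp
  also have "\<dots> = (\<integral>y. y0 powr (s - 2) * ?H 2 y \<partial>lborel)"
    using integral_gauss_cos_diff_layer_cake(2)[OF p', of 2] by simp
  also have "\<dots> \<le> (\<integral>y. ?H s y \<partial>lborel)"
  proof (rule integral_mono)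
    show "integrable lborel (\<lambda>y. y0 powr (s - 2) * ?H 2 y)"
      by (intro integrable_mult_right integral_gauss_cos_diff_layer_cake p') simp
    show "integrable lborel (?H s)"
      using s by (intro integral_gauss_cos_diff_layer_cake p') simp
    fix y :: real
    show "y0 powr (s - 2) * ?H 2 y \<le> ?H s y"
    proof (cases "0 < y \<and> y < 1")
      case True
      have eq: "y powr (s - 1) = y powr (s - 2) * y" using True by (simp add: powr_diff power2_eq_square)
      have "y0 powr (s - 2) * level_diff p y \<le> y powr (s - 2) * level_diff p y"
      proof (cases "y0" y rule: linorder_cases)
        case less
        then show ?thesis using y0 True s by (intro mult_right_mono powr_mono2) auto
      next
        case greater
        then show ?thesis using y0 True s by (intro mult_right_mono_neg powr_mono2) auto
      qed simp
      then have "y * (y0 powr (s - 2) * level_diff p y) \<le> y * (y powr (s - 2) * level_diff p y)"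
        using True by (intro mult_left_mono) auto
      then show ?thesis using True by (simp add: eq mult_ac)
    qed auto
  qed
  also have "\<dots> = (\<integral>u. gauss_cos_diff s u * jump_wt p u \<partial>lborel) / s"
    using s by (intro integral_gauss_cos_diff_layer_cake(2) p') simp
  finally show ?thesis using s by (simp add: zero_le_divide_iff)
qed

text \<open>For s = 2 everything is explicit, since cos^2 u = (1 + cos (2 u)) / 2 and exp (-u^2) is
  a rescaled Gaussian. The sign is that of the two-coefficient moment minus the normal
  moment.\<close>

lemma integral_gauss_cos_diff_two:
  assumes p: "0 < p" "p < 2"
  shows "(\<integral>u. gauss_cos_diff 2 u * jump_wt p u \<partial>lborel)
     = cos_const p * 2 powr (p / 2) * (2 powr (p / 2 - 1) - normal_moment p)"
proof -
  have eq: "gauss_cos_diff 2 u * jump_wt p u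
      = 1 / 2 * ((1 - cos (2 * u)) * jump_wt p u) - (1 - exp (- (sqrt 2 * u)\<^sup>2 / 2)) * jump_wt p u" for u
  proof -
    have e: "exp (- u\<^sup>2 / 2) powr 2 = exp (- (sqrt 2 * u)\<^sup>2 / 2)"
      by (simp add: power_mult_distrib flip: exp_double)
    have c: "\<bar>cos u\<bar> powr 2 = (1 + cos (2 * u)) / 2" by (simp add: cos_double_cos)
    show ?thesis unfolding gauss_cos_diff_def e c by (simp add: field_simps)
  qed
  have i2: "integrable lborel (\<lambda>u. (1 - exp (- (sqrt 2 * u)\<^sup>2 / 2)) * jump_wt p u)"
  proof -
    have eqf: "(\<lambda>u. (1 - exp (- (sqrt 2 * u)\<^sup>2 / 2)) * jump_wt p u)
        = (\<lambda>u. 1 / 2 * ((1 - cos (2 * u)) * jump_wt p u) - gauss_cos_diff 2 u * jump_wt p u)"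
      unfolding eq by simp
    show ?thesis unfolding eqf
      by (intro Bochner_Integration.integrable_diff integrable_mult_right integrable_cos_jump_wt integrable_gauss_cos_diff p) simp
  qed
  have "(\<integral>u. gauss_cos_diff 2 u * jump_wt p u \<partial>lborel)
     = 1 / 2 * (\<integral>u. (1 - cos (2 * u)) * jump_wt p u \<partial>lborel) - (\<integral>u. (1 - exp (- (sqrt 2 * u)\<^sup>2 / 2)) * jump_wt p u \<partial>lborel)"
    unfolding eq using i2 integrable_cos_jump_wt[OF p, of 2] by (subst Bochner_Integration.integral_diff) auto
  also have "(\<integral>u. (1 - cos (2 * u)) * jump_wt p u \<partial>lborel) = cos_const p * 2 powr p"
    using abs_powr_eq_integral[OF p, of 2] by simp
  also have "(\<integral>u. (1 - exp (- (sqrt 2 * u)\<^sup>2 / 2)) * jump_wt p u \<partial>lborel) = sqrt 2 powr p * (cos_const p * normal_moment p)"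
    using integral_jump_wt_scale[of "sqrt 2" "\<lambda>u. 1 - exp (- u\<^sup>2 / 2)" p] normal_integral(2)[OF p] by simp
  also have "sqrt 2 powr p = 2 powr (p / 2)" by (simp add: powr_half_sqrt[symmetric] powr_powr)
  also have "1 / 2 * (cos_const p * 2 powr p) = cos_const p * (2 powr (p / 2) * 2 powr (p / 2 - 1))"
    by (simp add: powr_diff flip: powr_add)
  finally show ?thesis by (simp add: algebra_simps)
qed

text \<open>Multiply the tangent estimates z / S \<le> exp (z / S - 1), raised to the weights; with
  S the weighted mean the exponentials cancel. Lists rather than sets let equal coefficients be
  counted separately.\<close>

lemma weighted_am_gm_list:
  fixes z :: "real \<Rightarrow> real"
  assumes w: "\<And>b. b \<in> set bs \<Longrightarrow> 0 \<le> w b" and z: "\<And>b. b \<in> set bs \<Longrightarrow> 0 \<le> z b"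
    and sum: "(\<Sum>b\<leftarrow>bs. w b) = 1"
  shows "(\<Prod>b\<leftarrow>bs. z b powr w b) \<le> (\<Sum>b\<leftarrow>bs. w b * z b)"
proof -
  have bound: "(\<Prod>b\<leftarrow>bs. z b powr w b) \<le> S * exp ((\<Sum>b\<leftarrow>bs. w b * z b) / S - 1)" if S: "0 < S" for S
  proof -
    have one: "z b powr w b \<le> S powr w b * exp (w b * z b / S - w b)" if "b \<in> set bs" for b
    proof -
      have "z b / S \<le> exp (z b / S - 1)" using exp_ge_add_one_self[of "z b / S - 1"] by simp
      then have "(z b / S) powr w b \<le> exp (z b / S - 1) powr w b" using S w z that by (intro powr_mono2) auto
      also have "\<dots> = exp (w b * z b / S - w b)" by (simp add: powr_def algebra_simps)
      finally have "S powr w b * (z b / S) powr w b \<le> S powr w b * exp (w b * z b / S - w b)" by (intro mult_left_mono) auto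
      then show ?thesis using S z[OF that] by (simp flip: powr_mult)
    qed
    have "(\<Prod>b\<leftarrow>bs. z b powr w b) \<le> S powr (\<Sum>b\<leftarrow>bs. w b) * exp ((\<Sum>b\<leftarrow>bs. w b * z b) / S - (\<Sum>b\<leftarrow>bs. w b))"
      using one
    proof (induction bs)
      case (Cons b bs)
      have "(\<Prod>b\<leftarrow>b # bs. z b powr w b) \<le> (S powr w b * exp (w b * z b / S - w b)) *
          (S powr (\<Sum>b\<leftarrow>bs. w b) * exp ((\<Sum>b\<leftarrow>bs. w b * z b) / S - (\<Sum>b\<leftarrow>bs. w b)))"
        using Cons by (auto intro!: mult_mono prod_list_nonneg)
      also have "\<dots> = S powr (\<Sum>b\<leftarrow>b # bs. w b) * exp ((\<Sum>b\<leftarrow>b # bs. w b * z b) / S - (\<Sum>b\<leftarrow>b # bs. w b))"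
        by (simp add: powr_add add_divide_distrib exp_diff exp_add)
      finally show ?case .
    qed (use S in simp)
    then show ?thesis using S sum by simp
  qed
  define T where "T = (\<Sum>b\<leftarrow>bs. w b * z b)"
  have "0 \<le> T" unfolding T_def using w z by (intro sum_list_nonneg) auto
  show ?thesis
  proof (cases "T = 0")
    case False
    then show ?thesis using bound[of T] \<open>0 \<le> T\<close> by (simp add: T_def)
  next
    case True
    \<comment> \<open>The mean is 0 and cannot serve as S, so S tends to 0 instead.\<close>
    have "(\<Prod>b\<leftarrow>bs. z b powr w b) \<le> 0 + e" if "0 < e" for e
    proof -
      have "(\<Prod>b\<leftarrow>bs. z b powr w b) \<le> e * exp (T / e - 1)" using bound[OF that] by (simp add: T_def)
      also have "\<dots> \<le> e * 1" using that True by (intro mult_left_mono) auto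
      finally show ?thesis by simp
    qed
    then have "(\<Prod>b\<leftarrow>bs. z b powr w b) \<le> 0" by (rule field_le_epsilon)
    then show ?thesis using True by (simp add: T_def)
  qed
qed

text \<open>After AM-GM the difference of the two integrands is at least a sum over the
  coefficients, and scaling by \<bar>b\<bar> turns the summand of b into the one-parameter integral
  with s = 1 / b^2 \<ge> 2.\<close>

lemma sgn_avg_ge_normal_moment_of_balanced:
  assumes p: "17 / 10 \<le> p" "p < 2" and mom: "normal_moment p \<le> 2 powr (p / 2 - 1)"
    and bs: "sq_sum bs = 1" "\<And>b. b \<in> set bs \<Longrightarrow> b\<^sup>2 \<le> 1 / 2"
  shows "normal_moment p \<le> sgn_moment p bs 0"
proof -
  let ?S = "\<lambda>u. (\<Sum>b\<leftarrow>bs. b\<^sup>2 * \<bar>cos (b * u)\<bar> powr (1 / b\<^sup>2))" and ?C = "\<lambda>u. (\<Prod>b\<leftarrow>bs. cos (b * u))"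
  have p': "0 < p" "p < 2" using p by auto
  have I2: "0 \<le> (\<integral>u. gauss_cos_diff 2 u * jump_wt p u \<partial>lborel)"
    unfolding integral_gauss_cos_diff_two[OF p'] using mom cos_const_pos[OF p'] by simp
  define h where "h = (\<lambda>b u. b\<^sup>2 * ((exp (- u\<^sup>2 / 2) - \<bar>cos (b * u)\<bar> powr (1 / b\<^sup>2)) * jump_wt p u))"
  have h: "integrable lborel (h b) \<and> 0 \<le> (\<integral>u. h b u \<partial>lborel)" if "b \<in> set bs" for b
  proof (cases "b = 0")
    case False
    define c where "c = \<bar>b\<bar>"
    have c: "0 < c" "c\<^sup>2 = b\<^sup>2" using False by (auto simp: c_def)
    define s where "s = 1 / b\<^sup>2"
    have s: "2 \<le> s" using bs(2)[OF that] False by (simp add: s_def field_simps)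
    have wt: "jump_wt p u = c powr (p + 1) * jump_wt p (c * u)" for u
      using c by (cases "0 < u") (auto simp: jump_wt_def indicator_def powr_mult powr_minus powr_diff powr_add field_simps zero_less_mult_iff)
    have ex: "(exp (- u\<^sup>2 / 2) - \<bar>cos (b * u)\<bar> powr (1 / b\<^sup>2)) = gauss_cos_diff s (c * u)" for u
    proof -
      have "exp (- (c * u)\<^sup>2 / 2) powr s = exp (- u\<^sup>2 / 2)"
        using False by (simp add: powr_def power_mult_distrib c s_def)
      moreover have "\<bar>cos (c * u)\<bar> = \<bar>cos (b * u)\<bar>" by (cases "0 \<le> b") (auto simp: c_def)
      ultimately show ?thesis by (simp add: gauss_cos_diff_def s_def)
    qed
    have int: "integrable lborel (\<lambda>u. gauss_cos_diff s (c * u) * jump_wt p u)"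
    proof -
      have "integrable lborel (\<lambda>u. gauss_cos_diff s u * jump_wt p u)"
        using s by (intro integrable_gauss_cos_diff p') simp
      then have "integrable lborel (\<lambda>u. gauss_cos_diff s (0 + c * u) * jump_wt p (0 + c * u))"
        using c by (intro lborel_integrable_real_affine) auto
      then have "integrable lborel (\<lambda>u. c powr (p + 1) * (gauss_cos_diff s (c * u) * jump_wt p (c * u)))"
        by (intro integrable_mult_right) simp
      moreover have "c powr (p + 1) * (gauss_cos_diff s (c * u) * jump_wt p (c * u)) = gauss_cos_diff s (c * u) * jump_wt p u" for u
        using arg_cong[OF wt[of u], of "\<lambda>x. gauss_cos_diff s (c * u) * x"] by (simp only: mult_ac)
      ultimately show ?thesis by simp
    qed
    have "0 \<le> (\<integral>u. gauss_cos_diff s (c * u) * jump_wt p u \<partial>lborel)"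
      unfolding integral_jump_wt_scale[OF c(1), of "gauss_cos_diff s" p]
      by (rule mult_nonneg_nonneg[OF powr_ge_zero integral_gauss_cos_diff_mono[OF p s I2]])
    then show ?thesis unfolding h_def ex using int by simp
  qed (simp add: h_def)
  define D where "D = (\<lambda>u. (exp (- u\<^sup>2 / 2) - ?C u) * jump_wt p u)"
  have pw: "(\<Sum>b\<leftarrow>bs. h b u) \<le> D u" for u
  proof -
    have "?C u \<le> (\<Prod>b\<leftarrow>bs. \<bar>cos (b * u)\<bar>)"
    proof -
      have "\<bar>\<Prod>b\<leftarrow>bs. cos (b * u)\<bar> = (\<Prod>b\<leftarrow>bs. \<bar>cos (b * u)\<bar>)" by (induction bs) (auto simp: abs_mult)
      then show ?thesis by linarith
    qed
    \<comment> \<open>This includes b = 0: then \<open>1 / b\<^sup>2\<close> is 0 by convention, and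
      cos 0 = 1 keeps both powers equal to 1.\<close>
    also have "\<dots> = (\<Prod>b\<leftarrow>bs. (\<bar>cos (b * u)\<bar> powr (1 / b\<^sup>2)) powr (b\<^sup>2))"
      by (intro arg_cong[where f = prod_list] map_cong refl) (auto simp: powr_powr)
    also have "\<dots> \<le> ?S u"
      by (rule weighted_am_gm_list) (use bs in auto)
    finally have "exp (- u\<^sup>2 / 2) * sq_sum bs - ?S u \<le> exp (- u\<^sup>2 / 2) - ?C u"
      using bs by simp
    then have "(exp (- u\<^sup>2 / 2) * sq_sum bs - ?S u) * jump_wt p u \<le> D u"
      unfolding D_def by (intro mult_right_mono) auto
    moreover have "(\<Sum>b\<leftarrow>bs. h b u) = (exp (- u\<^sup>2 / 2) * sq_sum bs - ?S u) * jump_wt p u"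
      unfolding h_def by (induction bs) (auto simp: algebra_simps)
    ultimately show ?thesis by simp
  qed
  have hs: "integrable lborel (\<lambda>u. \<Sum>b\<leftarrow>bs. h b u) \<and> 0 \<le> (\<integral>u. (\<Sum>b\<leftarrow>bs. h b u) \<partial>lborel)"
    using h by (induction bs) auto
  have Deq: "D u = (1 - ?C u) * jump_wt p u - (1 - exp (- u\<^sup>2 / 2)) * jump_wt p u" for u
    by (simp add: D_def algebra_simps)
  have Dint: "integrable lborel D"
    unfolding Deq[abs_def] by (intro Bochner_Integration.integrable_diff sgn_avg_powr_integral normal_integral p')
  have "0 \<le> (\<integral>u. (\<Sum>b\<leftarrow>bs. h b u) \<partial>lborel)" using hs by simp
  also have "\<dots> \<le> (\<integral>u. D u \<partial>lborel)" using hs Dint pw by (intro integral_mono) auto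
  also have "\<dots> = cos_const p * sgn_moment p bs 0 - cos_const p * normal_moment p"
    unfolding Deq using sgn_avg_powr_integral[OF p'] normal_integral[OF p'] by (subst Bochner_Integration.integral_diff) auto
  finally have "cos_const p * normal_moment p \<le> cos_const p * sgn_moment p bs 0" by simp
  then show ?thesis using cos_const_pos[OF p'] by simp
qed

text \<open>The role of \<open>p0\<close>: from there up to 2, two equal coefficients do no better
  than the Gaussian limit.\<close>

lemma normal_moment_le:
  assumes "p0 \<le> p" "p \<le> 2"
  shows "normal_moment p \<le> 2 powr (p / 2 - 1)"
proof -
  have "2 powr (p / 2) * Gamma ((p + 1) / 2) / sqrt pi \<le> 2 powr (p / 2) * (sqrt pi / 2) / sqrt pi"
    by (intro divide_right_mono mult_left_mono Gamma_le_of_p0_le assms) auto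
  then show ?thesis by (simp add: normal_moment_def powr_diff)
qed

lemma normal_moment_pos: "0 < p \<Longrightarrow> 0 < normal_moment p"
  unfolding normal_moment_def by (auto intro!: Gamma_real_pos divide_pos_pos mult_pos_pos)

lemma haagerup_lower:
  assumes p: "p0 \<le> p" "p < 2"
  shows "normal_moment p * sq_sum bs powr (p / 2) \<le> sgn_moment p bs 0"
proof (rule sgn_avg_lower_bound_of_balanced)
  have p17: "17 / 10 \<le> p" using p p0_ge by simp
  show "normal_moment p \<le> 2 powr (p / 2 - 1)" using p by (intro normal_moment_le) auto
  then show "normal_moment p \<le> sgn_moment p bs 0"
    if "sq_sum bs = 1" "\<And>b. b \<in> set bs \<Longrightarrow> b\<^sup>2 \<le> 1 / 2" for bs
    using sgn_avg_ge_normal_moment_of_balanced[OF p17 p(2) _ that] by simp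
  show "0 \<le> normal_moment p" "1 < p" "p < 2" using normal_moment_pos[of p] p p17 by auto
qed

subsection \<open>Interpolation and the Gaussian limit\<close>

lemma tendsto_cos_power:
  "(\<lambda>n. cos (1 / sqrt (real n) * u) ^ n) \<longlonglongrightarrow> exp (- u\<^sup>2 / 2)"
proof -
  have "((\<lambda>x::real. cos (u / sqrt x) powr x) \<longlongrightarrow> exp (- (u * u / 2))) at_top"
    by real_asymp
  then have "((\<lambda>x::real. cos (u / sqrt x) powr x) \<longlongrightarrow> exp (- u\<^sup>2 / 2)) at_top"
    by (simp add: power2_eq_square)
  then have "(\<lambda>n. cos (u / sqrt (real n)) powr real n) \<longlonglongrightarrow> exp (- u\<^sup>2 / 2)"
    by (rule filterlim_compose[OF _ filterlim_real_sequentially])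
  moreover have "\<forall>\<^sub>F n in sequentially. cos (u / sqrt (real n)) powr real n = cos (1 / sqrt (real n) * u) ^ n"
  proof -
    have "(\<lambda>n. cos (u / sqrt (real n))) \<longlonglongrightarrow> 1" by real_asymp
    then have "\<forall>\<^sub>F n in sequentially. cos (u / sqrt (real n)) > 0" by (rule order_tendstoD) simp
    then show ?thesis by eventually_elim (simp add: powr_realpow)
  qed
  ultimately show ?thesis by (rule Lim_transform_eventually)
qed

text \<open>The convex function t^(r/2) at t = x^2 lies above its tangent at t = S. Taking means
  yields Jensen's inequality, for sign averages and for integrals over the cube.\<close>

lemma powr_ge_tangent_square:
  fixes r S x :: real
  assumes r: "2 \<le> r" and S: "0 < S"
  shows "(1 - r / 2) * S powr (r / 2) + (r / 2 * S powr (r / 2 - 1)) * x\<^sup>2 \<le> \<bar>x\<bar> powr r"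
proof (cases "x = 0")
  case True
  then show ?thesis using r S by (simp add: mult_nonpos_nonneg)
next
  case False
  define z where "z = x\<^sup>2 / S"
  have z: "z > 0" using False S by (simp add: z_def)
  have "1 + r / 2 * (z - 1) \<le> z powr (r / 2)"
    using one_plus_powr_ge[of "r / 2" "z - 1"] r z by simp
  then have "S powr (r / 2) * (1 + r / 2 * (z - 1)) \<le> S powr (r / 2) * z powr (r / 2)"
    by (intro mult_left_mono) auto
  also have "\<dots> = (x\<^sup>2) powr (r / 2)" using S z by (simp add: z_def flip: powr_mult)
  also have "\<dots> = \<bar>x\<bar> powr r" by (rule abs_powr_conv_square[symmetric])
  also have "S powr (r / 2) * (1 + r / 2 * (z - 1)) = (1 - r / 2) * S powr (r / 2) + (r / 2 * S powr (r / 2 - 1)) * x\<^sup>2"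
  proof -
    define w where "w = S powr (r / 2 - 1)"
    have "S powr (r / 2) = S * w" using S by (simp add: w_def powr_diff)
    then show ?thesis using S unfolding w_def[symmetric] by (simp add: z_def field_simps)
  qed
  finally show ?thesis .
qed

text \<open>In place of log-convexity of the moments, the pointwise Young inequality behind it is
  averaged. The second moment equals S exactly, so only the r-th moment remains to be solved
  for.\<close>

lemma interpolation_lower:
  assumes p: "0 < r" "r < p" "p < 2"
    and bound: "\<And>bs. 2 powr (p / 2 - 1) * sq_sum bs powr (p / 2) \<le> sgn_moment p bs 0"
  shows "2 powr (r / 2 - 1) * sq_sum bs powr (r / 2) \<le> sgn_moment r bs 0"
proof (cases "sq_sum bs = 0")
  case True
  then show ?thesis using p sgn_avg_nonneg[of "\<lambda>x. \<bar>x\<bar> powr r" bs 0] by simp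
next
  case False
  define S where "S = sq_sum bs"
  have S: "S > 0" using False sq_sum_nonneg[of bs] by (simp add: S_def)
  define \<theta> where "\<theta> = (2 - p) / (2 - r)"
  have "\<theta> * (2 - r) = 2 - p" using p by (simp add: \<theta>_def)
  then have "p = \<theta> * r + (1 - \<theta>) * 2" by (simp add: algebra_simps)
  moreover have "0 < \<theta>" "0 \<le> 1 - \<theta>" using p by (auto simp: \<theta>_def)
  ultimately have \<theta>: "0 < \<theta>" "0 \<le> 1 - \<theta>" "p = \<theta> * r + (1 - \<theta>) * 2" by auto
  define E where "E = (\<lambda>s. sgn_moment s bs 0)"
  have pw: "\<bar>x\<bar> powr p \<le> \<theta> * (2 * S) powr ((p - r) / 2) * \<bar>x\<bar> powr r + (1 - \<theta>) * (2 * S) powr (p / 2 - 1) * x\<^sup>2" for x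
  proof (cases "x = 0")
    case False
    \<comment> \<open>For two equal coefficients \<bar>x\<bar> takes only the values 0 and sqrt (2
      S), and Young is an equality at z = 0 and z = 1. This scale therefore loses nothing in the
      extremal case.\<close>
    define R where "R = (2 * S) powr (1 / 2)"
    have R: "R > 0" using S by (simp add: R_def)
    define z where "z = \<bar>x\<bar> / R"
    have z: "z > 0" using False R by (simp add: z_def)
    have xz: "\<bar>x\<bar> = R * z" using R by (simp add: z_def)
    have "(z powr r) powr \<theta> * (z powr 2) powr (1 - \<theta>) \<le> \<theta> * z powr r + (1 - \<theta>) * z powr 2"
      using z \<theta> by (intro Youngs_inequality_0) auto
    moreover have "(z powr r) powr \<theta> * (z powr 2) powr (1 - \<theta>) = z powr p"
      unfolding powr_powr powr_add[symmetric] by (subst \<theta>(3)) (simp add: mult.commute)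
    ultimately have "z powr p \<le> \<theta> * z powr r + (1 - \<theta>) * z powr 2" by simp
    then have "R powr p * z powr p \<le> R powr p * (\<theta> * z powr r + (1 - \<theta>) * z powr 2)"
      by (intro mult_left_mono) auto
    also have "\<dots> = \<theta> * R powr (p - r) * (R powr r * z powr r) + (1 - \<theta>) * R powr (p - 2) * (R powr 2 * z powr 2)"
      using R by (simp add: powr_diff field_simps del: powr_numeral)
    finally have "(R * z) powr p \<le> \<theta> * R powr (p - r) * (R * z) powr r + (1 - \<theta>) * R powr (p - 2) * (R * z) powr 2"
      using R z by (simp add: powr_mult del: powr_numeral)
    moreover have "R powr (p - r) = (2 * S) powr ((p - r) / 2)" "R powr (p - 2) = (2 * S) powr (p / 2 - 1)"
      unfolding R_def powr_powr by (simp_all add: diff_divide_distrib)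
    moreover have "\<bar>x\<bar> powr 2 = x\<^sup>2" using False by simp
    ultimately show ?thesis unfolding xz[symmetric] by simp
  qed (use p in simp)
  have "2 powr (p / 2 - 1) * S powr (p / 2) \<le> E p" unfolding S_def E_def by (rule bound)
  also have "E p \<le> sgn_avg (\<lambda>x. \<theta> * (2 * S) powr ((p - r) / 2) * \<bar>x\<bar> powr r + (1 - \<theta>) * (2 * S) powr (p / 2 - 1) * x\<^sup>2) bs 0"
    unfolding E_def by (rule sgn_avg_mono) (rule pw)
  also have "\<dots> = \<theta> * (2 * S) powr ((p - r) / 2) * E r + (1 - \<theta>) * (2 * S) powr (p / 2 - 1) * S"
    unfolding sgn_avg_add sgn_avg_cmult sgn_avg_square E_def S_def by simp
  also have "2 powr (p / 2 - 1) * S powr (p / 2) = (2 * S) powr (p / 2 - 1) * S"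
    using S by (simp add: powr_mult powr_diff)
  finally have "\<theta> * ((2 * S) powr (p / 2 - 1) * S) \<le> \<theta> * ((2 * S) powr ((p - r) / 2) * E r)"
    by (simp add: algebra_simps)
  then have "(2 * S) powr (p / 2 - 1) * S \<le> (2 * S) powr ((p - r) / 2) * E r" using \<theta> by simp
  also have "(2 * S) powr (p / 2 - 1) * S = (2 * S) powr ((p - r) / 2) * (2 powr (r / 2 - 1) * S powr (r / 2))"
  proof -
    have "(2 * S) powr (r / 2 - 1) * S = 2 powr (r / 2 - 1) * S powr (r / 2)"
      using S by (simp add: powr_mult powr_diff)
    moreover have "(2 * S) powr (p / 2 - 1) = (2 * S) powr ((p - r) / 2) * (2 * S) powr (r / 2 - 1)"
      by (simp add: diff_divide_distrib flip: powr_add)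
    ultimately show ?thesis by simp
  qed
  finally show ?thesis using S by (simp add: E_def S_def)
qed

lemma p0_lower:
  assumes "0 < r" "r \<le> p0"
  shows "2 powr (r / 2 - 1) * sq_sum bs powr (r / 2) \<le> sgn_moment r bs 0"
proof -
  have "normal_moment p0 = 2 powr (p0 / 2 - 1)"
    by (simp add: normal_moment_def p0_spec powr_diff)
  then have at: "2 powr (p0 / 2 - 1) * sq_sum bs powr (p0 / 2) \<le> sgn_moment p0 bs 0" for bs
    using haagerup_lower[of p0 bs] p0_spec by simp
  show ?thesis
    using interpolation_lower[OF assms(1) _ p0_spec(2) at, of bs] at[of bs] assms
    by (cases "r = p0") auto
qed

lemma sgn_avg_jensen:
  assumes r: "2 \<le> r"
  shows "sq_sum bs powr (r / 2) \<le> sgn_moment r bs 0"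
proof (cases "sq_sum bs = 0")
  case True
  then show ?thesis using sgn_avg_nonneg[of "\<lambda>x. \<bar>x\<bar> powr r" bs 0] by simp
next
  case False
  define S where "S = sq_sum bs"
  have S: "S > 0" using False sq_sum_nonneg[of bs] by (simp add: S_def)
  have "S powr (r / 2) = sgn_avg (\<lambda>x. (1 - r / 2) * S powr (r / 2) + (r / 2 * S powr (r / 2 - 1)) * x\<^sup>2) bs 0"
    unfolding sgn_avg_add sgn_avg_cmult sgn_avg_square sgn_avg_const
    using S by (simp add: S_def[symmetric] powr_diff algebra_simps)
  also have "\<dots> \<le> sgn_moment r bs 0"
    by (rule sgn_avg_mono) (rule powr_ge_tangent_square[OF r S])
  finally show ?thesis by (simp add: S_def)
qed

text \<open>Convergence of moments in the central limit theorem, obtained by dominated convergence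
  in the integral representation.\<close>

lemma sgn_avg_replicate_limit:
  assumes p: "0 < p" "p < 2"
  shows "(\<lambda>n. sgn_moment p (replicate n (1 / sqrt (real n))) 0) \<longlonglongrightarrow> normal_moment p"
proof -
  let ?c = "\<lambda>n u. cos (1 / sqrt (real n) * u) ^ n"
  define F where "F = (\<lambda>n u. (1 - ?c n u) * jump_wt p u)"
  have eq: "(\<integral>u. F n u \<partial>lborel) = cos_const p * sgn_moment p (replicate n (1 / sqrt (real n))) 0" for n
    using sgn_avg_powr_integral(2)[OF p, of "replicate n (1 / sqrt (real n))"] unfolding F_def
    by (simp add: prod_list_replicate del: times_divide_eq_left)
  have bnd: "\<bar>1 - ?c n u\<bar> \<le> u\<^sup>2 / 2" "\<bar>1 - ?c n u\<bar> \<le> 2" for n u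
  proof -
    define c where "c = cos (1 / sqrt (real n) * u)"
    have c: "\<bar>c\<bar> \<le> 1" by (simp add: c_def)
    \<comment> \<open>The factor n is compensated by the scaling: 1 - c is at most u^2 / (2 n),
      which gives a bound uniform in n.\<close>
    have "\<bar>1 - c ^ n\<bar> \<le> real n * (1 - c)"
    proof (induction n)
      case (Suc n)
      have "\<bar>1 - c ^ Suc n\<bar> = \<bar>(1 - c) + c * (1 - c ^ n)\<bar>" by (simp add: algebra_simps)
      also have "\<dots> \<le> \<bar>1 - c\<bar> + \<bar>c\<bar> * \<bar>1 - c ^ n\<bar>" by (simp flip: abs_mult)
      also have "\<bar>c\<bar> * \<bar>1 - c ^ n\<bar> \<le> 1 * (real n * (1 - c))" using c Suc by (intro mult_mono) auto
      also have "\<bar>1 - c\<bar> = 1 - c" using c by auto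
      finally show ?case by (simp add: algebra_simps)
    qed simp
    also have "real n * (1 - c) \<le> real n * ((1 / sqrt (real n) * u)\<^sup>2 / 2)"
      unfolding c_def by (intro mult_left_mono one_minus_cos_le) auto
    also have "\<dots> \<le> u\<^sup>2 / 2" by (cases "n = 0") (auto simp: power_divide)
    finally show "\<bar>1 - ?c n u\<bar> \<le> u\<^sup>2 / 2" by (simp add: c_def)
    have "\<bar>c ^ n\<bar> \<le> 1" using c by (simp add: power_abs power_le_one)
    then show "\<bar>1 - ?c n u\<bar> \<le> 2" unfolding c_def[symmetric] by linarith
  qed
  have lim_cos: "(\<lambda>n. ?c n u) \<longlonglongrightarrow> exp (- u\<^sup>2 / 2)" for u :: real
    by (rule tendsto_cos_power)
  have "(\<lambda>n. \<integral>u. F n u \<partial>lborel) \<longlonglongrightarrow> (\<integral>u. (1 - exp (- u\<^sup>2 / 2)) * jump_wt p u \<partial>lborel)"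
  proof (rule integral_dominated_convergence[where w = "\<lambda>u. min (u\<^sup>2) 2 * jump_wt p u"])
    show "integrable lborel (\<lambda>u. min (u\<^sup>2) 2 * jump_wt p u)"
      by (rule integrable_mult_jump_wt[OF p, where C = 2]) (auto simp: min_def)
    show "AE u in lborel. (\<lambda>n. F n u) \<longlonglongrightarrow> (1 - exp (- u\<^sup>2 / 2)) * jump_wt p u"
      unfolding F_def by (intro AE_I2 tendsto_intros lim_cos)
    show "AE u in lborel. norm (F n u) \<le> min (u\<^sup>2) 2 * jump_wt p u" for n
    proof (rule AE_I2)
      fix u :: real
      have "\<bar>1 - ?c n u\<bar> \<le> min (u\<^sup>2) 2"
        using bnd[of n u] zero_le_power2[of u] by linarith
      then show "norm (F n u) \<le> min (u\<^sup>2) 2 * jump_wt p u"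
        unfolding F_def real_norm_def abs_mult by (intro mult_mono) auto
    qed
  qed (auto simp: F_def)
  then have "(\<lambda>n. cos_const p * sgn_moment p (replicate n (1 / sqrt (real n))) 0) \<longlonglongrightarrow> cos_const p * normal_moment p"
    unfolding eq normal_integral(2)[OF p] .
  then have "(\<lambda>n. cos_const p * sgn_moment p (replicate n (1 / sqrt (real n))) 0 / cos_const p) \<longlonglongrightarrow> cos_const p * normal_moment p / cos_const p"
    using cos_const_pos[OF p] by (intro tendsto_divide) auto
  then show ?thesis using cos_const_pos[OF p] by simp
qed

subsection \<open>The one-dimensional constants\<close>

lemma prob_space_unit_meas: "prob_space unit_meas"
proof
  show "emeasure unit_meas (space unit_meas) = 1"
    unfolding unit_meas_def by (simp add: space_restrict_space emeasure_restrict_space)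
qed

lemma rademacher_measurable [measurable]: "rademacher j \<in> borel_measurable borel"
  unfolding rademacher_def[abs_def] by measurable

lemma rademacher_measurable_unit [measurable]: "rademacher j \<in> borel_measurable unit_meas"
  unfolding unit_meas_def by (intro measurable_restrict_space1) simp

lemma abs_rademacher_le: "\<bar>rademacher j t\<bar> \<le> 1"
  by (simp add: rademacher_def sgn_if)

lemma rademacher_Suc_left: "rademacher (Suc j) (u / 2) = rademacher j u"
  by (simp add: rademacher_def mult.assoc)

text \<open>The half-unit shift adds 2^j pi to the argument of the sine, a multiple of 2 pi only for
  j \<ge> 1. The first Rademacher function changes sign instead, see
  \<open>rademacher_one\<close>.\<close>

lemma rademacher_Suc_right:
  assumes "1 \<le> j"
  shows "rademacher (Suc j) (1 / 2 + u / 2) = rademacher j u"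
proof -
  obtain i where j: "j = Suc i" using assms by (cases j) auto
  have "2 ^ Suc j * pi * (1 / 2 + u / 2) = 2 ^ j * pi * u + real (2 ^ i) * (2 * pi)"
    by (simp add: j algebra_simps)
  then show ?thesis unfolding rademacher_def using sin.plus_of_nat[of "2 ^ j * pi * u" "2 ^ i"] by simp
qed

lemma rademacher_one:
  assumes "0 < u" "u < 1"
  shows "rademacher (Suc 0) (u / 2) = 1" "rademacher (Suc 0) (1 / 2 + u / 2) = - 1"
proof -
  have s: "sin (pi * u) > 0" using assms by (intro sin_gt_zero) (auto simp: mult_less_cancel_left1)
  have 1: "2 ^ Suc 0 * pi * (u / 2) = pi * u" "2 ^ Suc 0 * pi * (1 / 2 + u / 2) = pi * u + pi"
    by (simp_all add: field_simps)
  show "rademacher (Suc 0) (u / 2) = 1" "rademacher (Suc 0) (1 / 2 + u / 2) = - 1"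
    unfolding rademacher_def 1 using s by simp_all
qed

lemma sum_rademacher_halves:
  assumes u: "0 < u" "u < 1"
  shows "(\<Sum>j=1..Suc n. a j * rademacher j (u / 2)) = a 1 + (\<Sum>j=1..n. a (Suc j) * rademacher j u)"
    and "(\<Sum>j=1..Suc n. a j * rademacher j (1 / 2 + u / 2)) = - a 1 + (\<Sum>j=1..n. a (Suc j) * rademacher j u)"
proof -
  have split: "(\<Sum>j=1..Suc n. f j) = f 1 + (\<Sum>j=1..n. f (Suc j))" for f :: "nat \<Rightarrow> real"
    using sum.atLeast_Suc_atMost[of 1 "Suc n" f] sum.shift_bounds_cl_Suc_ivl[of f 1 n] by simp
  show "(\<Sum>j=1..Suc n. a j * rademacher j (u / 2)) = a 1 + (\<Sum>j=1..n. a (Suc j) * rademacher j u)"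
    by (simp only: split rademacher_Suc_left) (simp add: rademacher_one u)
  show "(\<Sum>j=1..Suc n. a j * rademacher j (1 / 2 + u / 2)) = - a 1 + (\<Sum>j=1..n. a (Suc j) * rademacher j u)"
    unfolding split by (simp add: rademacher_Suc_right rademacher_one u)
qed

text \<open>On either half of the interval the first function is constantly 1 or -1, and stretching
  the half to unit length lowers the other indices by one. This is the recursion of
  \<open>sgn_avg\<close>; endpoints and midpoint, where the sign is 0, are null sets.\<close>

lemma has_integral_sum_rademacher:
  assumes [measurable]: "\<phi> \<in> borel_measurable borel"
  shows "has_bochner_integral lborel (\<lambda>t. indicator {0<..<1} t * \<phi> (x + (\<Sum>j=1..n. a j * rademacher j t)))
     (sgn_avg \<phi> (map a [1..<Suc n]) x)"
proof (induction n arbitrary: a x)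
  case 0
  have "has_bochner_integral lborel (\<lambda>t. indicator {0<..<1::real} t *\<^sub>R \<phi> x) (measure lborel {0<..<1::real} *\<^sub>R \<phi> x)"
    by (rule has_bochner_integral_indicator) auto
  then show ?case by simp
next
  case (Suc n)
  define F where "F = (\<lambda>t. \<phi> (x + (\<Sum>j=1..Suc n. a j * rademacher j t)))"
  have [measurable]: "F \<in> borel_measurable borel" unfolding F_def by measurable
  define b where "b = (\<lambda>j. a (Suc j))"
  let ?A = "sgn_avg \<phi> (map b [1..<Suc n])"
  have lists: "map a [1..<Suc (Suc n)] = a 1 # map b [1..<Suc n]"
  proof -
    have "[1..<Suc (Suc n)] = 1 # map Suc [1..<Suc n]" by (simp only: map_Suc_upt) (simp add: upt_rec)
    then show ?thesis by (simp add: b_def)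
  qed
  have left: "has_bochner_integral lborel (\<lambda>t. indicator {0<..<1/2} t * F t) (?A (x + a 1) / 2)"
  proof -
    have "(\<lambda>u. indicator {0<..<1/2} (0 + 1 / 2 * u) * F (0 + 1 / 2 * u))
        = (\<lambda>u. indicator {0<..<1} u * \<phi> (x + a 1 + (\<Sum>j=1..n. b j * rademacher j u)))"
    proof
      fix u :: real
      show "indicator {0<..<1/2} (0 + 1 / 2 * u) * F (0 + 1 / 2 * u) = indicator {0<..<1} u * \<phi> (x + a 1 + (\<Sum>j=1..n. b j * rademacher j u))"
        using sum_rademacher_halves(1)[of u a n] by (auto simp: indicator_def F_def b_def add.assoc)
    qed
    then show ?thesis
      using lborel_has_bochner_integral_real_affine_iff[of "1 / 2" "\<lambda>t. indicator {0<..<1/2} t * F t" "?A (x + a 1) / 2" 0]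
        Suc.IH[of "x + a 1" b] by simp
  qed
  have right: "has_bochner_integral lborel (\<lambda>t. indicator {1/2<..<1} t * F t) (?A (x - a 1) / 2)"
  proof -
    have "(\<lambda>u. indicator {1/2<..<1} (1 / 2 + 1 / 2 * u) * F (1 / 2 + 1 / 2 * u))
        = (\<lambda>u. indicator {0<..<1} u * \<phi> (x - a 1 + (\<Sum>j=1..n. b j * rademacher j u)))"
    proof
      fix u :: real
      show "indicator {1/2<..<1} (1 / 2 + 1 / 2 * u) * F (1 / 2 + 1 / 2 * u) = indicator {0<..<1} u * \<phi> (x - a 1 + (\<Sum>j=1..n. b j * rademacher j u))"
      proof (cases "0 < u \<and> u < 1")
        case True
        have "F (1 / 2 + 1 / 2 * u) = \<phi> (x + (- a 1 + (\<Sum>j=1..n. a (Suc j) * rademacher j u)))"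
          using sum_rademacher_halves(2)[of u a n] True by (simp add: F_def)
        also have "x + (- a 1 + (\<Sum>j=1..n. a (Suc j) * rademacher j u)) = x - a 1 + (\<Sum>j=1..n. b j * rademacher j u)"
          by (simp add: b_def)
        finally show ?thesis using True by simp
      qed auto
    qed
    then show ?thesis
      using lborel_has_bochner_integral_real_affine_iff[of "1 / 2" "\<lambda>t. indicator {1/2<..<1} t * F t" "?A (x - a 1) / 2" "1 / 2"]
        Suc.IH[of "x - a 1" b] by simp
  qed
  have "has_bochner_integral lborel (\<lambda>t. indicator {0<..<1/2} t * F t + indicator {1/2<..<1} t * F t)
     (?A (x + a 1) / 2 + ?A (x - a 1) / 2)"
    by (rule has_bochner_integral_add[OF left right])
  moreover have "AE t in lborel. indicator {0<..<1/2} t * F t + indicator {1/2<..<1} t * F t = indicator {0<..<1} t * F t"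
  proof -
    have "AE t in lborel. t \<noteq> (1 / 2 :: real)" by (rule AE_lborel_singleton)
    then show ?thesis by eventually_elim (auto simp: indicator_def)
  qed
  ultimately have "has_bochner_integral lborel (\<lambda>t. indicator {0<..<1} t * F t)
     (?A (x + a 1) / 2 + ?A (x - a 1) / 2)"
    by (subst (asm) has_bochner_integral_cong_AE) auto
  then show ?case unfolding lists sgn_avg.simps F_def by (simp add: add_divide_distrib)
qed

lemma integral_sum_rademacher:
  assumes [measurable]: "\<phi> \<in> borel_measurable borel"
  shows "(\<integral>t. \<phi> (\<Sum>j=1..n. a j * rademacher j t) \<partial>unit_meas) = sgn_avg \<phi> (map a [1..<Suc n]) 0"
proof -
  have "(\<integral>t. \<phi> (\<Sum>j=1..n. a j * rademacher j t) \<partial>unit_meas)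
      = (\<integral>t. indicator {0..1} t * \<phi> (\<Sum>j=1..n. a j * rademacher j t) \<partial>lborel)"
    unfolding unit_meas_def by (subst integral_restrict_space) auto
  also have "\<dots> = (\<integral>t. indicator {0<..<1} t * \<phi> (0 + (\<Sum>j=1..n. a j * rademacher j t)) \<partial>lborel)"
  proof (rule integral_cong_AE)
    have "AE t in lborel. t \<noteq> (0 :: real)" "AE t in lborel. t \<noteq> (1 :: real)" by (rule AE_lborel_singleton)+
    then show "AE t in lborel. indicator {0..1} t * \<phi> (\<Sum>j=1..n. a j * rademacher j t) = indicator {0<..<1} t * \<phi> (0 + (\<Sum>j=1..n. a j * rademacher j t))"
      by eventually_elim (auto simp: indicator_def)
  qed measurable
  also have "\<dots> = sgn_avg \<phi> (map a [1..<Suc n]) 0"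
    by (rule has_bochner_integral_integral_eq[OF has_integral_sum_rademacher[OF assms]])
  finally show ?thesis .
qed

abbreviation rademacher_moment :: "real \<Rightarrow> nat \<Rightarrow> (nat \<Rightarrow> real) \<Rightarrow> real" where
  "rademacher_moment r n a \<equiv> (\<integral>t. \<bar>\<Sum>j=1..n. a j * rademacher j t\<bar> powr r \<partial>unit_meas)"

lemma integral_sum_rademacher_powr:
  "rademacher_moment r n a = sgn_moment r (map a [1..<Suc n]) 0"
  by (rule integral_sum_rademacher) measurable

lemma sq_sum_map_upt: "sq_sum (map a [1..<Suc n]) = (\<Sum>j=1..n. (a j)\<^sup>2)"
  by (simp add: sum_list_distinct_conv_sum_set o_def atLeastLessThanSuc_atLeastAtMost del: upt_Suc)

lemma khintchine_ok_iff:
  "khintchine_ok r A \<longleftrightarrow> (\<forall>as. sqrt (sq_sum as) \<le> A * sgn_moment r as 0 powr (1 / r))"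
proof
  assume ok: "khintchine_ok r A"
  show "\<forall>as. sqrt (sq_sum as) \<le> A * sgn_moment r as 0 powr (1 / r)"
  proof
    fix as :: "real list"
    define a where "a = (\<lambda>j. as ! (j - 1))"
    have as: "map a [1..<Suc (length as)] = as"
      by (rule nth_equalityI) (auto simp: a_def simp del: upt_Suc)
    show "sqrt (sq_sum as) \<le> A * sgn_moment r as 0 powr (1 / r)"
      using ok[unfolded khintchine_ok_def, rule_format, of a "length as"]
      unfolding integral_sum_rademacher_powr sq_sum_map_upt[symmetric] as .
  qed
next
  assume "\<forall>as. sqrt (sq_sum as) \<le> A * sgn_moment r as 0 powr (1 / r)"
  then show "khintchine_ok r A"
    unfolding khintchine_ok_def integral_sum_rademacher_powr sq_sum_map_upt[symmetric] by blast
qed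

section \<open>Optimal constants in the three ranges of the exponent\<close>

lemma khintchine_ok_powrI:
  assumes r: "0 < r" and c: "0 < c"
    and lower: "\<And>as. c * sq_sum as powr (r / 2) \<le> sgn_moment r as 0"
  shows "khintchine_ok r (c powr (- 1 / r))"
  unfolding khintchine_ok_iff
proof
  fix as :: "real list"
  have "sqrt (sq_sum as) = (sq_sum as powr (r / 2)) powr (1 / r)"
    using r sq_sum_nonneg[of as] by (simp add: powr_powr powr_half_sqrt)
  also have "\<dots> \<le> (sgn_moment r as 0 / c) powr (1 / r)"
    using r c lower[of as] by (intro powr_mono2) (auto simp: field_simps)
  also have "\<dots> = c powr (- 1 / r) * sgn_moment r as 0 powr (1 / r)"
    using c sgn_avg_nonneg[of "\<lambda>x. \<bar>x\<bar> powr r" as 0] by (simp add: powr_divide powr_minus_divide)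
  finally show "sqrt (sq_sum as) \<le> c powr (- 1 / r) * sgn_moment r as 0 powr (1 / r)" .
qed

lemma khintchine_ok_ge_one:
  assumes "khintchine_ok r A"
  shows "1 \<le> A"
  using assms[unfolded khintchine_ok_iff, rule_format, of "[1]"] by simp

lemma A_constI:
  assumes "khintchine_ok r A" "\<And>B. khintchine_ok r B \<Longrightarrow> A \<le> B"
  shows "A_const r = A"
  unfolding A_const_def using assms by (intro cInf_eq_minimum) auto

lemma A_const_ge_2:
  assumes "2 \<le> r"
  shows "khintchine_ok r 1" "A_const r = 1"
proof -
  show ok: "khintchine_ok r 1"
    using khintchine_ok_powrI[of r 1] sgn_avg_jensen[OF assms] assms by simp
  show "A_const r = 1" by (rule A_constI[OF ok khintchine_ok_ge_one])
qed

lemma A_const_le_p0: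
  assumes r: "0 < r" "r \<le> p0"
  shows "khintchine_ok r (2 powr (1 / r - 1 / 2))" "A_const r = 2 powr (1 / r - 1 / 2)"
proof -
  have "(2 powr (r / 2 - 1)) powr (- 1 / r) = (2 powr (1 / r - 1 / 2) :: real)"
  proof -
    have "(r / 2 - 1) * (- 1 / r) = 1 / r - 1 / 2" using r by (simp add: field_simps)
    then show ?thesis by (simp only: powr_powr)
  qed
  then show ok: "khintchine_ok r (2 powr (1 / r - 1 / 2))"
    using khintchine_ok_powrI[of r "2 powr (r / 2 - 1)"] p0_lower[OF r] r by simp
  show "A_const r = 2 powr (1 / r - 1 / 2)"
  proof (rule A_constI[OF ok])
    fix B assume "khintchine_ok r B"
    \<comment> \<open>Two equal coefficients are extremal in this range.\<close>
    then have "sqrt (sq_sum [1, 1]) \<le> B * sgn_moment r [1, 1] 0 powr (1 / r)"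
      unfolding khintchine_ok_iff by blast
    moreover have "sgn_moment r [1, 1] 0 = 2 powr (r - 1)" by (simp add: powr_diff)
    ultimately have "2 powr (1 / 2) \<le> B * (2 powr (r - 1)) powr (1 / r)" by (simp add: powr_half_sqrt)
    also have "(2 powr (r - 1)) powr (1 / r) = (2 powr (1 - 1 / r) :: real)"
      unfolding powr_powr using r by (simp add: field_simps)
    finally have "2 powr (1 / 2) / 2 powr (1 - 1 / r) \<le> B" by (simp add: pos_divide_le_eq)
    moreover have "2 powr (1 / 2) / 2 powr (1 - 1 / r) = (2 powr (1 / r - 1 / 2) :: real)"
      by (simp add: algebra_simps flip: powr_diff)
    ultimately show "2 powr (1 / r - 1 / 2) \<le> B" by simp
  qed
qed

lemma A_const_between:
  assumes r: "p0 < r" "r < 2"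
  defines "A \<equiv> 1 / sqrt 2 * (Gamma ((r + 1) / 2) / sqrt pi) powr (- 1 / r)"
  shows "khintchine_ok r A" "A_const r = A"
proof -
  have r0: "0 < r" using r p0_spec by simp
  have m: "0 < normal_moment r" by (rule normal_moment_pos[OF r0])
  have A: "A = normal_moment r powr (- 1 / r)"
  proof -
    have "normal_moment r powr (- 1 / r) = (2 powr (r / 2) * (Gamma ((r + 1) / 2) / sqrt pi)) powr (- 1 / r)"
      by (simp add: normal_moment_def)
    also have "\<dots> = (2 powr (r / 2)) powr (- 1 / r) * (Gamma ((r + 1) / 2) / sqrt pi) powr (- 1 / r)"
      using r0 by (intro powr_mult)
    also have "(2 powr (r / 2)) powr (- 1 / r) = (1 / sqrt 2 :: real)"
      unfolding powr_powr using r0 by (simp add: powr_minus_divide powr_half_sqrt)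
    finally show ?thesis by (simp add: A_def)
  qed
  show ok: "khintchine_ok r A"
    unfolding A using r haagerup_lower[of r] by (intro khintchine_ok_powrI r0 m) auto
  show "A_const r = A"
  proof (rule A_constI[OF ok])
    fix B assume B: "khintchine_ok r B"
    have B1: "1 \<le> B" by (rule khintchine_ok_ge_one[OF B])
    \<comment> \<open>No finite list need be extremal here; optimality comes from n equal
      coefficients of square sum 1 as n grows.\<close>
    define E where "E = (\<lambda>n. sgn_moment r (replicate n (1 / sqrt (real n))) 0)"
    have "(\<lambda>n. B * E n powr (1 / r)) \<longlonglongrightarrow> B * normal_moment r powr (1 / r)"
      unfolding E_def using sgn_avg_replicate_limit[OF r0 r(2)] m by (intro tendsto_intros) auto
    moreover have "\<forall>\<^sub>F n in sequentially. 1 \<le> B * E n powr (1 / r)"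
    proof (rule eventually_sequentiallyI[of 1])
      fix n :: nat assume "1 \<le> n"
      then have "sq_sum (replicate n (1 / sqrt (real n))) = 1" by (simp add: sum_list_replicate power_divide)
      then show "1 \<le> B * E n powr (1 / r)"
        using B[unfolded khintchine_ok_iff, rule_format, of "replicate n (1 / sqrt (real n))"] by (simp add: E_def)
    qed
    ultimately have "1 \<le> B * normal_moment r powr (1 / r)"
      by (intro tendsto_lowerbound[of "\<lambda>n. B * E n powr (1 / r)"]) auto
    then show "A \<le> B" unfolding A using m by (simp add: powr_minus_divide pos_divide_le_eq)
  qed
qed

subsection \<open>The multiple inequality\<close>

text \<open>Hoelder with exponents s / (s - 1) and s, with the first factor already in the form
  u^(s-1) in which the duality proof of Minkowski uses it. Young's inequality is applied termwise
  after normalizing both sums to 1.\<close>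

lemma holder_sum:
  fixes u w :: "'a \<Rightarrow> real"
  assumes J: "finite J" and s: "1 \<le> s" and nn: "\<And>j. j \<in> J \<Longrightarrow> 0 \<le> u j" "\<And>j. j \<in> J \<Longrightarrow> 0 \<le> w j"
  shows "(\<Sum>j\<in>J. u j powr (s - 1) * w j)
    \<le> (\<Sum>j\<in>J. u j powr s) powr ((s - 1) / s) * (\<Sum>j\<in>J. w j powr s) powr (1 / s)"
proof -
  define P where "P = (\<Sum>j\<in>J. u j powr s)"
  define Q where "Q = (\<Sum>j\<in>J. w j powr s)"
  have PQ: "0 \<le> P" "0 \<le> Q" by (auto simp: P_def Q_def intro: sum_nonneg)
  have zeros: "P = 0 \<Longrightarrow> j \<in> J \<Longrightarrow> u j = 0" "Q = 0 \<Longrightarrow> j \<in> J \<Longrightarrow> w j = 0" for j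
    using J by (auto simp: P_def Q_def sum_nonneg_eq_0_iff)
  show ?thesis
  proof (cases "P = 0 \<or> Q = 0")
    case True
    then have "(\<Sum>j\<in>J. u j powr (s - 1) * w j) = 0" using zeros by (intro sum.neutral) auto
    then show ?thesis by simp
  next
    case False
    then have PQ: "0 < P" "0 < Q" using PQ by auto
    let ?R = "\<lambda>j. (s - 1) / s * (u j powr s / P) + 1 / s * (w j powr s / Q)" and ?C = "P powr ((s - 1) / s) * Q powr (1 / s)"
    have young: "u j powr (s - 1) * w j \<le> ?C * ?R j"
      if j: "j \<in> J" for j
    proof (cases "u j = 0 \<or> w j = 0")
      case True
      then have "u j powr (s - 1) * w j = 0" by auto
      also have "0 \<le> ?C * ?R j"
        using PQ s by (intro mult_nonneg_nonneg add_nonneg_nonneg) auto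
      finally show ?thesis .
    next
      case False
      then have uw: "0 < u j" "0 < w j" using nn[OF j] by auto
      have "(u j powr s / P) powr ((s - 1) / s) * (w j powr s / Q) powr (1 / s)
         \<le> ?R j"
        using uw PQ s by (intro Youngs_inequality_0) (auto simp: diff_divide_distrib)
      moreover have "(u j powr s / P) powr ((s - 1) / s) = u j powr (s - 1) / P powr ((s - 1) / s)"
        using uw PQ s by (simp add: powr_divide powr_powr)
      moreover have "(w j powr s / Q) powr (1 / s) = w j / Q powr (1 / s)"
        using uw PQ s by (simp add: powr_divide powr_powr)
      ultimately have "u j powr (s - 1) / P powr ((s - 1) / s) * (w j / Q powr (1 / s))
         \<le> ?R j" by simp
      then have "?C * (u j powr (s - 1) / P powr ((s - 1) / s) * (w j / Q powr (1 / s)))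
         \<le> ?C * ?R j"
        by (intro mult_left_mono) auto
      moreover have "?C * (u j powr (s - 1) / P powr ((s - 1) / s) * (w j / Q powr (1 / s))) = u j powr (s - 1) * w j"
        using PQ by simp
      ultimately show ?thesis by simp
    qed
    have "(\<Sum>j\<in>J. u j powr (s - 1) * w j)
      \<le> (\<Sum>j\<in>J. ?C * ?R j)"
      by (rule sum_mono) (rule young)
    also have "\<dots> = ?C * ((s - 1) / s * (P / P) + 1 / s * (Q / Q))"
      unfolding sum_distrib_left[symmetric] sum.distrib P_def Q_def sum_divide_distrib[symmetric] ..
    also have "(s - 1) / s * (P / P) + 1 / s * (Q / Q) = 1" using PQ s by (simp flip: add_divide_distrib)
    finally show ?thesis by (simp add: P_def Q_def)
  qed
qed

text \<open>Duality: T, the s-th power sum of the integrals W, is the integral of the pairing of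
  W^(s-1) with w. Hoelder under the integral bounds it by T^((s-1)/s) times the right side, and this
  power cancels.\<close>

lemma minkowski_integral_sum:
  fixes w :: "'a \<Rightarrow> 'b \<Rightarrow> real"
  assumes J: "finite J" and s: "1 \<le> s" and nn: "\<And>j t. j \<in> J \<Longrightarrow> 0 \<le> w j t"
    and int: "\<And>j. j \<in> J \<Longrightarrow> integrable M (w j)"
    and int': "integrable M (\<lambda>t. (\<Sum>j\<in>J. w j t powr s) powr (1 / s))"
  shows "(\<Sum>j\<in>J. (\<integral>t. w j t \<partial>M) powr s) powr (1 / s) \<le> (\<integral>t. (\<Sum>j\<in>J. w j t powr s) powr (1 / s) \<partial>M)"
proof -
  let ?Q = "\<lambda>t. (\<Sum>j\<in>J. w j t powr s) powr (1 / s)"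
  define W where "W = (\<lambda>j. \<integral>t. w j t \<partial>M)"
  have W: "0 \<le> W j" if "j \<in> J" for j unfolding W_def using nn[OF that] by (intro integral_nonneg_AE) auto
  define T where "T = (\<Sum>j\<in>J. W j powr s)"
  have T: "0 \<le> T" by (auto simp: T_def intro: sum_nonneg)
  show ?thesis
  proof (cases "T = 0")
    case True
    then show ?thesis by (simp add: T_def W_def)
  next
    case False
    then have T0: "T > 0" using T by simp
    have "T = (\<Sum>j\<in>J. W j powr (s - 1) * W j)"
      unfolding T_def
    proof (rule sum.cong)
      fix j assume "j \<in> J"
      then show "W j powr s = W j powr (s - 1) * W j" using W[of j] by (cases "W j = 0") (auto simp: powr_diff)
    qed simp
    also have "\<dots> = (\<integral>t. (\<Sum>j\<in>J. W j powr (s - 1) * w j t) \<partial>M)"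
      using int by (subst Bochner_Integration.integral_sum) (auto simp: W_def)
    also have "\<dots> \<le> (\<integral>t. T powr ((s - 1) / s) * ?Q t \<partial>M)"
      using int int' holder_sum[OF J s W nn] unfolding T_def by (intro integral_mono) auto
    also have "\<dots> = T powr ((s - 1) / s) * (\<integral>t. ?Q t \<partial>M)" by simp
    finally have "T \<le> T powr ((s - 1) / s) * (\<integral>t. ?Q t \<partial>M)" .
    moreover have "T = T powr ((s - 1) / s) * T powr (1 / s)"
      using T0 s by (simp flip: powr_add add_divide_distrib)
    ultimately have "T powr ((s - 1) / s) * T powr (1 / s) \<le> T powr ((s - 1) / s) * (\<integral>t. ?Q t \<partial>M)"
      by linarith
    then have "T powr (1 / s) \<le> (\<integral>t. ?Q t \<partial>M)"
      using T0 by simp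
    then show ?thesis by (simp add: T_def W_def)
  qed
qed

section \<open>Multilinear Rademacher sums on the cube\<close>

abbreviation cube_meas :: "nat \<Rightarrow> (nat \<Rightarrow> real) measure" where
  "cube_meas m \<equiv> PiM {..<m} (\<lambda>_. unit_meas)"

lemma product_sigma_finite_unit: "product_sigma_finite (\<lambda>_ :: nat. unit_meas)"
  by (simp add: product_sigma_finite_def prob_space_imp_sigma_finite prob_space_unit_meas)

lemma prob_space_cube_meas: "prob_space (cube_meas m)"
  by (intro prob_space_PiM prob_space_unit_meas)

definition multi_sum :: "nat \<Rightarrow> nat \<Rightarrow> ((nat \<Rightarrow> nat) \<Rightarrow> real) \<Rightarrow> (nat \<Rightarrow> real) \<Rightarrow> real" where
  "multi_sum m N y t = (\<Sum>i\<in>multi_idx m N. (\<Prod>k<m. rademacher (i k) (t k)) * y i)"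

lemma multi_sum_measurable [measurable]: "multi_sum m N y \<in> borel_measurable (cube_meas m)"
proof -
  have "(\<lambda>t. rademacher j (t k)) \<in> borel_measurable (cube_meas m)" if "k < m" for j k
  proof -
    have "(\<lambda>t. t k) \<in> measurable (cube_meas m) unit_meas"
      using that by (intro measurable_component_singleton) auto
    from measurable_compose[OF this rademacher_measurable_unit[of j]] show ?thesis .
  qed
  then show ?thesis unfolding multi_sum_def[abs_def]
    by (intro borel_measurable_sum borel_measurable_times borel_measurable_prod) auto
qed

lemma abs_multi_sum_le: "\<bar>multi_sum m N y t\<bar> \<le> (\<Sum>i\<in>multi_idx m N. \<bar>y i\<bar>)"
proof -
  have "\<bar>multi_sum m N y t\<bar> \<le> (\<Sum>i\<in>multi_idx m N. \<bar>(\<Prod>k<m. rademacher (i k) (t k)) * y i\<bar>)"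
    unfolding multi_sum_def by (rule sum_abs)
  also have "\<dots> \<le> (\<Sum>i\<in>multi_idx m N. \<bar>y i\<bar>)"
  proof (rule sum_mono)
    fix i
    have "(\<Prod>k<m. \<bar>rademacher (i k) (t k)\<bar>) \<le> 1"
      by (rule prod_le_1) (use abs_rademacher_le in auto)
    from mult_right_mono[OF this, of "\<bar>y i\<bar>"]
    show "\<bar>(\<Prod>k<m. rademacher (i k) (t k)) * y i\<bar> \<le> \<bar>y i\<bar>"
      by (simp add: abs_mult abs_prod)
  qed
  finally show ?thesis .
qed

lemma integrable_cube_bounded:
  fixes f :: "_ \<Rightarrow> real"
  assumes "f \<in> borel_measurable (cube_meas m)" "\<And>t. \<bar>f t\<bar> \<le> B"
  shows "integrable (cube_meas m) f"
proof -
  interpret prob_space "cube_meas m" by (rule prob_space_cube_meas)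
  show ?thesis using assms by (intro integrable_const_bound[where B = B]) auto
qed

lemma integrable_multi_sum_powr:
  assumes "0 \<le> r"
  shows "integrable (cube_meas m) (\<lambda>t. \<bar>multi_sum m N y t\<bar> powr r)"
proof (rule integrable_cube_bounded)
  show "\<bar>\<bar>multi_sum m N y t\<bar> powr r\<bar> \<le> (\<Sum>i\<in>multi_idx m N. \<bar>y i\<bar>) powr r" for t
    using abs_multi_sum_le[of m N y t] assms by (auto intro: powr_mono2)
qed measurable

lemma sum_multi_idx_Suc:
  fixes f :: "(nat \<Rightarrow> nat) \<Rightarrow> real"
  shows "(\<Sum>i\<in>multi_idx (Suc m) N. f i) = (\<Sum>j=1..N. \<Sum>i\<in>multi_idx m N. f (i(m := j)))"
proof -
  have "multi_idx (Suc m) N = (\<lambda>(j, i). i(m := j)) ` ({1..N} \<times> multi_idx m N)"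
    unfolding multi_idx_def lessThan_Suc PiE_insert_eq ..
  moreover have "inj_on (\<lambda>(j, i). i(m := j)) ({1..N} \<times> multi_idx m N)"
    unfolding multi_idx_def using inj_combinator[of m "{..<m}" "\<lambda>_. {1..N}"] by simp
  ultimately have "(\<Sum>i\<in>multi_idx (Suc m) N. f i) = (\<Sum>(j, i)\<in>{1..N} \<times> multi_idx m N. f (i(m := j)))"
    by (simp add: sum.reindex case_prod_unfold)
  then show ?thesis by (simp add: sum.cartesian_product)
qed

lemma multi_sum_Suc:
  "multi_sum (Suc m) N y (t(m := s)) = (\<Sum>j=1..N. multi_sum m N (\<lambda>i. y (i(m := j))) t * rademacher j s)"
proof -
  have "(\<Prod>k<m. rademacher ((i(m := j)) k) ((t(m := s)) k)) = (\<Prod>k<m. rademacher (i k) (t k))" for i j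
    by (rule prod.cong) auto
  then show ?thesis
    unfolding multi_sum_def sum_multi_idx_Suc by (simp add: sum_distrib_right sum_distrib_left mult_ac)
qed

lemma integral_cube_Suc:
  fixes f :: "_ \<Rightarrow> real"
  assumes "integrable (cube_meas (Suc m)) f"
  shows "(\<integral>t. f t \<partial>cube_meas (Suc m)) = (\<integral>t. (\<integral>s. f (t(m := s)) \<partial>unit_meas) \<partial>cube_meas m)"
  using product_sigma_finite.product_integral_insert[OF product_sigma_finite_unit, of "{..<m}" m f] assms by (simp add: lessThan_Suc)

lemma khintchine_ok_powr:
  assumes ok: "khintchine_ok r A" and r: "0 < r"
  shows "(\<Sum>j=1..n. (a j)\<^sup>2) powr (r / 2) \<le> A powr r * rademacher_moment r n a"
proof -
  define E where "E = rademacher_moment r n a"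
  have E: "0 \<le> E" unfolding E_def by (intro integral_nonneg_AE) auto
  have S: "0 \<le> (\<Sum>j=1..n. (a j)\<^sup>2)" by (intro sum_nonneg) auto
  have "sqrt (\<Sum>j=1..n. (a j)\<^sup>2) powr r \<le> (A * E powr (1 / r)) powr r"
    using ok r S unfolding khintchine_ok_def E_def by (intro powr_mono2) auto
  also have "\<dots> = A powr r * E" using khintchine_ok_ge_one[OF ok] E r by (simp add: powr_mult powr_powr)
  also have "sqrt (\<Sum>j=1..n. (a j)\<^sup>2) powr r = (\<Sum>j=1..n. (a j)\<^sup>2) powr (r / 2)"
    using S by (simp add: powr_powr flip: powr_half_sqrt)
  finally show ?thesis by (simp add: E_def)
qed

text \<open>Induction on m, splitting off the last variable. The induction hypothesis treats each
  slice with last index j, Minkowski moves the sum over j inside the integral, and the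
  one-dimensional inequality is applied in the last variable. Working with r-th powers makes the
  factors simply multiply.\<close>

lemma multi_khintchine_powr:
  assumes ok: "khintchine_ok r A" and r: "0 < r" "r \<le> 2"
  shows "(\<Sum>i\<in>multi_idx m N. (y i)\<^sup>2) powr (r / 2) \<le> (A powr r) ^ m * (\<integral>t. \<bar>multi_sum m N y t\<bar> powr r \<partial>cube_meas m)"
proof (induction m arbitrary: y)
  case 0
  interpret prob_space "cube_meas 0" by (rule prob_space_cube_meas)
  \<comment> \<open>There is exactly one extensional function on the empty index set, so the array
    has one entry and not none.\<close>
  have idx: "multi_idx 0 N = {\<lambda>_. undefined}" by (simp add: multi_idx_def)
  then have "multi_sum 0 N y = (\<lambda>_. y (\<lambda>_. undefined))" by (simp add: multi_sum_def fun_eq_iff)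
  then show ?case
    using prob_space by (simp add: idx abs_powr_conv_square del: lessThan_0 PiM_empty)
next
  case (Suc m)
  let ?Y = "(\<Sum>i\<in>multi_idx (Suc m) N. \<bar>y i\<bar>) powr r" and ?I = "\<lambda>t. \<integral>u. \<bar>multi_sum (Suc m) N y (t(m := u))\<bar> powr r \<partial>unit_meas"
  define z where "z = (\<lambda>j. multi_sum m N (\<lambda>i. y (i(m := j))))"
  have zfold: "multi_sum m N (\<lambda>i. y (i(m := j))) = z j" for j by (simp add: z_def)
  define W where "W = (\<lambda>j. \<integral>t. \<bar>z j t\<bar> powr r \<partial>cube_meas m)"
  define s where "s = 2 / r"
  have s: "1 \<le> s" using r by (simp add: s_def)
  have A: "1 \<le> A" by (rule khintchine_ok_ge_one[OF ok])
  have W0: "0 \<le> W j" for j unfolding W_def by (intro integral_nonneg_AE) auto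
  have zs: "(\<bar>z j t\<bar> powr r) powr s = (z j t)\<^sup>2" for j t
    using r by (cases "z j t = 0") (auto simp: powr_powr s_def)
  have [measurable]: "z j \<in> borel_measurable (cube_meas m)" for j unfolding z_def by measurable
  have intz: "integrable (cube_meas m) (\<lambda>t. \<bar>z j t\<bar> powr r)" for j
    unfolding z_def using r by (intro integrable_multi_sum_powr) simp
  have int2: "integrable (cube_meas m) (\<lambda>t. (\<Sum>j=1..N. (z j t)\<^sup>2) powr (1 / s))"
  proof (rule integrable_cube_bounded)
    fix t
    have "(\<Sum>j=1..N. (z j t)\<^sup>2) \<le> (\<Sum>j=1..N. (\<Sum>i\<in>multi_idx m N. \<bar>y (i(m := j))\<bar>)\<^sup>2)"
    proof (rule sum_mono)
      fix j
      have "\<bar>z j t\<bar>\<^sup>2 \<le> (\<Sum>i\<in>multi_idx m N. \<bar>y (i(m := j))\<bar>)\<^sup>2"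
        unfolding z_def by (intro power_mono abs_multi_sum_le) auto
      then show "(z j t)\<^sup>2 \<le> (\<Sum>i\<in>multi_idx m N. \<bar>y (i(m := j))\<bar>)\<^sup>2" by simp
    qed
    then show "\<bar>(\<Sum>j=1..N. (z j t)\<^sup>2) powr (1 / s)\<bar> \<le> (\<Sum>j=1..N. (\<Sum>i\<in>multi_idx m N. \<bar>y (i(m := j))\<bar>)\<^sup>2) powr (1 / s)"
      using s by (auto intro!: powr_mono2 sum_nonneg)
  qed measurable
  have Sj: "(\<Sum>i\<in>multi_idx m N. (y (i(m := j)))\<^sup>2) \<le> ((A powr r) ^ m * W j) powr s" for j
  proof -
    have "(\<Sum>i\<in>multi_idx m N. (y (i(m := j)))\<^sup>2) = ((\<Sum>i\<in>multi_idx m N. (y (i(m := j)))\<^sup>2) powr (r / 2)) powr s"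
      using r by (simp add: powr_powr s_def sum_nonneg)
    also have "\<dots> \<le> ((A powr r) ^ m * W j) powr s"
      using Suc.IH[of "\<lambda>i. y (i(m := j))"] s unfolding W_def z_def by (intro powr_mono2) auto
    finally show ?thesis .
  qed
  have "(\<Sum>i\<in>multi_idx (Suc m) N. (y i)\<^sup>2) powr (r / 2) \<le> (\<Sum>j=1..N. ((A powr r) ^ m * W j) powr s) powr (r / 2)"
    unfolding sum_multi_idx_Suc using r Sj by (intro powr_mono2 sum_mono sum_nonneg) auto
  also have "(\<Sum>j=1..N. ((A powr r) ^ m * W j) powr s) = ((A powr r) ^ m) powr s * (\<Sum>j=1..N. W j powr s)"
    by (simp add: powr_mult sum_distrib_left)
  also have "\<dots> powr (r / 2) = (A powr r) ^ m * (\<Sum>j=1..N. W j powr s) powr (1 / s)"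
    using A r by (simp add: powr_mult powr_powr s_def)
  \<comment> \<open>Minkowski with exponent s = 2/r for the functions \<bar>z_j\<bar>^r; s \<ge> 1
    is the assumption r \<le> 2.\<close>
  also have "\<dots> \<le> (A powr r) ^ m * (\<integral>t. (\<Sum>j=1..N. (z j t)\<^sup>2) powr (1 / s) \<partial>cube_meas m)"
  proof (intro mult_left_mono)
    show "(\<Sum>j=1..N. W j powr s) powr (1 / s) \<le> (\<integral>t. (\<Sum>j=1..N. (z j t)\<^sup>2) powr (1 / s) \<partial>cube_meas m)"
      using minkowski_integral_sum[of "{1..N}" s "\<lambda>j t. \<bar>z j t\<bar> powr r" "cube_meas m"] s intz int2
      unfolding zs W_def by simp
  qed simp
  also have "\<dots> \<le> (A powr r) ^ m * (\<integral>t. A powr r * ?I t \<partial>cube_meas m)"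
  proof (intro mult_left_mono integral_mono int2)
    \<comment> \<open>The inner integral is rewritten as a finite sign average of the slices, so its
      measurability in t follows by recursion on the list.\<close>
    have "integrable (cube_meas m) ?I"
      unfolding multi_sum_Suc integral_sum_rademacher_powr zfold
    proof (rule integrable_cube_bounded)
      have "(\<lambda>t. sgn_moment r (map (\<lambda>j. z j t) [1..<Suc N]) (c t)) \<in> borel_measurable (cube_meas m)"
        if "c \<in> borel_measurable (cube_meas m)" for c
      proof -
        have "(\<lambda>t. sgn_moment r (map (\<lambda>j. z j t) js) (c t)) \<in> borel_measurable (cube_meas m)" for js
          using that
        proof (induction js arbitrary: c)
          case (Cons j js)
          have "(\<lambda>t. c t + z j t) \<in> borel_measurable (cube_meas m)" "(\<lambda>t. c t - z j t) \<in> borel_measurable (cube_meas m)"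
            using Cons.prems by measurable
          then show ?case using Cons.IH by simp
        qed simp
        then show ?thesis .
      qed
      then show "(\<lambda>t. sgn_moment r (map (\<lambda>j. z j t) [1..<Suc N]) 0) \<in> borel_measurable (cube_meas m)"
        by simp
      fix t
      show "\<bar>sgn_moment r (map (\<lambda>j. z j t) [1..<Suc N]) 0\<bar> \<le> ?Y"
      proof -
        interpret prob_space unit_meas by (rule prob_space_unit_meas)
        have "?I t \<le> (\<integral>u. ?Y \<partial>unit_meas)"
        proof (rule integral_mono')
          show "\<bar>multi_sum (Suc m) N y (t(m := u))\<bar> powr r \<le> ?Y" for u
            using r by (intro powr_mono2 abs_multi_sum_le) auto
        qed auto
        also have "\<dots> = ?Y" using prob_space by simp
        finally show ?thesis
          unfolding multi_sum_Suc integral_sum_rademacher_powr zfold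
          using sgn_avg_nonneg[of "\<lambda>x. \<bar>x\<bar> powr r" "map (\<lambda>j. z j t) [1..<Suc N]" 0] by simp
      qed
    qed
    then show "integrable (cube_meas m) (\<lambda>t. A powr r * ?I t)"
      by simp
    fix t
    show "(\<Sum>j=1..N. (z j t)\<^sup>2) powr (1 / s) \<le> A powr r * ?I t"
      using khintchine_ok_powr[OF ok r(1), of "\<lambda>j. z j t" N] unfolding multi_sum_Suc z_def by (simp add: s_def)
  qed simp
  also have "\<dots> = (A powr r) ^ Suc m * (\<integral>t. \<bar>multi_sum (Suc m) N y t\<bar> powr r \<partial>cube_meas (Suc m))"
    using integral_cube_Suc[OF integrable_multi_sum_powr[of r "Suc m" N y]] r by simp
  finally show ?case .
qed

lemma multi_khintchine_ok_power:
  assumes ok: "khintchine_ok r A" and r: "0 < r" "r \<le> 2"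
  shows "multi_khintchine_ok m r (A ^ m)"
  unfolding multi_khintchine_ok_def multi_sum_def[symmetric]
proof (intro allI)
  fix N and y :: "(nat \<Rightarrow> nat) \<Rightarrow> real"
  define E where "E = (\<integral>t. \<bar>multi_sum m N y t\<bar> powr r \<partial>cube_meas m)"
  define S where "S = (\<Sum>i\<in>multi_idx m N. (y i)\<^sup>2)"
  have A: "1 \<le> A" by (rule khintchine_ok_ge_one[OF ok])
  have S: "0 \<le> S" unfolding S_def by (intro sum_nonneg) auto
  have E: "0 \<le> E" unfolding E_def by (intro integral_nonneg_AE) auto
  have "sqrt S = (S powr (r / 2)) powr (1 / r)" using r S by (simp add: powr_powr powr_half_sqrt)
  also have "\<dots> \<le> ((A powr r) ^ m * E) powr (1 / r)"
    unfolding S_def E_def using r multi_khintchine_powr[OF ok r] by (intro powr_mono2) auto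
  also have "(A powr r) ^ m = (A ^ m) powr r" using A by (simp add: powr_powr mult.commute flip: powr_realpow)
  also have "((A ^ m) powr r * E) powr (1 / r) = A ^ m * E powr (1 / r)"
    using A E r by (simp add: powr_mult powr_powr)
  finally show "sqrt S \<le> A ^ m * E powr (1 / r)" .
qed

text \<open>For r = 2 the constant is 1, so S is bounded by the second moment; the tangent
  inequality at S then passes from the second to the r-th moment on the probability space.\<close>

lemma multi_khintchine_ok_ge_2:
  assumes r: "2 \<le> r"
  shows "multi_khintchine_ok m r 1"
  unfolding multi_khintchine_ok_def multi_sum_def[symmetric]
proof (intro allI)
  fix N and y :: "(nat \<Rightarrow> nat) \<Rightarrow> real"
  let ?X = "multi_sum m N y"
  interpret prob_space "cube_meas m" by (rule prob_space_cube_meas)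
  define E where "E = (\<integral>t. \<bar>?X t\<bar> powr r \<partial>cube_meas m)"
  define S where "S = (\<Sum>i\<in>multi_idx m N. (y i)\<^sup>2)"
  have S: "0 \<le> S" unfolding S_def by (intro sum_nonneg) auto
  let ?v = "\<lambda>x. (1 - r / 2) * S powr (r / 2) + (r / 2 * S powr (r / 2 - 1)) * x" and ?M = "(\<integral>t. (?X t)\<^sup>2 \<partial>cube_meas m)"
  have E: "0 \<le> E" unfolding E_def by (intro integral_nonneg_AE) auto
  have int2: "integrable (cube_meas m) (\<lambda>t. (?X t)\<^sup>2)"
    using integrable_multi_sum_powr[of 2 m N y] by simp
  have S2: "S \<le> ?M"
    using multi_khintchine_powr[OF A_const_ge_2(1)[of 2], where m = m and N = N and y = y] S by (simp add: S_def)
  have "S powr (r / 2) \<le> E"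
  proof (cases "S = 0")
    case False
    then have S0: "0 < S" using S by simp
    have "S powr (r / 2) = ?v S"
      using S0 by (simp add: powr_diff algebra_simps)
    also have "\<dots> \<le> ?v ?M"
      using S2 r by (intro add_left_mono mult_left_mono) auto
    also have "\<dots> = (\<integral>t. ?v ((?X t)\<^sup>2) \<partial>cube_meas m)"
      using int2 prob_space by simp
    also have "\<dots> \<le> E"
      unfolding E_def
    proof (rule integral_mono)
      show "integrable (cube_meas m) (\<lambda>t. ?v ((?X t)\<^sup>2))"
        using int2 by simp
      show "integrable (cube_meas m) (\<lambda>t. \<bar>?X t\<bar> powr r)" using r by (intro integrable_multi_sum_powr) simp
    qed (rule powr_ge_tangent_square[OF r S0])
    finally show ?thesis .
  qed (use E in simp)
  then have "(S powr (r / 2)) powr (1 / r) \<le> E powr (1 / r)" using r by (intro powr_mono2) auto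
  moreover have "(S powr (r / 2)) powr (1 / r) = sqrt S" using r S by (simp add: powr_powr powr_half_sqrt)
  ultimately show "sqrt S \<le> 1 * E powr (1 / r)" by simp
qed

text \<open>For a product array both sides factor over the m coordinates, so K must bound the m-th
  power of any one-dimensional quotient.\<close>

lemma multi_khintchine_tensor:
  assumes ok: "multi_khintchine_ok m r K" and r: "0 < r"
  shows "sqrt (\<Sum>j=1..n. (a j)\<^sup>2) ^ m \<le> K * (rademacher_moment r n a powr (1 / r)) ^ m"
proof -
  define y where "y = (\<lambda>i::nat \<Rightarrow> nat. \<Prod>k<m. a (i k))"
  define E where "E = rademacher_moment r n a"
  have E: "0 \<le> E" unfolding E_def by (intro integral_nonneg_AE) auto
  have "(\<Sum>i\<in>multi_idx m n. (y i)\<^sup>2) = (\<Prod>k<m. \<Sum>j\<in>{1..n}. (a j)\<^sup>2)"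
    unfolding multi_idx_def y_def prod_power_distrib by (rule prod_sum_PiE[symmetric]) auto
  then have lhs: "sqrt (\<Sum>i\<in>multi_idx m n. (y i)\<^sup>2) = sqrt (\<Sum>j=1..n. (a j)\<^sup>2) ^ m"
    by (simp add: real_sqrt_power)
  have X: "multi_sum m n y t = (\<Prod>k<m. \<Sum>j=1..n. a j * rademacher j (t k))" for t
    unfolding multi_sum_def multi_idx_def y_def
    by (subst prod_sum_PiE) (auto simp: prod.distrib mult.commute)
  have "(\<integral>t. \<bar>multi_sum m n y t\<bar> powr r \<partial>cube_meas m) = (\<integral>t. (\<Prod>k<m. \<bar>\<Sum>j=1..n. a j * rademacher j (t k)\<bar> powr r) \<partial>cube_meas m)"
    unfolding X by (simp add: abs_prod prod_powr_distrib)
  also have "\<dots> = (\<Prod>k<m. E)"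
    unfolding E_def
  proof (rule product_sigma_finite.product_integral_prod[OF product_sigma_finite_unit])
    interpret prob_space unit_meas by (rule prob_space_unit_meas)
    fix k
    show "integrable unit_meas (\<lambda>t. \<bar>\<Sum>j=1..n. a j * rademacher j t\<bar> powr r)"
    proof -
      have "\<bar>\<Sum>j=1..n. a j * rademacher j t\<bar> \<le> (\<Sum>j=1..n. \<bar>a j\<bar>)" for t
        by (rule order.trans[OF sum_abs sum_mono]) (auto simp: abs_mult intro: mult_right_le_one_le abs_rademacher_le)
      then show ?thesis
        using r by (intro integrable_const_bound[where B = "(\<Sum>j=1..n. \<bar>a j\<bar>) powr r"]) (auto intro!: powr_mono2)
    qed
  qed simp
  finally have "(\<integral>t. \<bar>multi_sum m n y t\<bar> powr r \<partial>cube_meas m) = E ^ m" by simp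
  moreover have "(E ^ m) powr (1 / r) = (E powr (1 / r)) ^ m"
  proof (cases "E = 0")
    case False
    then show ?thesis using E by (simp add: powr_powr mult.commute flip: powr_realpow)
  qed (cases m; simp)
  ultimately show ?thesis
    using ok[unfolded multi_khintchine_ok_def multi_sum_def[symmetric], rule_format, where N = n and y = y]
    unfolding lhs E_def by simp
qed

theorem theorem3p4:
  fixes r :: real and m :: nat
  assumes "0 < r" and "1 \<le> m"
  shows "K_const m r = (A_const r) ^ m
    \<and> (2 \<le> r \<longrightarrow> K_const m r = 1)
    \<and> (r \<le> p0 \<longrightarrow> K_const m r = (2 powr (1 / r - 1 / 2)) ^ m)
    \<and> (p0 < r \<and> r < 2 \<longrightarrow>
         K_const m r = (1 / sqrt 2 * (Gamma ((r + 1) / 2) / sqrt pi) powr (- 1 / r)) ^ m)"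
proof -
  have ok: "khintchine_ok r (A_const r)"
    using A_const_ge_2[of r] A_const_le_p0[of r] A_const_between[of r] assms(1) by (cases "2 \<le> r"; cases "r \<le> p0") auto
  have multi_ok: "multi_khintchine_ok m r (A_const r ^ m)"
    using multi_khintchine_ok_power[OF ok assms(1)] multi_khintchine_ok_ge_2[of r m] A_const_ge_2(2)[of r]
    by (cases "r \<le> 2") auto
  have "A_const r ^ m \<le> K" if K: "multi_khintchine_ok m r K" for K
  proof -
    \<comment> \<open>A single coefficient shows it; K is thus nonnegative and its m-th root below
      is meaningful.\<close>
    have "1 \<le> K"
    proof -
      interpret prob_space unit_meas by (rule prob_space_unit_meas)
      have "(\<integral>t. \<bar>\<Sum>j=1..1. 1 * rademacher j t\<bar> powr r \<partial>unit_meas) = 1"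
        unfolding integral_sum_rademacher_powr by simp
      then show ?thesis using multi_khintchine_tensor[OF K assms(1), where n = 1 and a = "\<lambda>_. 1"] by simp
    qed
    \<comment> \<open>By the tensor inequality B is an admissible one-dimensional constant, hence at
      least \<open>A_const r\<close>.\<close>
    define B where "B = root m K"
    have B: "0 \<le> B" "B ^ m = K" using \<open>1 \<le> K\<close> assms(2) by (auto simp: B_def)
    have "khintchine_ok r B"
      unfolding khintchine_ok_def
    proof (intro allI)
      fix n and a :: "nat \<Rightarrow> real"
      have "sqrt (\<Sum>j=1..n. (a j)\<^sup>2) ^ m \<le> (B * rademacher_moment r n a powr (1 / r)) ^ m"
        using multi_khintchine_tensor[OF K assms(1), where n = n and a = a] by (simp add: power_mult_distrib B)
      then show "sqrt (\<Sum>j=1..n. (a j)\<^sup>2) \<le> B * rademacher_moment r n a powr (1 / r)"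
        by (rule power_mono_iff[THEN iffD1, rotated 3]) (use assms(2) B in \<open>auto intro: sum_nonneg\<close>)
    qed
    then have "A_const r \<le> B"
      unfolding A_const_def using khintchine_ok_ge_one by (intro cInf_lower bdd_belowI[of _ 1]) auto
    moreover have "0 \<le> A_const r" using khintchine_ok_ge_one[OF ok] by simp
    ultimately show ?thesis using power_mono[of "A_const r" B m] B by simp
  qed
  then have "K_const m r = A_const r ^ m"
    unfolding K_const_def using multi_ok by (intro cInf_eq_minimum) auto
  then show ?thesis
    using A_const_ge_2(2)[of r] A_const_le_p0(2)[of r] A_const_between(2)[of r] assms by auto
qed

end
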